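(* Let $K$ be an algebraically closed field, let $1<r<m\le n$ and $p\ge 1$ be integers, and let $\mathscr{L}^{m,n}_{r,p-1}$ be the $(p-1)$-th jet scheme of the determinantal variety of $m\times n$ matrices defined by the $r\times r$ minors. Let $\lambda=(\lambda_1,\dots,\lambda_m)$ be an admissible pre-partition for $(m,r,p)$ (see context). For $1\le s\le m$ put $i_s=\lambda_m+\lambda_{m-1}+\dots+\lambda_{m-s+1}$ and $j_s=\lceil i_s/s\rceil$. Let $\tilde{\Omega_{\lambda}'}$ be the family of polynomials consisting of all elements of $\tilde{\Theta}_{1,0},\dots,\tilde{\Theta}_{1,i_1-1}$, together with, for each $1\le s\le m-1$ such that $i_s+j_s<i_{s+1}$, all elements of $\tilde{\Theta}_{s+1,i_s+j_s},\dots,\tilde{\Theta}_{s+1,i_{s+1}-1}$. Then $\tilde{\Omega_{\lambda}'}$ defines the irreducible component of $\mathscr{L}^{m,n}_{r,p-1}$ corresponding to $\lambda$; that is, the zero locus of $\tilde{\Omega_{\lambda}'}$ in the affine space with coordinates $x_{i,j}^{(l)}$ ($1\le i\le m$, $1\le j\le n$, $0\le l\le p-1$) is exactly that irreducible component.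
   Context: Jet scheme: $\mathscr{L}^{m,n}_{r,p-1}$ is the closed subscheme of the affine space $\mathcal{M}_{p-1}$ with coordinates $x_{i,j}^{(l)}$ ($1\le i\le m$, $1\le j\le n$, $0\le l\le p-1$) defined by the coefficients of $t^0,\dots,t^{p-1}$ of all $r\times r$ minors of the matrix with entries $x_{i,j}^{(0)}+x_{i,j}^{(1)}t+\dots+x_{i,j}^{(p-1)}t^{p-1}$. Polynomial families: $\tilde{\Theta}_{s,\alpha}$ is the set of all polynomials in the $x_{i,j}^{(l)}$ ($0\le l\le p-1$) that occur as the coefficient of $t^{\alpha}$ in some $s\times s$ minor of the $m\times n$ matrix with entries $x_{i,j}^{(0)}+x_{i,j}^{(1)}t+\dots+x_{i,j}^{(p-1)}t^{p-1}$ (the minors being computed in the polynomial ring in $t$, without truncation). Admissible pre-partitions: $\lambda=(\lambda_1\ge\dots\ge\lambda_m)$ is admissible for $(m,r,p)$ if $\lambda=(d,\dots,d,e,0,\dots,0)$ where $d\geq 1$, $e$, $a$ are integers with $p=(a+1)d+e$, $0\le e<d$, either ($e=0$ and $0\le a\le r-1$) or ($e>0$ and $0\le a<r-1$), and exactly $a+m-r+1$ entries of $\lambda$ are equal to $d$ (followed by $e$, then zeros, for a total of $m$ entries). Component corresponding to $\lambda$: let $\mathcal{M}_\infty$ be the arc space of the space of $m\times n$ matrices, whose points are the $m\times n$ matrices over $K[[t]]$, with the action of $G_\infty=GL_m(K[[t]])\times GL_n(K[[t]])$ by $(g,h)\cdot A=gAh^{-1}$. Let $\delta_\lambda$ be the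 $m\times n$ matrix whose first $n-m$ columns are zero and whose last $m$ columns form the diagonal matrix $\mathrm{diag}(t^{\lambda_1},\dots,t^{\lambda_m})$, let $\mathcal{C}_\lambda$ be the $G_\infty$-orbit of $\delta_\lambda$, let $\overline{\mathcal{C}_\lambda}$ be its Zariski closure in $\mathcal{M}_\infty$, and let $\pi_{\infty,p-1}:\mathcal{M}_\infty\to\mathcal{M}_{p-1}$ be truncation modulo $t^{p}$. By a known result (Docampo), for $1<r<m$, $\lambda\mapsto \pi_{\infty,p-1}(\overline{\mathcal{C}_\lambda})$ is a bijection from admissible pre-partitions to the irreducible components of $\mathscr{L}^{m,n}_{r,p-1}$; the component corresponding to $\lambda$ is $\pi_{\infty,p-1}(\overline{\mathcal{C}_\lambda})$. *)

theory Defs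
  imports
    "HOL-Library.Poly_Mapping"
    "HOL-Library.FuncSet"
    "HOL-Computational_Algebra.Formal_Power_Series"
    "HOL-Analysis.Abstract_Topology"
    "Jordan_Normal_Form.Determinant"
    "Jordan_Normal_Form.DL_Submatrix"
begin

text \<open>
  A polynomial is a finitely supported map from monomials to coefficients, a monomial
  being a finitely supported map from variables to exponents; the ring structure is the
  convolution ring of \<^theory>\<open>HOL-Library.Poly_Mapping\<close>.
\<close>

type_synonym ('v, 'a) mpoly = "('v \<Rightarrow>\<^sub>0 nat) \<Rightarrow>\<^sub>0 'a"

definition mvar :: "'v \<Rightarrow> ('v, 'a::comm_ring_1) mpoly" where
  "mvar v = Poly_Mapping.single (Poly_Mapping.single v 1) 1"

definition mpolys :: "'v set \<Rightarrow> ('v, 'a::comm_ring_1) mpoly set" where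
  "mpolys V = {f. \<forall>\<mu>\<in>Poly_Mapping.keys f. Poly_Mapping.keys \<mu> \<subseteq> V}"

definition mono_eval :: "('v \<Rightarrow> 'a::comm_ring_1) \<Rightarrow> ('v \<Rightarrow>\<^sub>0 nat) \<Rightarrow> 'a" where
  "mono_eval x \<mu> = (\<Prod>v\<in>Poly_Mapping.keys \<mu>. x v ^ Poly_Mapping.lookup \<mu> v)"

definition mpoly_eval :: "('v \<Rightarrow> 'a::comm_ring_1) \<Rightarrow> ('v, 'a) mpoly \<Rightarrow> 'a" where
  "mpoly_eval x f = (\<Sum>\<mu>\<in>Poly_Mapping.keys f. Poly_Mapping.lookup f \<mu> * mono_eval x \<mu>)"

text \<open>
  The (possibly infinite-dimensional) affine space with coordinates indexed by \<open>V\<close>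
  consists of the functions on \<open>V\<close>, made extensional (value \<^const>\<open>undefined\<close>
  outside \<open>V\<close>).
\<close>

definition affine_space :: "'v set \<Rightarrow> ('v \<Rightarrow> 'a) set" where
  "affine_space V = V \<rightarrow>\<^sub>E UNIV"

definition zero_locus :: "'v set \<Rightarrow> ('v, 'a::comm_ring_1) mpoly set \<Rightarrow> ('v \<Rightarrow> 'a) set" where
  "zero_locus V F = {x \<in> affine_space V. \<forall>f\<in>F. mpoly_eval x f = 0}"

definition zariski :: "'v set \<Rightarrow> ('v \<Rightarrow> 'a::idom) topology" where
  "zariski V = topology (\<lambda>U. \<exists>F \<subseteq> mpolys V. U = affine_space V - zero_locus V F)"

definition irreducible_set :: "'b topology \<Rightarrow> 'b set \<Rightarrow> bool" where
  "irreducible_set X S \<longleftrightarrow> S \<subseteq> topspace X \<and> S \<noteq> {} \<and>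
     (\<forall>A B. closedin X A \<longrightarrow> closedin X B \<longrightarrow> S \<subseteq> A \<union> B \<longrightarrow> S \<subseteq> A \<or> S \<subseteq> B)"

definition irreducible_components :: "'b topology \<Rightarrow> 'b set set" where
  "irreducible_components X =
     {S. irreducible_set X S \<and> (\<forall>T. irreducible_set X T \<longrightarrow> S \<subseteq> T \<longrightarrow> T = S)}"

lemma mono_eval_superset:
  assumes "finite S" "Poly_Mapping.keys \<mu> \<subseteq> S"
  shows "mono_eval x \<mu> = (\<Prod>v\<in>S. x v ^ Poly_Mapping.lookup \<mu> v)"
  unfolding mono_eval_def
  by (rule prod.mono_neutral_left) (use assms in \<open>auto simp: in_keys_iff\<close>)

lemma mono_eval_0 [simp]: "mono_eval x 0 = 1"
  by (simp add: mono_eval_def)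

lemma mono_eval_add: "mono_eval x (\<mu> + \<nu>) = mono_eval x \<mu> * mono_eval x \<nu>"
proof -
  let ?S = "Poly_Mapping.keys \<mu> \<union> Poly_Mapping.keys \<nu>"
  have "Poly_Mapping.keys (\<mu> + \<nu>) \<subseteq> ?S"
    by (rule Poly_Mapping.keys_add)
  then show ?thesis
    by (subst (1 2 3) mono_eval_superset[of ?S])
       (auto simp: lookup_add power_add prod.distrib)
qed

lemma mpoly_eval_superset:
  assumes "finite S" "Poly_Mapping.keys f \<subseteq> S"
  shows "mpoly_eval x f = (\<Sum>\<mu>\<in>S. Poly_Mapping.lookup f \<mu> * mono_eval x \<mu>)"
  unfolding mpoly_eval_def
  by (rule sum.mono_neutral_left) (use assms in \<open>auto simp: in_keys_iff\<close>)

lemma mpoly_eval_0 [simp]: "mpoly_eval x 0 = 0"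
  by (simp add: mpoly_eval_def)

lemma mpoly_eval_single [simp]: "mpoly_eval x (Poly_Mapping.single \<mu> c) = c * mono_eval x \<mu>"
  by (simp add: mpoly_eval_superset[of "{\<mu>}"])

lemma mpoly_eval_1 [simp]: "mpoly_eval x 1 = 1"
  using mpoly_eval_single[of x 0 1] by simp

lemma mpoly_eval_mvar [simp]: "mpoly_eval x (mvar v) = x v"
  by (simp add: mvar_def mono_eval_def)

lemma mpoly_eval_add: "mpoly_eval x (f + g) = mpoly_eval x f + mpoly_eval x g"
proof -
  let ?S = "Poly_Mapping.keys f \<union> Poly_Mapping.keys g"
  have "Poly_Mapping.keys (f + g) \<subseteq> ?S"
    by (rule Poly_Mapping.keys_add)
  then show ?thesis
    by (subst (1 2 3) mpoly_eval_superset[of ?S])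
       (auto simp: lookup_add algebra_simps sum.distrib)
qed

lemma mpoly_add_single_induct:
  fixes f :: "'b \<Rightarrow>\<^sub>0 'c::comm_monoid_add"
  assumes "P 0" "\<And>f \<mu> c. P f \<Longrightarrow> P (f + Poly_Mapping.single \<mu> c)"
  shows "P f"
proof (induction f rule: update_induct)
  case const
  show ?case by (fact assms(1))
next
  case (update f \<mu> c)
  have "Poly_Mapping.update \<mu> c f = f + Poly_Mapping.single \<mu> c"
    using update.hyps
    by (intro poly_mapping_eqI) (auto simp: lookup_update lookup_add lookup_single in_keys_iff when_def)
  then show ?case
    using assms(2) update.IH by simp
qed

lemma mpoly_eval_mult: "mpoly_eval x (f * g) = mpoly_eval x f * mpoly_eval x g"
proof -
  have single: "mpoly_eval x (Poly_Mapping.single \<mu> c * g) = c * mono_eval x \<mu> * mpoly_eval x g"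
    for \<mu> c
    by (induction g rule: mpoly_add_single_induct)
       (simp_all add: distrib_left mpoly_eval_add mult_single mono_eval_add mult_ac)
  show ?thesis
    by (induction f rule: mpoly_add_single_induct)
       (simp_all add: distrib_right mpoly_eval_add single)
qed

lemma mpolys_1 [simp]: "1 \<in> mpolys V"
  by (simp add: mpolys_def)

lemma mpolys_mult:
  assumes "f \<in> mpolys V" "g \<in> mpolys V"
  shows "f * g \<in> mpolys V"
proof -
  have "Poly_Mapping.keys \<mu> \<subseteq> V" if \<mu>: "\<mu> \<in> Poly_Mapping.keys (f * g)" for \<mu>
  proof -
    obtain \<alpha> \<beta> where "\<mu> = \<alpha> + \<beta>" "\<alpha> \<in> Poly_Mapping.keys f" "\<beta> \<in> Poly_Mapping.keys g"
      using \<mu> Poly_Mapping.keys_mult[of f g] by blast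
    then show ?thesis
      using assms Poly_Mapping.keys_add[of \<alpha> \<beta>] unfolding mpolys_def by blast
  qed
  then show ?thesis unfolding mpolys_def by blast
qed

lemma zero_locus_Un:
  fixes F G :: "('v, 'a::idom) mpoly set"
  shows "zero_locus V F \<union> zero_locus V G = zero_locus V {f * g | f g. f \<in> F \<and> g \<in> G}"
  by (fastforce simp: zero_locus_def mpoly_eval_mult)

lemma istopology_zariski:
  "istopology (\<lambda>U :: ('v \<Rightarrow> 'a::idom) set.
     \<exists>F \<subseteq> mpolys V. U = affine_space V - zero_locus V F)"
  unfolding istopology_def
proof (intro conjI allI impI)
  fix S T :: "('v \<Rightarrow> 'a) set"
  assume "\<exists>F \<subseteq> mpolys V. S = affine_space V - zero_locus V F"
    and "\<exists>F \<subseteq> mpolys V. T = affine_space V - zero_locus V F"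
  then obtain F G where "F \<subseteq> mpolys V" "G \<subseteq> mpolys V"
    and "S = affine_space V - zero_locus V F" "T = affine_space V - zero_locus V G"
    by blast
  then have "S \<inter> T = affine_space V - zero_locus V {f * g | f g. f \<in> F \<and> g \<in> G}"
    and "{f * g | f g. f \<in> F \<and> g \<in> G} \<subseteq> mpolys V"
    using zero_locus_Un[of V F G] mpolys_mult by blast+
  then show "\<exists>F \<subseteq> mpolys V. S \<inter> T = affine_space V - zero_locus V F"
    by blast
next
  fix \<K> :: "('v \<Rightarrow> 'a) set set"
  assume "\<forall>K\<in>\<K>. \<exists>F \<subseteq> mpolys V. K = affine_space V - zero_locus V F"
  then obtain F where "\<forall>K\<in>\<K>. F K \<subseteq> mpolys V \<and> K = affine_space V - zero_locus V (F K)"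
    by metis
  then have "\<Union>(F ` \<K>) \<subseteq> mpolys V"
    and "\<Union>\<K> = affine_space V - zero_locus V (\<Union>(F ` \<K>))"
    unfolding zero_locus_def by blast+
  then show "\<exists>F \<subseteq> mpolys V. \<Union>\<K> = affine_space V - zero_locus V F"
    by blast
qed

lemma openin_zariski:
  "openin (zariski V) U \<longleftrightarrow> (\<exists>F \<subseteq> mpolys V. U = affine_space V - zero_locus V F)"
  unfolding zariski_def by (simp add: istopology_zariski)

lemma topspace_zariski [simp]:
  "topspace (zariski V :: ('v \<Rightarrow> 'a::idom) topology) = affine_space V"
proof -
  have "affine_space V - zero_locus V {1} = (affine_space V :: ('v \<Rightarrow> 'a) set)"
    by (auto simp: zero_locus_def)
  then have "openin (zariski V) (affine_space V :: ('v \<Rightarrow> 'a) set)"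
    unfolding openin_zariski by (intro exI[of _ "{1}"]) auto
  then show ?thesis
    unfolding topspace_def openin_zariski by blast
qed

lemma closedin_zariski:
  fixes Z :: "('v \<Rightarrow> 'a::idom) set"
  shows "closedin (zariski V) Z \<longleftrightarrow> (\<exists>F \<subseteq> mpolys V. Z = zero_locus V F)"
proof -
  have "zero_locus V F \<subseteq> affine_space V" for F :: "('v, 'a) mpoly set"
    by (auto simp: zero_locus_def)
  then show ?thesis
    unfolding closedin_def openin_zariski topspace_zariski by (metis double_diff subset_refl)
qed

text \<open>
  The coordinate \<open>(i, j, l)\<close> is the coefficient of \<open>t\<^sup>l\<close> in the entry in row \<open>i\<close> and column
  \<open>j\<close>. Rows and columns are numbered from 0, as usual for \<^typ>\<open>'a mat\<close>.
\<close>

type_synonym coord = "nat \<times> nat \<times> nat"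

definition jet_coords :: "nat \<Rightarrow> nat \<Rightarrow> nat \<Rightarrow> coord set" where
  "jet_coords m n p = {(i, j, l). i < m \<and> j < n \<and> l < p}"

definition arc_coords :: "nat \<Rightarrow> nat \<Rightarrow> coord set" where
  "arc_coords m n = {(i, j, l). i < m \<and> j < n}"

definition generic_matrix :: "nat \<Rightarrow> nat \<Rightarrow> nat \<Rightarrow> (coord, 'a::comm_ring_1) mpoly poly mat" where
  "generic_matrix m n p = mat m n (\<lambda>(i, j). \<Sum>l<p. monom (mvar (i, j, l)) l)"

definition minor_coeffs ::
  "nat \<Rightarrow> nat \<Rightarrow> nat \<Rightarrow> nat \<Rightarrow> nat \<Rightarrow> (coord, 'a::comm_ring_1) mpoly set" where
  "minor_coeffs m n p s \<alpha> =
     {coeff (det (submatrix (generic_matrix m n p) I J)) \<alpha> | I J.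
        I \<subseteq> {..<m} \<and> J \<subseteq> {..<n} \<and> card I = s \<and> card J = s}"

text \<open>The jet scheme as a set of points with coordinates in the base field.\<close>

definition jet_scheme :: "nat \<Rightarrow> nat \<Rightarrow> nat \<Rightarrow> nat \<Rightarrow> (coord \<Rightarrow> 'a::idom) set" where
  "jet_scheme m n r p = zero_locus (jet_coords m n p) (\<Union>\<alpha><p. minor_coeffs m n p r \<alpha>)"

definition arc_of_mat :: "nat \<Rightarrow> nat \<Rightarrow> 'a fps mat \<Rightarrow> coord \<Rightarrow> 'a" where
  "arc_of_mat m n A = (\<lambda>(i, j, l)\<in>arc_coords m n. fps_nth (A $$ (i, j)) l)"

definition truncate_arc :: "nat \<Rightarrow> nat \<Rightarrow> nat \<Rightarrow> (coord \<Rightarrow> 'a) \<Rightarrow> coord \<Rightarrow> 'a" where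
  "truncate_arc m n p x = restrict x (jet_coords m n p)"

text \<open>
  A pre-partition \<open>\<lambda>\<^sub>1 \<ge> \<dots> \<ge> \<lambda>\<^sub>m\<close> is a list of length \<open>m\<close>, so that \<open>\<lambda>\<^sub>k\<close> is
  \<open>lam ! (k - 1)\<close>. When \<open>e = 0\<close> the entry \<open>e\<close> is one of the zeros, and it is absent
  if \<open>a + m - r + 1 = m\<close>.
\<close>

definition admissible :: "nat \<Rightarrow> nat \<Rightarrow> nat \<Rightarrow> nat list \<Rightarrow> bool" where
  "admissible m r p lam \<longleftrightarrow> length lam = m \<and>
     (\<exists>d e a :: nat. d \<ge> 1 \<and> p = (a + 1) * d + e \<and> e < d \<and>
        (e = 0 \<and> a \<le> r - 1 \<or> e > 0 \<and> a < r - 1) \<and>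
        (\<forall>k<m. lam ! k = (if k < a + (m - r) + 1 then d
                           else if k = a + (m - r) + 1 then e else 0)))"

definition delta_mat :: "nat \<Rightarrow> nat \<Rightarrow> nat list \<Rightarrow> 'a::comm_ring_1 fps mat" where
  "delta_mat m n lam = mat m n (\<lambda>(i, j). if j = (n - m) + i then fps_X ^ (lam ! i) else 0)"

definition orbit :: "nat \<Rightarrow> nat \<Rightarrow> nat list \<Rightarrow> 'a::comm_ring_1 fps mat set" where
  "orbit m n lam = {g * delta_mat m n lam * h' | g h h'.
     g \<in> carrier_mat m m \<and> invertible_mat g \<and>
     h \<in> carrier_mat n n \<and> h' \<in> carrier_mat n n \<and> inverts_mat h h' \<and> inverts_mat h' h}"

definition jet_component :: "nat \<Rightarrow> nat \<Rightarrow> nat \<Rightarrow> nat list \<Rightarrow> (coord \<Rightarrow> 'a::idom) set" where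
  "jet_component m n p lam =
     truncate_arc m n p ` (zariski (arc_coords m n) closure_of (arc_of_mat m n ` orbit m n lam))"

definition tail_sum :: "nat list \<Rightarrow> nat \<Rightarrow> nat" where
  "tail_sum lam s = (\<Sum>k\<in>{length lam - s..<length lam}. lam ! k)"

definition tail_mean_ceil :: "nat list \<Rightarrow> nat \<Rightarrow> nat" where
  "tail_mean_ceil lam s = nat \<lceil>real (tail_sum lam s) / real s\<rceil>"

definition Omega' :: "nat \<Rightarrow> nat \<Rightarrow> nat \<Rightarrow> nat list \<Rightarrow> (coord, 'a::comm_ring_1) mpoly set" where
  "Omega' m n p lam =
     (\<Union>\<alpha>\<in>{0..<tail_sum lam 1}. minor_coeffs m n p 1 \<alpha>) \<union>
     (\<Union>s\<in>{s. 1 \<le> s \<and> s \<le> m - 1 \<and> tail_sum lam s + tail_mean_ceil lam s < tail_sum lam (s + 1)}.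
        \<Union>\<alpha>\<in>{tail_sum lam s + tail_mean_ceil lam s..<tail_sum lam (s + 1)}.
          minor_coeffs m n p (s + 1) \<alpha>)"

end

theory Submission
  imports Defs
begin

text \<open>
  Let \<open>M\<^sub>s\<close> be the sum of the \<open>s\<close> smallest entries of \<open>\<lambda>\<close>. For an \<open>(s + 1) \<times> (s + 1)\<close> matrix \<open>B\<close> over
  \<open>K[[t]]\<close> the identity \<open>det (adj B) = det B ^ s\<close> shows that if all \<open>s\<close>-minors have order at least
  \<open>q\<close>, then \<open>ord (det B) \<ge> q + \<lceil>q / s\<rceil>\<close>. By induction on \<open>s\<close>, the polynomials in \<open>\<Omega>'\<close>
  therefore cut out exactly the jets all of whose \<open>s\<close>-minors have order at least \<open>M\<^sub>s\<close>, for all \<open>s\<close>.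

  By the Smith normal form (modulo a large power of \<open>t\<close>) such a jet lifts to an arc in the
  orbit of a diagonal matrix whose exponents \<open>h\<close>, sorted, have partial sums at least \<open>M\<^sub>s\<close>. Such
  an \<open>h\<close> is reached from \<open>\<lambda>\<close> by moving or adding single units, and each of these moves is a
  degeneration along an affine line of matrices, so the arc lies in the closure of \<open>C\<^sub>\<lambda>\<close>.

  The orbit is irreducible because any two of its points lie on a curve that is generically
  contained in it. It is a component because a jet of the scheme that is not in it has
  \<open>(r - 1)\<close>-minors of order above \<open>M\<^sub>r\<^sub>-\<^sub>1\<close> only, or \<open>(r + 1)\<close>-minors of order above \<open>M\<^sub>r\<^sub>+\<^sub>1\<close>
  only, and these closed conditions fail at \<open>\<delta>\<^sub>\<lambda>\<close>.
\<close>

subsection \<open>Orders of minors\<close>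

text \<open>The minors are not truncated, so the equations of \<Omega>' reach coefficients of
  t^\<alpha> with \<alpha> \<ge> p, whereas the component is a truncation of arcs. A jet is
  therefore read as the arc with zero coefficients from p on, and bounds above p must be shown
  independent of that choice; this is where \<lambda> having no entry above p enters. Minors may
  vanish, so orders are expressed as divisibility by powers of t, and normal forms are taken modulo
  t^N with N beyond p and every bound in play: an exponent N then stands for anything from N on,
  zero included. The indices r - 1 and r + 1 come from the shape of the bounds: if d is the largest
  entry of \<lambda>, then M_s is the maximum of 0 and p + (s - r) d, which is linear around s = r.
  Let H_s be the partial sums of the exponents of a jet, with H_r \<ge> p. If H at r - 1 is at most
  p - d and H at r + 1 is at most p + d, the r-th and (r + 1)-st exponents equal d, and sortedness
  gives the bounds for all s. If d = p, truncation kills the entries t^d, so the test at r + 1 is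
  dropped; the bounds for s < r are then 0.\<close>

lemma fps_X_power_dvd_iff:
  "fps_X ^ q dvd (u :: 'a::comm_ring_1 fps) \<longleftrightarrow> (\<forall>l<q. fps_nth u l = 0)"
proof
  assume "fps_X ^ q dvd u"
  then show "\<forall>l<q. fps_nth u l = 0"
    by (auto simp: fps_X_power_mult_nth elim!: dvdE)
next
  assume *: "\<forall>l<q. fps_nth u l = 0"
  have "u = fps_X ^ q * fps_shift q u"
    by (rule fps_ext) (auto simp: fps_X_power_mult_nth *)
  then show "fps_X ^ q dvd u"
    by (rule dvdI)
qed

text \<open>Indices are functions instead of sets: repetitions give 0 and reorderings change only
  the sign, so determinants can be expanded without sorted index sets.\<close>

definition fminor :: "'a::comm_ring_1 mat \<Rightarrow> nat \<Rightarrow> (nat \<Rightarrow> nat) \<Rightarrow> (nat \<Rightarrow> nat) \<Rightarrow> 'a" where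
  "fminor A s \<alpha> \<beta> = det (mat s s (\<lambda>(i, j). A $$ (\<alpha> i, \<beta> j)))"

definition minors_dvd :: "'a::comm_ring_1 \<Rightarrow> 'a mat \<Rightarrow> nat \<Rightarrow> bool" where
  "minors_dvd d A s \<longleftrightarrow>
     (\<forall>\<alpha> \<beta>. \<alpha> ` {..<s} \<subseteq> {..<dim_row A} \<longrightarrow> \<beta> ` {..<s} \<subseteq> {..<dim_col A} \<longrightarrow> d dvd fminor A s \<alpha> \<beta>)"

lemma minors_dvdI:
  assumes "\<And>\<alpha> \<beta>. \<alpha> ` {..<s} \<subseteq> {..<dim_row A} \<Longrightarrow> \<beta> ` {..<s} \<subseteq> {..<dim_col A} \<Longrightarrow> d dvd fminor A s \<alpha> \<beta>"
  shows "minors_dvd d A s"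
  using assms unfolding minors_dvd_def by blast

lemma minors_dvdD:
  assumes "minors_dvd d A s" "\<alpha> ` {..<s} \<subseteq> {..<dim_row A}" "\<beta> ` {..<s} \<subseteq> {..<dim_col A}"
  shows "d dvd fminor A s \<alpha> \<beta>"
  using assms unfolding minors_dvd_def by blast

lemma fminor_transpose:
  assumes "\<alpha> ` {..<s} \<subseteq> {..<dim_row A}" "\<beta> ` {..<s} \<subseteq> {..<dim_col A}"
  shows "fminor (transpose_mat A) s \<beta> \<alpha> = fminor A s \<alpha> \<beta>"
proof -
  have "mat s s (\<lambda>(i, j). transpose_mat A $$ (\<beta> i, \<alpha> j))
      = transpose_mat (mat s s (\<lambda>(i, j). A $$ (\<alpha> i, \<beta> j)))"
    using assms by (intro eq_matI) (auto simp: image_subset_iff)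
  then show ?thesis
    unfolding fminor_def by (simp add: det_transpose[of _ s])
qed

lemma minors_dvd_transpose:
  assumes "minors_dvd d A s"
  shows "minors_dvd d (transpose_mat A) s"
  using assms by (intro minors_dvdI) (simp add: fminor_transpose minors_dvdD)

text \<open>The divisibility half of Cauchy-Binet: by linearity in the rows, a minor of
  \<open>g * A\<close> is a combination of minors of \<open>A\<close> over all row choices
  \<open>f\<close>, repetitions included.\<close>

lemma minors_dvd_mult_left:
  assumes d: "minors_dvd d A s" and g: "g \<in> carrier_mat m' m" and A: "A \<in> carrier_mat m n"
  shows "minors_dvd d (g * A) s"
proof (rule minors_dvdI)
  fix \<alpha> \<beta> assume \<alpha>: "\<alpha> ` {..<s} \<subseteq> {..<dim_row (g * A)}" and \<beta>: "\<beta> ` {..<s} \<subseteq> {..<dim_col (g * A)}"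
  let ?G = "mat s m (\<lambda>(i, k). g $$ (\<alpha> i, k))" and ?C = "mat m s (\<lambda>(k, j). A $$ (k, \<beta> j))"
  let ?F = "{f. (\<forall>i\<in>{0..<s}. f i \<in> {0..<m}) \<and> (\<forall>i. i \<notin> {0..<s} \<longrightarrow> f i = i)}"
  have "mat s s (\<lambda>(i, j). (g * A) $$ (\<alpha> i, \<beta> j)) = ?G * ?C"
    using \<alpha> \<beta> g A by (intro eq_matI) (auto simp: scalar_prod_def image_subset_iff)
  also have "\<dots> = mat\<^sub>r s s (\<lambda>i. finsum_vec TYPE('a) s (\<lambda>k. ?G $$ (i, k) \<cdot>\<^sub>v row ?C k) {0..<m})"
    by (rule mat_mul_finsum_alt) auto
  finally have "fminor (g * A) s \<alpha> \<beta> = (\<Sum>f\<in>?F. det (mat\<^sub>r s s (\<lambda>i. ?G $$ (i, f i) \<cdot>\<^sub>v row ?C (f i))))"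
    unfolding fminor_def by (simp only:) (rule det_linear_rows_sum, auto)
  also have "d dvd \<dots>"
  proof (rule dvd_sum)
    fix f assume f: "f \<in> ?F"
    have "det (mat\<^sub>r s s (\<lambda>i. ?G $$ (i, f i) \<cdot>\<^sub>v row ?C (f i)))
        = (\<Prod>i\<in>{0..<s}. ?G $$ (i, f i)) * det (mat\<^sub>r s s (\<lambda>i. row ?C (f i)))"
      using f by (intro det_rows_mul) auto
    also have "mat\<^sub>r s s (\<lambda>i. row ?C (f i)) = mat s s (\<lambda>(i, j). A $$ (f i, \<beta> j))"
      using f by (intro eq_matI) auto
    also have "d dvd (\<Prod>i\<in>{0..<s}. ?G $$ (i, f i)) * det (mat s s (\<lambda>(i, j). A $$ (f i, \<beta> j)))"
      using f A \<beta> by (intro dvd_mult minors_dvdD[OF d, unfolded fminor_def]) auto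
    finally show "d dvd det (mat\<^sub>r s s (\<lambda>i. ?G $$ (i, f i) \<cdot>\<^sub>v row ?C (f i)))" .
  qed
  finally show "d dvd fminor (g * A) s \<alpha> \<beta>" .
qed

lemma minors_dvd_mult_right:
  assumes d: "minors_dvd d A s" and A: "A \<in> carrier_mat m n" and h: "h \<in> carrier_mat n n'"
  shows "minors_dvd d (A * h) s"
proof -
  have "minors_dvd d (transpose_mat h * transpose_mat A) s"
    using A h by (intro minors_dvd_mult_left[of _ _ _ _ n' n m] minors_dvd_transpose d) auto
  then have "minors_dvd d (transpose_mat (transpose_mat h * transpose_mat A)) s"
    by (rule minors_dvd_transpose)
  then show ?thesis
    using A h by (simp add: transpose_mult[of _ _ n])
qed

lemma dvd_prod_diff:
  fixes f g :: "'b \<Rightarrow> 'a::comm_ring_1"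
  assumes "\<And>i. i \<in> S \<Longrightarrow> d dvd f i - g i"
  shows "d dvd prod f S - prod g S"
  using assms
proof (induction S rule: infinite_finite_induct)
  case (insert x S)
  have "prod f (insert x S) - prod g (insert x S)
      = (f x - g x) * prod f S + g x * (prod f S - prod g S)"
    using insert.hyps by (simp add: algebra_simps)
  then show ?case
    using insert by simp
qed auto

lemma dvd_det_diff:
  assumes "A \<in> carrier_mat s s" "B \<in> carrier_mat s s"
    and "\<And>i j. i < s \<Longrightarrow> j < s \<Longrightarrow> d dvd A $$ (i, j) - B $$ (i, j)"
  shows "d dvd det A - det B"
proof -
  have "det A - det B = (\<Sum>p | p permutes {0..<s}.
      signof p * ((\<Prod>i = 0..<s. A $$ (i, p i)) - (\<Prod>i = 0..<s. B $$ (i, p i))))"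
    by (simp add: det_def'[OF assms(1)] det_def'[OF assms(2)] sum_subtractf right_diff_distrib)
  also have "d dvd \<dots>"
  proof (intro dvd_sum dvd_mult dvd_prod_diff assms(3))
    fix p i assume "p \<in> {p. p permutes {0..<s}}" "i \<in> {0..<s}"
    then show "p i < s"
      using permutes_in_image[of p "{0..<s}" i] by simp
  qed auto
  finally show ?thesis .
qed

lemma minors_dvd_cong:
  assumes "minors_dvd d A s" "A \<in> carrier_mat m n" "B \<in> carrier_mat m n"
    and "\<And>i j. i < m \<Longrightarrow> j < n \<Longrightarrow> d dvd A $$ (i, j) - B $$ (i, j)"
  shows "minors_dvd d B s"
proof (rule minors_dvdI)
  fix \<alpha> \<beta> assume *: "\<alpha> ` {..<s} \<subseteq> {..<dim_row B}" "\<beta> ` {..<s} \<subseteq> {..<dim_col B}"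
  have "d dvd fminor A s \<alpha> \<beta> - fminor B s \<alpha> \<beta>"
    unfolding fminor_def using * assms(2-4) by (intro dvd_det_diff) (auto simp: image_subset_iff)
  moreover have "d dvd fminor A s \<alpha> \<beta>"
    using assms * by (intro minors_dvdD) auto
  ultimately have "d dvd fminor A s \<alpha> \<beta> - (fminor A s \<alpha> \<beta> - fminor B s \<alpha> \<beta>)"
    by (simp only: dvd_diff)
  then show "d dvd fminor B s \<alpha> \<beta>"
    by simp
qed

lemma fminor_eq_0:
  assumes "\<not> inj_on \<alpha> {..<s}"
  shows "fminor A s \<alpha> \<beta> = 0"
proof -
  obtain i j where "i < s" "j < s" "i \<noteq> j" "\<alpha> i = \<alpha> j"
    using assms by (auto simp: inj_on_def)
  then show ?thesis
    unfolding fminor_def by (intro det_identical_rows[of _ s i j]) auto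
qed

text \<open>Peeling off the largest index: a set of \<open>k + 1\<close> naturals has maximum at
  least \<open>k\<close>, so by monotonicity the value there is at least \<open>h k\<close>.\<close>

lemma sum_le_sum_mono_inj:
  fixes h :: "nat \<Rightarrow> nat"
  assumes "mono_on {..<m} h" "inj_on \<gamma> {..<s}" "\<gamma> ` {..<s} \<subseteq> {..<m}"
  shows "(\<Sum>k<s. h k) \<le> (\<Sum>k<s. h (\<gamma> k))"
proof -
  have "(\<Sum>k<card S. h k) \<le> sum h S" if "finite S" "S \<subseteq> {..<m}" for S
    using that
  proof (induction "card S" arbitrary: S)
    case (Suc k)
    let ?M = "Max S"
    have "S \<noteq> {}" using Suc.hyps(2) by auto
    then have M: "?M \<in> S" "S \<subseteq> {..?M}"
      using Suc.prems(1) by auto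
    have "card S \<le> card {..?M}"
      using M(2) by (intro card_mono) auto
    then have "h k \<le> h ?M"
      using M(1) Suc.hyps(2) Suc.prems(2) by (intro mono_onD[OF assms(1)]) auto
    moreover have "(\<Sum>i<k. h i) \<le> sum h (S - {?M})"
    proof -
      have card: "k = card (S - {?M})"
        using Suc.hyps(2) Suc.prems(1) M(1) by simp
      then show ?thesis
        using Suc.hyps(1)[OF card] Suc.prems by auto
    qed
    moreover have "sum h S = h ?M + sum h (S - {?M})"
      using Suc.prems(1) M(1) by (intro sum.remove)
    moreover have "(\<Sum>i<card S. h i) = (\<Sum>i<k. h i) + h k"
      unfolding Suc.hyps(2)[symmetric] by simp
    ultimately show ?case
      by linarith
  qed simp
  from this[of "\<gamma> ` {..<s}"] show ?thesis
    using assms(2,3) by (simp add: card_image sum.reindex)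
qed

text \<open>Each Leibniz term takes one entry from every chosen row, and distinct rows contribute at
  least the \<open>s\<close> smallest exponents. Row \<open>i\<close> carries
  \<open>h (m - 1 - i)\<close> because pivots are counted from the bottom.\<close>

lemma minors_dvd_rows:
  fixes A :: "'a::field fps mat"
  assumes A: "A \<in> carrier_mat m n" and h: "mono_on {..<m} h"
    and dvd: "\<And>i j. i < m \<Longrightarrow> j < n \<Longrightarrow> fps_X ^ h (m - 1 - i) dvd A $$ (i, j)"
  shows "minors_dvd (fps_X ^ (\<Sum>k<s. h k)) A s"
proof (rule minors_dvdI)
  fix \<alpha> \<beta> assume \<alpha>: "\<alpha> ` {..<s} \<subseteq> {..<dim_row A}" and \<beta>: "\<beta> ` {..<s} \<subseteq> {..<dim_col A}"
  show "fps_X ^ (\<Sum>k<s. h k) dvd fminor A s \<alpha> \<beta>"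
  proof (cases "inj_on \<alpha> {..<s}")
    case True
    have "inj_on (\<lambda>k. m - 1 - \<alpha> k) {..<s}"
    proof (rule inj_onI)
      fix x y assume xy: "x \<in> {..<s}" "y \<in> {..<s}" and eq: "m - 1 - \<alpha> x = m - 1 - \<alpha> y"
      then have "\<alpha> x < m" "\<alpha> y < m"
        using \<alpha> A by auto
      with eq have "\<alpha> x = \<alpha> y" by arith
      with True xy show "x = y" by (auto dest: inj_onD)
    qed
    moreover have "(\<lambda>k. m - 1 - \<alpha> k) ` {..<s} \<subseteq> {..<m}"
      using \<alpha> A by (force simp: image_subset_iff)
    ultimately have le: "(\<Sum>k<s. h k) \<le> (\<Sum>k<s. h (m - 1 - \<alpha> k))"
      by (rule sum_le_sum_mono_inj[OF h])
    have "fps_X ^ (\<Sum>k<s. h (m - 1 - \<alpha> k)) dvd fminor A s \<alpha> \<beta>"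
      unfolding fminor_def
    proof (subst det_def'[of _ s]; (intro dvd_sum dvd_mult)?)
      fix p assume "p \<in> {p. p permutes {0..<s}}"
      then have p: "p i < s" if "i < s" for i
        using permutes_in_image[of p "{0..<s}" i] that by simp
      have "(\<Prod>i<s. fps_X ^ h (m - 1 - \<alpha> i)) dvd (\<Prod>i<s. A $$ (\<alpha> i, \<beta> (p i)))"
        using \<alpha> \<beta> A p by (intro prod_dvd_prod dvd) (auto simp: image_subset_iff)
      also have "\<dots> = (\<Prod>i = 0..<s. mat s s (\<lambda>(i, j). A $$ (\<alpha> i, \<beta> j)) $$ (i, p i))"
        using p by (intro prod.cong) auto
      finally show "fps_X ^ (\<Sum>k<s. h (m - 1 - \<alpha> k)) dvd
          (\<Prod>i = 0..<s. mat s s (\<lambda>(i, j). A $$ (\<alpha> i, \<beta> j)) $$ (i, p i))"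
        by (simp add: power_sum)
    qed auto
    then show ?thesis
      using le le_imp_power_dvd dvd_trans by blast
  qed (simp add: fminor_eq_0)
qed

section \<open>Minors by index functions and by index sets\<close>

lemma fminor_pick_rows:
  assumes "inj_on \<alpha> {..<s}"
  shows "fminor A s (pick (\<alpha> ` {..<s})) \<beta> dvd fminor A s \<alpha> \<beta>"
proof -
  define I where "I = \<alpha> ` {..<s}"
  \<comment> \<open>The rank of \<open>\<alpha> i\<close> in the image, continued by the identity so
    that it permutes \<open>{0..<s}\<close>; the two minors then differ by
    \<open>signof \<rho>\<close>.\<close>
  define \<rho> where "\<rho> i = (if i < s then card {a \<in> I. a < \<alpha> i} else i)" for i
  have fin: "finite I" and card: "card I = s"
    using assms by (simp_all add: I_def card_image)
  have pick: "pick I (\<rho> i) = \<alpha> i" if "i < s" for i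
    using that unfolding \<rho>_def by (auto simp: I_def intro: pick_card_in_set)
  have "inj_on \<rho> {0..<s}"
    using pick assms unfolding inj_on_def by (metis atLeastLessThan_iff lessThan_iff)
  moreover have lt: "\<rho> i < s" if "i < s" for i
  proof -
    have "{a \<in> I. a < \<alpha> i} \<subset> I"
      using that by (auto simp: I_def)
    then show ?thesis
      using fin card that psubset_card_mono[of I] by (auto simp: \<rho>_def)
  qed
  then have "\<rho> \<in> {0..<s} \<rightarrow> {0..<s}" by auto
  moreover have "\<rho> i = i" if "i \<notin> {0..<s}" for i
    using that by (auto simp: \<rho>_def)
  ultimately have perm: "\<rho> permutes {0..<s}"
    by (intro inj_on_nat_permutes) auto
  let ?B = "mat s s (\<lambda>(i, j). A $$ (pick I i, \<beta> j))"
  have "mat s s (\<lambda>(i, j). A $$ (\<alpha> i, \<beta> j)) = mat s s (\<lambda>(i, j). ?B $$ (\<rho> i, j))"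
    using lt pick by (intro eq_matI) auto
  then have "fminor A s \<alpha> \<beta> = signof \<rho> * fminor A s (pick I) \<beta>"
    unfolding fminor_def using det_permute_rows[of ?B s \<rho>] perm by simp
  then show ?thesis
    by (simp add: I_def)
qed

lemma pick_image:
  assumes "card I = s"
  shows "pick I ` {..<s} \<subseteq> I"
  using assms pick_in_set_le by auto

lemma det_submatrix:
  assumes "A \<in> carrier_mat m n" "I \<subseteq> {..<m}" "J \<subseteq> {..<n}" "card I = s" "card J = s"
  shows "det (submatrix A I J) = fminor A s (pick I) (pick J)"
proof -
  have "{i. i < m \<and> i \<in> I} = I" "{j. j < n \<and> j \<in> J} = J"
    using assms by auto
  then show ?thesis
    using assms by (simp add: submatrix_def fminor_def)
qed

text \<open>Translates between index functions and the subsets used in \<open>minor_coeffs\<close>.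
  A noninjective index function gives 0; otherwise the rows and then, after transposing, the columns
  are brought into increasing order.\<close>

lemma minors_dvd_iff_submatrix:
  assumes A: "A \<in> carrier_mat m n"
  shows "minors_dvd d A s \<longleftrightarrow>
    (\<forall>I J. I \<subseteq> {..<m} \<longrightarrow> J \<subseteq> {..<n} \<longrightarrow> card I = s \<longrightarrow> card J = s \<longrightarrow> d dvd det (submatrix A I J))"
proof (intro iffI allI impI)
  fix I J assume "minors_dvd d A s" "I \<subseteq> {..<m}" "J \<subseteq> {..<n}" "card I = s" "card J = s"
  then show "d dvd det (submatrix A I J)"
    using A pick_image[of I s] pick_image[of J s]
    by (simp add: det_submatrix[of _ m n]) (rule minors_dvdD, auto)
next
  assume *: "\<forall>I J. I \<subseteq> {..<m} \<longrightarrow> J \<subseteq> {..<n} \<longrightarrow> card I = s \<longrightarrow> card J = s \<longrightarrow> d dvd det (submatrix A I J)"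
  show "minors_dvd d A s"
  proof (rule minors_dvdI)
    fix \<alpha> \<beta> assume \<alpha>: "\<alpha> ` {..<s} \<subseteq> {..<dim_row A}" and \<beta>: "\<beta> ` {..<s} \<subseteq> {..<dim_col A}"
    show "d dvd fminor A s \<alpha> \<beta>"
    proof (cases "inj_on \<alpha> {..<s} \<and> inj_on \<beta> {..<s}")
      case True
      let ?I = "\<alpha> ` {..<s}" and ?J = "\<beta> ` {..<s}"
      have I: "card ?I = s" "?I \<subseteq> {..<m}" "pick ?I ` {..<s} \<subseteq> {..<m}"
        using True \<alpha> A pick_image[of ?I s] by (auto simp: card_image)
      have J: "card ?J = s" "?J \<subseteq> {..<n}" "pick ?J ` {..<s} \<subseteq> {..<n}"
        using True \<beta> A pick_image[of ?J s] by (auto simp: card_image)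
      have "d dvd fminor A s (pick ?I) (pick ?J)"
        using * I J A by (simp add: det_submatrix[of _ m n, symmetric])
      also have "\<dots> = fminor (transpose_mat A) s (pick ?J) (pick ?I)"
        using I J A by (simp add: fminor_transpose)
      also have "\<dots> dvd fminor (transpose_mat A) s \<beta> (pick ?I)"
        using True by (simp add: fminor_pick_rows)
      also have "\<dots> = fminor A s (pick ?I) \<beta>"
        using I \<beta> A by (intro fminor_transpose) auto
      also have "\<dots> dvd fminor A s \<alpha> \<beta>"
        using True by (simp add: fminor_pick_rows)
      finally show ?thesis .
    next
      case False
      then show ?thesis
        using fminor_eq_0[of \<alpha> s A \<beta>] fminor_eq_0[of \<beta> s "transpose_mat A" \<alpha>] \<alpha> \<beta>
        by (auto simp: fminor_transpose)
    qed
  qed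
qed

section \<open>The adjugate identity and the growth of orders\<close>

lemma det_adj_mat:
  assumes "A \<in> carrier_mat (Suc s) (Suc s)"
  shows "det (adj_mat A) * det A = det A ^ Suc s"
proof -
  have "det (adj_mat A) * det A = det (det A \<cdot>\<^sub>m 1\<^sub>m (Suc s))"
    using adj_mat[OF assms] assms by (simp add: det_mult[symmetric])
  then show ?thesis
    by (simp add: det_smult)
qed

text \<open>A Leibniz term of the adjugate has \<open>Suc s\<close> cofactors, each divisible by
  t^q, whence \<open>Suc s * q\<close>. The estimate stays in integers; the ceiling appears only in
  \<open>minors_dvd_Suc\<close>.\<close>

lemma subdegree_fminor_Suc:
  fixes A :: "'a::field fps mat"
  assumes d: "minors_dvd (fps_X ^ q) A s"
    and \<alpha>: "\<alpha> ` {..<Suc s} \<subseteq> {..<dim_row A}" and \<beta>: "\<beta> ` {..<Suc s} \<subseteq> {..<dim_col A}"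
    and nz: "fminor A (Suc s) \<alpha> \<beta> \<noteq> 0"
  shows "Suc s * q \<le> s * subdegree (fminor A (Suc s) \<alpha> \<beta>)"
proof -
  define B where "B = mat (Suc s) (Suc s) (\<lambda>(i, j). A $$ (\<alpha> i, \<beta> j))"
  have B: "B \<in> carrier_mat (Suc s) (Suc s)" by (simp add: B_def)
  have detB: "det B = fminor A (Suc s) \<alpha> \<beta>" by (simp add: B_def fminor_def)
  have cof: "fps_X ^ q dvd cofactor B i j" if "i < Suc s" "j < Suc s" for i j
  proof -
    \<comment> \<open>Deleting a row and a column amounts to composing the index functions with
      \<open>insert_index\<close>, which skips the deleted position.\<close>
    have "mat_delete B i j = mat s s (\<lambda>(i', j'). A $$ ((\<alpha> \<circ> insert_index i) i', (\<beta> \<circ> insert_index j) j'))"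
      by (intro eq_matI) (auto simp: B_def mat_delete_def insert_index_def)
    then have "det (mat_delete B i j) = fminor A s (\<alpha> \<circ> insert_index i) (\<beta> \<circ> insert_index j)"
      by (simp add: fminor_def)
    also have "fps_X ^ q dvd \<dots>"
      using \<alpha> \<beta> that by (intro minors_dvdD[OF d]) (auto simp: insert_index_def image_subset_iff)
    finally show ?thesis
      by (simp add: cofactor_def)
  qed
  have "fps_X ^ (Suc s * q) dvd det (adj_mat B)"
  proof (subst det_def'[of _ "Suc s"]; (intro dvd_sum dvd_mult)?)
    show "adj_mat B \<in> carrier_mat (Suc s) (Suc s)"
      using adj_mat[OF B] by simp
    fix p assume "p \<in> {p. p permutes {0..<Suc s}}"
    then have p: "p i < Suc s" if "i < Suc s" for i
      using permutes_in_image[of p "{0..<Suc s}" i] that by simp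
    have "(\<Prod>i = 0..<Suc s. fps_X ^ q) dvd (\<Prod>i = 0..<Suc s. adj_mat B $$ (i, p i))"
      using p cof B by (intro prod_dvd_prod) (auto simp: adj_mat_def)
    moreover have "(\<Prod>i = 0..<Suc s. fps_X ^ q) = (fps_X ^ (Suc s * q) :: 'a fps)"
      by (simp only: prod_constant card_atLeastLessThan diff_zero power_mult[symmetric] mult.commute)
    ultimately show "fps_X ^ (Suc s * q) dvd (\<Prod>i = 0..<Suc s. adj_mat B $$ (i, p i))"
      by simp
  qed
  \<comment> \<open>One factor \<open>det B\<close> is cancelled here, which is why the minor is
    assumed nonzero.\<close>
  moreover have eq: "det (adj_mat B) = det B ^ s"
    using det_adj_mat[OF B] nz detB by simp
  ultimately have "subdegree (fps_X ^ (Suc s * q) :: 'a fps) \<le> subdegree (det B ^ s)"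
    using nz detB by (intro dvd_imp_subdegree_le) auto
  then show ?thesis
    using nz detB by (simp add: fps_X_power_subdegree)
qed

subsection \<open>Smith normal form modulo a power of the variable\<close>

text \<open>The inverse is carried along explicitly with its dimension; products, transposes and
  exchange of roles then produce the new inverse directly.\<close>

definition mutual_inverse :: "nat \<Rightarrow> 'a::comm_ring_1 mat \<Rightarrow> 'a mat \<Rightarrow> bool" where
  "mutual_inverse n g g' \<longleftrightarrow> g \<in> carrier_mat n n \<and> g' \<in> carrier_mat n n \<and> g * g' = 1\<^sub>m n \<and> g' * g = 1\<^sub>m n"

lemma mutual_inverse_sym: "mutual_inverse n g g' \<Longrightarrow> mutual_inverse n g' g"
  by (auto simp: mutual_inverse_def)

lemma mutual_inverse_one: "mutual_inverse n (1\<^sub>m n) (1\<^sub>m n)"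
  by (auto simp: mutual_inverse_def)

lemma mult_inverse_cancel:
  fixes g :: "'a::comm_ring_1 mat"
  assumes "g \<in> carrier_mat n n" "g' \<in> carrier_mat n n" "k \<in> carrier_mat n n" "k' \<in> carrier_mat n n"
    and "g * g' = 1\<^sub>m n" "k * k' = 1\<^sub>m n"
  shows "(g * k) * (k' * g') = 1\<^sub>m n"
proof -
  have "(g * k) * (k' * g') = g * (k * (k' * g'))"
    using assms by (intro assoc_mult_mat) auto
  also have "k * (k' * g') = k * k' * g'"
    using assms by (intro assoc_mult_mat[symmetric]) auto
  also have "k * k' * g' = g'"
    using assms by (simp add: left_mult_one_mat[of g' n n])
  finally show ?thesis
    using assms by simp
qed

lemma mutual_inverse_mult:
  assumes "mutual_inverse n g g'" "mutual_inverse n k k'"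
  shows "mutual_inverse n (g * k) (k' * g')"
  using assms mult_inverse_cancel[of g n g' k k'] mult_inverse_cancel[of k' n k g' g]
  unfolding mutual_inverse_def by auto

lemma mutual_inverse_transpose:
  assumes "mutual_inverse n g g'"
  shows "mutual_inverse n (transpose_mat g) (transpose_mat g')"
proof -
  have c: "g \<in> carrier_mat n n" "g' \<in> carrier_mat n n" and inv: "g * g' = 1\<^sub>m n" "g' * g = 1\<^sub>m n"
    using assms by (auto simp: mutual_inverse_def)
  have "transpose_mat g * transpose_mat g' = 1\<^sub>m n"
    using transpose_mult[OF c(2,1)] unfolding inv by simp
  moreover have "transpose_mat g' * transpose_mat g = 1\<^sub>m n"
    using transpose_mult[OF c] unfolding inv by simp
  ultimately show ?thesis
    using c by (simp add: mutual_inverse_def)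
qed

definition mat_equiv :: "nat \<Rightarrow> nat \<Rightarrow> 'a::comm_ring_1 mat \<Rightarrow> 'a mat \<Rightarrow> bool" where
  "mat_equiv m n A B \<longleftrightarrow> A \<in> carrier_mat m n \<and>
     (\<exists>g g' h h'. mutual_inverse m g g' \<and> mutual_inverse n h h' \<and> B = g * A * h)"

lemma mat_equivI:
  assumes "A \<in> carrier_mat m n" "mutual_inverse m g g'" "mutual_inverse n h h'"
  shows "mat_equiv m n A (g * A * h)"
  using assms unfolding mat_equiv_def by blast

lemma mat_equivE:
  assumes "mat_equiv m n A B"
  obtains g g' h h' where "A \<in> carrier_mat m n" "mutual_inverse m g g'" "mutual_inverse n h h'" "B = g * A * h"
  using assms unfolding mat_equiv_def by blast

lemma mat_equiv_carrier:
  assumes "mat_equiv m n A B"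
  shows "A \<in> carrier_mat m n" "B \<in> carrier_mat m n"
  using assms by (auto simp: mat_equiv_def mutual_inverse_def)

lemma mat_equiv_sym:
  assumes "mat_equiv m n A B"
  shows "mat_equiv m n B A"
proof -
  obtain g g' h h' where *: "A \<in> carrier_mat m n" "mutual_inverse m g g'" "mutual_inverse n h h'" "B = g * A * h"
    using assms by (rule mat_equivE)
  have c: "g \<in> carrier_mat m m" "g' \<in> carrier_mat m m" "h \<in> carrier_mat n n" "h' \<in> carrier_mat n n"
    using * by (auto simp: mutual_inverse_def)
  have "g' * (g * A * h) = g' * (g * (A * h))"
    using c *(1) by (simp add: assoc_mult_mat[of g m m A n h n])
  also have "\<dots> = g' * g * (A * h)"
    using c *(1) by (intro assoc_mult_mat[symmetric]) auto
  also have "\<dots> = A * h"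
    using c * by (simp add: mutual_inverse_def)
  finally have "g' * (g * A * h) * h' = A * h * h'"
    by simp
  also have "\<dots> = A * (h * h')"
    using c *(1) by (intro assoc_mult_mat) auto
  also have "\<dots> = A"
    using * by (simp add: mutual_inverse_def)
  finally have "A = g' * B * h'"
    using * by simp
  then show ?thesis
    using mat_equivI[of B m n g' g h' h] * mutual_inverse_sym mat_equiv_carrier[OF assms] by metis
qed

lemma mat_equiv_trans:
  assumes "mat_equiv m n A B" "mat_equiv m n B C"
  shows "mat_equiv m n A C"
proof -
  obtain g g' h h' where *: "A \<in> carrier_mat m n" "mutual_inverse m g g'" "mutual_inverse n h h'" "B = g * A * h"
    using assms(1) by (rule mat_equivE)
  obtain k k' l l' where **: "mutual_inverse m k k'" "mutual_inverse n l l'" "C = k * B * l"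
    using assms(2) by (rule mat_equivE)
  have c: "g \<in> carrier_mat m m" "k \<in> carrier_mat m m" "h \<in> carrier_mat n n" "l \<in> carrier_mat n n"
    using * ** by (auto simp: mutual_inverse_def)
  have "k * (g * A * h) = k * (g * A) * h"
    using c *(1) by (intro assoc_mult_mat[symmetric]) auto
  also have "k * (g * A) = k * g * A"
    using c *(1) by (intro assoc_mult_mat[symmetric]) auto
  finally have "C = k * g * A * h * l"
    using *(4) **(3) by simp
  also have "\<dots> = k * g * A * (h * l)"
    using c *(1) by (intro assoc_mult_mat) auto
  finally have "C = (k * g) * A * (h * l)" .
  then show ?thesis
    using mat_equivI[OF *(1) mutual_inverse_mult[OF **(1) *(2)] mutual_inverse_mult[OF *(3) **(2)]] by simp
qed

lemma mat_equiv_transpose: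
  assumes "mat_equiv m n A B"
  shows "mat_equiv n m (transpose_mat A) (transpose_mat B)"
proof -
  obtain g g' h h' where *: "A \<in> carrier_mat m n" "mutual_inverse m g g'" "mutual_inverse n h h'" "B = g * A * h"
    using assms by (rule mat_equivE)
  have c: "g \<in> carrier_mat m m" "h \<in> carrier_mat n n"
    using * by (auto simp: mutual_inverse_def)
  have "transpose_mat B = transpose_mat h * transpose_mat (g * A)"
    unfolding *(4) using c *(1) by (intro transpose_mult) auto
  also have "transpose_mat (g * A) = transpose_mat A * transpose_mat g"
    using c *(1) by (intro transpose_mult)
  also have "transpose_mat h * (transpose_mat A * transpose_mat g) = transpose_mat h * transpose_mat A * transpose_mat g"
    using c *(1) by (intro assoc_mult_mat[symmetric]) auto
  finally show ?thesis
    using mat_equivI[of "transpose_mat A" n m, OF _ mutual_inverse_transpose[OF *(3)] mutual_inverse_transpose[OF *(2)]] *(1)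
    by simp
qed

lemma mat_equiv_left:
  assumes "A \<in> carrier_mat m n" "mutual_inverse m g g'"
  shows "mat_equiv m n A (g * A)"
  using mat_equivI[OF assms mutual_inverse_one[of n]] assms by (auto simp: mutual_inverse_def)

lemma mat_equiv_refl: "A \<in> carrier_mat m n \<Longrightarrow> mat_equiv m n A A"
  using mat_equiv_left[of A m n "1\<^sub>m m" "1\<^sub>m m"] mutual_inverse_one[of m] by simp

section \<open>Elementary row and column operations\<close>

lemma mat_equiv_scale_rows:
  assumes A: "A \<in> carrier_mat m n" and uv: "\<And>i. i < m \<Longrightarrow> u i * v i = 1"
  shows "mat_equiv m n A (mat m n (\<lambda>(i, j). u i * A $$ (i, j)))"
proof -
  define D :: "(nat \<Rightarrow> 'a) \<Rightarrow> 'a mat" where "D w = mat m m (\<lambda>(i, k). if i = k then w i else 0)" for w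
  have D_carrier: "D w \<in> carrier_mat m m" for w
    by (simp add: D_def)
  have mult: "D w * B = mat m c (\<lambda>(i, j). w i * B $$ (i, j))" if "B \<in> carrier_mat m c" for w B c
    using that by (intro eq_matI)
      (auto simp: D_def scalar_prod_def if_distrib[of "\<lambda>x. x * _"] sum.delta cong: if_cong)
  have "mutual_inverse m (D u) (D v)"
    unfolding mutual_inverse_def mult[OF D_carrier] using uv
    by (auto simp: D_def mult.commute intro!: eq_matI)
  then show ?thesis
    using mat_equiv_left[OF A] mult[OF A] by metis
qed

text \<open>Since \<open>w a = 0\<close>, row \<open>a\<close> itself is unchanged, so adding the
  same multiples of it back inverts the operation.\<close>

lemma mat_equiv_clear_rows:
  assumes A: "A \<in> carrier_mat m n" and a: "a < m" and w: "w a = 0"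
  shows "mat_equiv m n A (mat m n (\<lambda>(i, j). A $$ (i, j) - w i * A $$ (a, j)))"
proof -
  define D :: "(nat \<Rightarrow> 'a) \<Rightarrow> 'a mat"
    where "D u = mat m m (\<lambda>(i, k). (if k = i then 1 else 0) - (if k = a then u i else 0))" for u
  have D_carrier: "D u \<in> carrier_mat m m" for u
    by (simp add: D_def)
  have mult: "D u * B = mat m c (\<lambda>(i, j). B $$ (i, j) - u i * B $$ (a, j))" if "B \<in> carrier_mat m c" for u B c
    using that a by (intro eq_matI)
      (auto simp: D_def scalar_prod_def left_diff_distrib sum_subtractf if_distrib[of "\<lambda>x. x * _"] sum.delta cong: if_cong)
  have "mutual_inverse m (D w) (D (\<lambda>i. - w i))"
    unfolding mutual_inverse_def mult[OF D_carrier] using a w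
    by (auto simp: D_def intro!: eq_matI)
  then show ?thesis
    using mat_equiv_left[OF A] mult[OF A] by metis
qed

lemma mat_equiv_permute_rows:
  assumes A: "A \<in> carrier_mat m n" and "k < m" "l < m"
  shows "mat_equiv m n A (mat m n (\<lambda>(i, j). A $$ (Transposition.transpose k l i, j)))"
proof -
  have "swaprows k l A = mat m n (\<lambda>(i, j). A $$ (Transposition.transpose k l i, j))"
    using assms by (intro eq_matI) (auto simp: Transposition.transpose_def)
  moreover have "mutual_inverse m (swaprows_mat m k l) (swaprows_mat m k l)"
    using swaprows_mat_inv[of k m l] assms by (simp add: mutual_inverse_def)
  ultimately show ?thesis
    using mat_equiv_left[OF A] swaprows_mat[OF assms] by metis
qed

lemma mat_equiv_clear_cols:
  assumes A: "A \<in> carrier_mat m n" and b: "b < n" and w: "w b = 0"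
  shows "mat_equiv m n A (mat m n (\<lambda>(i, j). A $$ (i, j) - w j * A $$ (i, b)))"
proof -
  have "mat_equiv m n (transpose_mat (transpose_mat A))
      (transpose_mat (mat n m (\<lambda>(i, j). transpose_mat A $$ (i, j) - w i * transpose_mat A $$ (b, j))))"
    using A b w by (intro mat_equiv_transpose mat_equiv_clear_rows) auto
  moreover have "transpose_mat (mat n m (\<lambda>(i, j). transpose_mat A $$ (i, j) - w i * transpose_mat A $$ (b, j)))
      = mat m n (\<lambda>(i, j). A $$ (i, j) - w j * A $$ (i, b))"
    using A b by (intro eq_matI) auto
  ultimately show ?thesis
    by simp
qed

lemma mat_equiv_permute_cols:
  assumes A: "A \<in> carrier_mat m n" and kl: "k < n" "l < n"
  shows "mat_equiv m n A (mat m n (\<lambda>(i, j). A $$ (i, Transposition.transpose k l j)))"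
proof -
  have "mat_equiv m n (transpose_mat (transpose_mat A))
      (transpose_mat (mat n m (\<lambda>(i, j). transpose_mat A $$ (Transposition.transpose k l i, j))))"
    using A kl by (intro mat_equiv_transpose mat_equiv_permute_rows) auto
  moreover have "transpose_mat (mat n m (\<lambda>(i, j). transpose_mat A $$ (Transposition.transpose k l i, j)))
      = mat m n (\<lambda>(i, j). A $$ (i, Transposition.transpose k l j))"
    using A kl by (intro eq_matI) (auto simp: Transposition.transpose_def)
  ultimately show ?thesis
    by simp
qed

text \<open>The exponents \<open>h\<close> are listed in the order in which the pivots are found, i.e. from the bottom right corner.\<close>

definition smith_mat :: "nat \<Rightarrow> nat \<Rightarrow> (nat \<Rightarrow> nat) \<Rightarrow> 'a::comm_ring_1 fps mat" where
  "smith_mat m n h = mat m n (\<lambda>(i, j). if j = (n - m) + i then fps_X ^ h (m - 1 - i) else 0)"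

lemma smith_mat_carrier [simp]: "smith_mat m n h \<in> carrier_mat m n"
  by (simp add: smith_mat_def)

text \<open>On the diagonal \<open>j = (n - m) + i\<close>, the index \<open>i\<close> is among the
  last \<open>k\<close> rows iff \<open>j\<close> is among the last \<open>k\<close> columns. The
  last hypothesis says that exactly one of them is, so the position is off the diagonal.\<close>

lemma smith_mat_eq_0:
  assumes "m \<le> n" "k \<le> m" "i < m" "j < n" "m - k \<le> i \<longleftrightarrow> \<not> n - k \<le> j"
  shows "smith_mat m n h $$ (i, j) = 0"
proof -
  have "j \<noteq> (n - m) + i"
  proof
    assume "j = (n - m) + i"
    then have "m - k \<le> i \<longleftrightarrow> n - k \<le> j"
      using assms(1,2) by arith
    then show False
      using assms(5) by blast
  qed
  then show ?thesis
    using assms(3,4) by (simp add: smith_mat_def)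
qed

lemma smith_mat_upd:
  assumes "m \<le> n" "k < m" "i < m" "j < n" "m - k \<le> i \<or> n - k \<le> j"
  shows "smith_mat m n (h(k := q)) $$ (i, j) = smith_mat m n h $$ (i, j)"
proof -
  have "m - 1 - i \<noteq> k" if "j = (n - m) + i"
    using assms that by arith
  then show ?thesis
    using assms(3,4) by (simp add: smith_mat_def)
qed

text \<open>The state after \<open>k\<close> pivots: only the block of the first
  \<open>m - k\<close> rows and \<open>n - k\<close> columns is still free. Agreement is modulo t^N,
  so leftovers divisible by t^N count as cleared.\<close>

definition smith_partial :: "nat \<Rightarrow> nat \<Rightarrow> nat \<Rightarrow> nat \<Rightarrow> (nat \<Rightarrow> nat) \<Rightarrow> 'a::field fps mat \<Rightarrow> bool" where
  "smith_partial m n N k h B \<longleftrightarrow>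
     (\<forall>i<m. \<forall>j<n. m - k \<le> i \<or> n - k \<le> j \<longrightarrow> fps_X ^ N dvd B $$ (i, j) - smith_mat m n h $$ (i, j))"

text \<open>An entry of least order in the free block is moved to its corner \<open>(a, b)\<close>,
  normalised to a pure power and used to clear its column and row. By minimality it divides the
  whole free block, and the finished off-diagonal blocks stay divisible by t^N.\<close>

lemma smith_partial_step:
  fixes B :: "'a::field fps mat"
  assumes B: "B \<in> carrier_mat m n" and mn: "m \<le> n" and k: "k < m"
    and part: "smith_partial m n N k h B"
    and i0: "i0 < m - k" and j0: "j0 < n - k" and nz: "B $$ (i0, j0) \<noteq> 0"
    and q: "q = subdegree (B $$ (i0, j0))"
    and min: "\<And>i j. i < m - k \<Longrightarrow> j < n - k \<Longrightarrow> fps_X ^ q dvd B $$ (i, j)"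
  shows "\<exists>C. mat_equiv m n B C \<and> smith_partial m n N (Suc k) (h(k := q)) C \<and>
           (\<forall>i<m - Suc k. \<forall>j<n - Suc k. fps_X ^ q dvd C $$ (i, j))"
proof -
  define a where "a = m - 1 - k"
  define b where "b = n - 1 - k"
  have a: "a < m" "a < m - k" "m - Suc k = a" "i < m - k \<longleftrightarrow> i \<le> a" for i
    using k by (auto simp: a_def)
  have b: "b < n" "b < n - k" "n - Suc k = b" "j < n - k \<longleftrightarrow> j \<le> b" for j
    using k mn by (auto simp: b_def)
  define \<sigma> where "\<sigma> = Transposition.transpose a i0"
  define \<tau> where "\<tau> = Transposition.transpose b j0"
  have \<sigma>: "\<sigma> a = i0" "i < m - k \<Longrightarrow> \<sigma> i < m - k" "m - k \<le> i \<Longrightarrow> \<sigma> i = i" for i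
    using i0 a(1,2) by (auto simp: \<sigma>_def Transposition.transpose_def)
  have \<tau>: "\<tau> b = j0" "j < n - k \<Longrightarrow> \<tau> j < n - k" "n - k \<le> j \<Longrightarrow> \<tau> j = j" for j
    using j0 b(1,2) by (auto simp: \<tau>_def Transposition.transpose_def)
  \<comment> \<open>The unit factor has nonzero constant term, so the pivot row can be divided by
    it.\<close>
  define w where "w = unit_factor (B $$ (i0, j0))"
  have "fps_nth w 0 \<noteq> 0"
    unfolding w_def by (rule fps_unit_factor_nth_0[OF nz])
  then have w: "w * inverse w = 1"
    by (rule inverse_mult_eq_1')
  have wq: "B $$ (i0, j0) = fps_X ^ q * w"
    unfolding w_def q by (rule fps_unit_factor_decompose')
  define B1 where "B1 = mat m n (\<lambda>(i, j). B $$ (\<sigma> i, \<tau> j))"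
  define B2 where "B2 = mat m n (\<lambda>(i, j). (if i = a then inverse w else 1) * B1 $$ (i, j))"
  \<comment> \<open>\<open>u\<close>, like \<open>v\<close> for the columns below, vanishes from the
    pivot on, so the pivot line and the diagonal block of finished pivots stay as they are.\<close>
  define u where "u i = (if i < a then fps_shift q (B2 $$ (i, b)) else 0)" for i
  define B3 where "B3 = mat m n (\<lambda>(i, j). B2 $$ (i, j) - u i * B2 $$ (a, j))"
  define v where "v j = (if j < b then fps_shift q (B3 $$ (a, j)) else 0)" for j
  define B4 where "B4 = mat m n (\<lambda>(i, j). B3 $$ (i, j) - v j * B3 $$ (i, b))"
  have c: "B1 \<in> carrier_mat m n" "B2 \<in> carrier_mat m n" "B3 \<in> carrier_mat m n"
    by (simp_all add: B1_def B2_def B3_def)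
  have "mat_equiv m n B (mat m n (\<lambda>(i, j). B $$ (\<sigma> i, j)))"
    unfolding \<sigma>_def using B a i0 by (intro mat_equiv_permute_rows) auto
  also have \<open>mat_equiv m n \<dots> B1\<close>
  proof -
    have "mat_equiv m n (mat m n (\<lambda>(i, j). B $$ (\<sigma> i, j)))
      (mat m n (\<lambda>(i, j). mat m n (\<lambda>(i, j). B $$ (\<sigma> i, j)) $$ (i, \<tau> j)))"
      unfolding \<tau>_def using b j0 by (intro mat_equiv_permute_cols) auto
    also have "mat m n (\<lambda>(i, j). mat m n (\<lambda>(i, j). B $$ (\<sigma> i, j)) $$ (i, \<tau> j)) = B1"
    proof -
      have "\<tau> j < n" if "j < n" for j
        using \<tau>(2,3)[of j] that by linarith
      then show ?thesis
        by (intro eq_matI) (auto simp: B1_def)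
    qed
    finally show ?thesis .
  qed
  finally (mat_equiv_trans) have "mat_equiv m n B B1" .
  also have "mat_equiv m n B1 B2"
    unfolding B2_def using c w
    by (intro mat_equiv_scale_rows[where v = "\<lambda>i. if i = a then w else 1"]) (auto simp: mult.commute)
  also (mat_equiv_trans) have "mat_equiv m n B2 B3"
    unfolding B3_def using c a by (intro mat_equiv_clear_rows) (auto simp: u_def)
  also (mat_equiv_trans) have "mat_equiv m n B3 B4"
    unfolding B4_def using c b by (intro mat_equiv_clear_cols) (auto simp: v_def)
  finally (mat_equiv_trans) have equiv: "mat_equiv m n B B4" .

  have rows0: "fps_X ^ N dvd B $$ (i, j)" if "m - k \<le> i" "i < m" "j < n - k" for i j
    using part[unfolded smith_partial_def, rule_format, of i j] that mn k
    by (simp add: smith_mat_eq_0[of m n k i j h])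
  have cols0: "fps_X ^ N dvd B $$ (i, j)" if "i < m - k" "n - k \<le> j" "j < n" for i j
    using part[unfolded smith_partial_def, rule_format, of i j] that mn k
    by (simp add: smith_mat_eq_0[of m n k i j h])
  have in2: "fps_X ^ q dvd B2 $$ (i, j)" if "i \<le> a" "j \<le> b" for i j
    using min[OF \<sigma>(2) \<tau>(2), of i j] that a b by (auto simp: B2_def B1_def)
  have piv2: "B2 $$ (a, b) = fps_X ^ q"
  proof -
    have "B2 $$ (a, b) = inverse w * (fps_X ^ q * w)"
      using a b wq \<sigma>(1) \<tau>(1) by (simp add: B2_def B1_def)
    also have "\<dots> = (w * inverse w) * fps_X ^ q"
      by (simp only: mult_ac)
    finally show ?thesis
      by (simp only: w mult_1_left)
  qed
  have rows2: "fps_X ^ N dvd B2 $$ (i, j)" if "a < i" "i < m" "j \<le> b" for i j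
    using rows0[of i "\<tau> j"] \<sigma>(3)[of i] \<tau>(2)[of j] that a b by (auto simp: B2_def B1_def)
  have cols2: "fps_X ^ N dvd B2 $$ (i, j)" if "i \<le> a" "b < j" "j < n" for i j
    using cols0[of "\<sigma> i" j] \<sigma>(2)[of i] \<tau>(3)[of j] that a b by (auto simp: B2_def B1_def)
  have low2: "B2 $$ (i, j) = B $$ (i, j)" if "a < i" "i < m" "b < j" "j < n" for i j
    using \<sigma>(3)[of i] \<tau>(3)[of j] that a b by (auto simp: B2_def B1_def)
  have shift: "fps_shift q x * fps_X ^ q = x" if "fps_X ^ q dvd x" for x :: "'a fps"
    using that by (metis dvdE fps_shift_times_fps_X_power' mult.commute)
  have in3: "fps_X ^ q dvd B3 $$ (i, j)" if "i \<le> a" "j \<le> b" for i j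
    using in2 that a(1) b(1) by (auto simp: B3_def)
  have piv3: "B3 $$ (i, b) = (if i = a then fps_X ^ q else 0)" if "i \<le> a" for i
    using in2[of i b] shift that a(1) b(1) piv2 by (auto simp: B3_def u_def)
  have rows3: "fps_X ^ N dvd B3 $$ (i, j)" if "a < i" "i < m" "j \<le> b" for i j
    using rows2[of i j] that a(1) b(1) by (auto simp: B3_def u_def)
  have cols3: "fps_X ^ N dvd B3 $$ (i, j)" if "i \<le> a" "b < j" "j < n" for i j
    using cols2[of _ j] that a(1) b(1) by (auto simp: B3_def u_def)
  have low3: "B3 $$ (i, j) = B $$ (i, j)" if "a < i" "i < m" "b < j" "j < n" for i j
    using low2 that a(1) b(1) by (auto simp: B3_def u_def)
  have in4: "fps_X ^ q dvd B4 $$ (i, j)" if "i \<le> a" "j \<le> b" for i j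
    using in3 that a(1) b(1) by (auto simp: B4_def)
  have piv4: "B4 $$ (i, j) = (if i = a \<and> j = b then fps_X ^ q else 0)" if "i \<le> a" "j \<le> b" "i = a \<or> j = b" for i j
  proof (cases "j < b")
    case True
    then have "i = a" "B4 $$ (i, j) = B3 $$ (i, j) - fps_shift q (B3 $$ (a, j)) * B3 $$ (i, b)"
      using that a(1) b(1) by (auto simp: B4_def v_def)
    then show ?thesis
      using True piv3[of a] shift[OF in3[of a j]] by simp
  next
    case False
    then show ?thesis
      using that a(1) b(1) piv3[of i] by (simp add: B4_def v_def)
  qed
  have rows4: "fps_X ^ N dvd B4 $$ (i, j)" if "a < i" "i < m" "j \<le> b" for i j
    using rows3[of i] that a(1) b(1) by (auto simp: B4_def v_def)
  have cols4: "fps_X ^ N dvd B4 $$ (i, j)" if "i \<le> a" "b < j" "j < n" for i j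
    using cols3[of i j] that a(1) b(1) by (auto simp: B4_def v_def)
  have low4: "B4 $$ (i, j) = B $$ (i, j)" if "a < i" "i < m" "b < j" "j < n" for i j
    using low3 that a(1) b(1) by (auto simp: B4_def v_def)
  have "smith_partial m n N (Suc k) (h(k := q)) B4"
    unfolding smith_partial_def
  proof (intro allI impI)
    fix i j assume ij: "i < m" "j < n" "m - Suc k \<le> i \<or> n - Suc k \<le> j"
    consider "a < i" "b < j" | "a < i" "j \<le> b" | "i \<le> a" "b < j" | "i \<le> a" "j \<le> b" "i = a \<or> j = b"
      using ij(3) unfolding a(3) b(3) by linarith
    then show "fps_X ^ N dvd B4 $$ (i, j) - smith_mat m n (h(k := q)) $$ (i, j)"
    proof cases
      case 1
      then have le: "m - k \<le> i \<or> n - k \<le> j"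
        unfolding a_def by arith
      then show ?thesis
        using part[unfolded smith_partial_def, rule_format, OF ij(1,2) le]
        by (simp only: low4[OF 1(1) ij(1) 1(2) ij(2)] smith_mat_upd[OF mn k ij(1,2) le])
    next
      case 2
      then have "m - k \<le> i" "\<not> n - k \<le> j"
        using mn k unfolding a_def b_def by arith+
      then have "smith_mat m n (h(k := q)) $$ (i, j) = (0 :: 'a fps)"
        using ij mn k by (intro smith_mat_eq_0[of m n k]) simp_all
      then show ?thesis using rows4 2 ij by simp
    next
      case 3
      then have "\<not> m - k \<le> i" "n - k \<le> j"
        using mn k unfolding a_def b_def by arith+
      then have "smith_mat m n (h(k := q)) $$ (i, j) = (0 :: 'a fps)"
        using ij mn k by (intro smith_mat_eq_0[of m n k]) simp_all
      then show ?thesis using cols4 3 ij by simp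
    next
      case 4
      then have "smith_mat m n (h(k := q)) $$ (i, j) = (if i = a \<and> j = b then fps_X ^ q else (0 :: 'a fps))"
      proof -
        have "j = (n - m) + i \<longleftrightarrow> i = a \<and> j = b"
          using 4 mn k unfolding a_def b_def by arith
        moreover have "m - 1 - a = k"
          using k unfolding a_def by arith
        ultimately show ?thesis
          using ij(1,2) by (simp add: smith_mat_def)
      qed
      then show ?thesis using piv4[OF 4] by simp
    qed
  qed
  moreover have "\<forall>i<m - Suc k. \<forall>j<n - Suc k. fps_X ^ q dvd B4 $$ (i, j)"
    using in4 unfolding a(3) b(3) by simp
  ultimately show ?thesis
    using equiv by blast
qed

text \<open>The bound \<open>h l \<le> N\<close> and the divisibility of the free block by all
  earlier pivots keep the exponents sorted, whether the next one is a minimal order or the cap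
  \<open>N\<close>.\<close>

lemma smith_form_partial:
  fixes A :: "'a::field fps mat"
  assumes A: "A \<in> carrier_mat m n" and mn: "m \<le> n" and "k \<le> m"
  shows "\<exists>B h. mat_equiv m n A B \<and> mono_on {..<k} h \<and> (\<forall>l<k. h l \<le> N) \<and> smith_partial m n N k h B \<and>
           (\<forall>i<m - k. \<forall>j<n - k. \<forall>l<k. fps_X ^ h l dvd B $$ (i, j))"
  using \<open>k \<le> m\<close>
proof (induction k)
  case 0
  then show ?case
    using mat_equiv_refl[OF A] mn by (intro exI[of _ A]) (auto simp: smith_partial_def mono_on_def)
next
  case (Suc k)
  then obtain B h where B: "mat_equiv m n A B" and h: "mono_on {..<k} h" "\<And>l. l < k \<Longrightarrow> h l \<le> N"
    and part: "smith_partial m n N k h B"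
    and dvd: "\<And>i j l. i < m - k \<Longrightarrow> j < n - k \<Longrightarrow> l < k \<Longrightarrow> fps_X ^ h l dvd B $$ (i, j)"
    by (metis Suc_leD)
  have k: "k < m" using Suc.prems by simp
  have cB: "B \<in> carrier_mat m n" using mat_equiv_carrier[OF B] by simp
  have mono: "mono_on {..<Suc k} (h(k := q))" if "\<And>l. l < k \<Longrightarrow> h l \<le> q" for q
    using h(1) that unfolding mono_on_def by (auto simp: less_Suc_eq)
  show ?case
  \<comment> \<open>If the free block is divisible by t^N, the exponent \<open>N\<close> is recorded
    without any operation: modulo t^N both the diagonal entry t^N and the actual entry are
    0.\<close>
  proof (cases "\<forall>i<m - k. \<forall>j<n - k. fps_X ^ N dvd B $$ (i, j)")
    case True
    have "smith_partial m n N (Suc k) (h(k := N)) B"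
      unfolding smith_partial_def
    proof (intro allI impI)
      fix i j assume ij: "i < m" "j < n" "m - Suc k \<le> i \<or> n - Suc k \<le> j"
      show "fps_X ^ N dvd B $$ (i, j) - smith_mat m n (h(k := N)) $$ (i, j)"
      proof (cases "m - k \<le> i \<or> n - k \<le> j")
        case True
        then show ?thesis
          using part[unfolded smith_partial_def, rule_format, OF ij(1,2) True]
          by (simp only: smith_mat_upd[OF mn k ij(1,2) True])
      next
        case False
        have "smith_mat m n (h(k := N)) $$ (i, j) \<in> {0 :: 'a fps, fps_X ^ N}"
          using False ij mn k by (auto simp: smith_mat_def)
        then show ?thesis
          using True False by auto
      qed
    qed
    moreover have "fps_X ^ (h(k := N)) l dvd B $$ (i, j)"
      if "i < m - Suc k" "j < n - Suc k" "l < Suc k" for i j l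
      using dvd[of i j l] True that by (auto simp: less_Suc_eq)
    moreover have "\<forall>l<Suc k. (h(k := N)) l \<le> N"
      using h(2) by (auto simp: less_Suc_eq)
    ultimately show ?thesis
      using B mono[OF h(2)] by blast
  next
    case False
    define Q where "Q x \<longleftrightarrow> fst x < m - k \<and> snd x < n - k \<and> B $$ x \<noteq> 0" for x
    obtain i1 j1 where ij1: "i1 < m - k" "j1 < n - k" "\<not> fps_X ^ N dvd B $$ (i1, j1)"
      using False by blast
    then have "Q (i1, j1)" by (auto simp: Q_def)
    then obtain x where x: "Q x" "\<And>y. Q y \<Longrightarrow> subdegree (B $$ x) \<le> subdegree (B $$ y)"
      using ex_has_least_nat[of Q "(i1, j1)" "\<lambda>x. subdegree (B $$ x)"] by blast
    obtain i0 j0 where x_eq: "x = (i0, j0)" by (cases x)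
    define q where "q = subdegree (B $$ (i0, j0))"
    have min: "fps_X ^ q dvd B $$ (i, j)" if "i < m - k" "j < n - k" for i j
    proof (cases "B $$ (i, j) = 0")
      case False
      then have "q \<le> subdegree (B $$ (i, j))"
        using x(2)[of "(i, j)"] that by (simp add: Q_def x_eq q_def)
      then show ?thesis
        by (auto simp: fps_X_power_dvd_iff intro: nth_less_subdegree_zero)
    qed simp
    have nz: "B $$ (i0, j0) \<noteq> 0" and i0: "i0 < m - k" and j0: "j0 < n - k"
      using x(1) by (auto simp: Q_def x_eq)
    have "q \<le> N"
    proof (rule ccontr)
      assume "\<not> q \<le> N"
      then have "fps_X ^ N dvd (fps_X ^ q :: 'a fps)"
        by (intro le_imp_power_dvd) simp
      then show False
        using min[OF ij1(1,2)] ij1(3) dvd_trans by blast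
    qed
    have "h l \<le> q" if "l < k" for l
      using dvd_imp_subdegree_le[OF dvd[OF i0 j0 that] nz] by (simp add: q_def fps_X_power_subdegree)
    obtain C where C: "mat_equiv m n B C" "smith_partial m n N (Suc k) (h(k := q)) C"
      "\<And>i j. i < m - Suc k \<Longrightarrow> j < n - Suc k \<Longrightarrow> fps_X ^ q dvd C $$ (i, j)"
      using smith_partial_step[OF cB mn k part i0 j0 nz q_def min] by blast
    have "fps_X ^ (h(k := q)) l dvd C $$ (i, j)"
      if "i < m - Suc k" "j < n - Suc k" "l < Suc k" for i j l
    proof -
      have "(h(k := q)) l \<le> q"
        using \<open>\<And>l. l < k \<Longrightarrow> h l \<le> q\<close> that by (auto simp: less_Suc_eq)
      then show ?thesis
        using C(3)[OF that(1,2)] le_imp_power_dvd dvd_trans by blast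
    qed
    moreover have "\<forall>l<Suc k. (h(k := q)) l \<le> N"
      using h(2) \<open>q \<le> N\<close> by (auto simp: less_Suc_eq)
    ultimately show ?thesis
      using mat_equiv_trans[OF B C(1)] C(2) mono[OF \<open>\<And>l. l < k \<Longrightarrow> h l \<le> q\<close>] by blast
  qed
qed

lemma smith_form_mod:
  fixes A :: "'a::field fps mat"
  assumes "A \<in> carrier_mat m n" "m \<le> n"
  obtains B h where "mat_equiv m n A B" "mono_on {..<m} h" "\<And>l. l < m \<Longrightarrow> h l \<le> N"
    and "\<And>i j. i < m \<Longrightarrow> j < n \<Longrightarrow> fps_X ^ N dvd B $$ (i, j) - smith_mat m n h $$ (i, j)"
  using smith_form_partial[OF assms order_refl, of N] unfolding smith_partial_def by fastforce

subsection \<open>Minors and equivalence of matrices\<close>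

lemma minors_dvd_mono:
  assumes "minors_dvd e A s" "d dvd e"
  shows "minors_dvd d A s"
  using assms dvd_trans unfolding minors_dvd_def by blast

lemma minors_dvd_equiv:
  assumes "mat_equiv m n A B" "minors_dvd d A s"
  shows "minors_dvd d B s"
proof -
  obtain g g' h h' where *: "A \<in> carrier_mat m n" "mutual_inverse m g g'" "mutual_inverse n h h'" "B = g * A * h"
    using assms(1) by (rule mat_equivE)
  then have c: "g \<in> carrier_mat m m" "h \<in> carrier_mat n n"
    by (auto simp: mutual_inverse_def)
  show ?thesis
    unfolding *(4)
    by (rule minors_dvd_mult_right[OF minors_dvd_mult_left[OF assms(2) c(1) *(1)] mult_carrier_mat[OF c(1) *(1)] c(2)])
qed

lemma minors_dvd_equiv_iff:
  assumes "mat_equiv m n A B"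
  shows "minors_dvd d A s \<longleftrightarrow> minors_dvd d B s"
  using minors_dvd_equiv[OF assms] minors_dvd_equiv[OF mat_equiv_sym[OF assms]] by blast

text \<open>Reversing both index functions turns the bottom right corner into the diagonal matrix
  with exponents \<open>h 0\<close>, ..., \<open>h (s - 1)\<close> in this order.\<close>

lemma fminor_smith_mat:
  assumes "m \<le> n" "s \<le> m"
  shows "fminor (smith_mat m n h) s (\<lambda>i. m - 1 - i) (\<lambda>j. n - 1 - j) = fps_X ^ (\<Sum>k<s. h k)"
proof -
  let ?D = "mat s s (\<lambda>(i, j). smith_mat m n h $$ (m - 1 - i, n - 1 - j)) :: 'a fps mat"
  have D: "?D $$ (i, j) = (if i = j then fps_X ^ h i else 0)" if "i < s" "j < s" for i j
  proof -
    have "n - 1 - j = (n - m) + (m - 1 - i) \<longleftrightarrow> i = j"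
      using assms that by arith
    moreover have "m - 1 - (m - 1 - i) = i" "m - 1 - i < m" "n - 1 - j < n"
      using assms that by arith+
    ultimately show ?thesis
      using that by (simp add: smith_mat_def)
  qed
  have "det ?D = prod_list (diag_mat ?D)"
    using D by (intro det_upper_triangular[of _ s]) auto
  also have "\<dots> = (\<Prod>k = 0..<s. ?D $$ (k, k))"
    by (simp add: prod_list_diag_prod)
  also have "\<dots> = (\<Prod>k<s. fps_X ^ h k)"
    using D by (intro prod.cong) auto
  finally show ?thesis
    by (simp add: fminor_def power_sum)
qed

lemma fps_X_power_dvd_power_iff:
  "fps_X ^ a dvd (fps_X ^ b :: 'a::field fps) \<longleftrightarrow> a \<le> b"
proof
  assume *: "fps_X ^ a dvd (fps_X ^ b :: 'a fps)"
  show "a \<le> b"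
  proof (rule ccontr)
    assume "\<not> a \<le> b"
    then have "fps_nth (fps_X ^ b :: 'a fps) b = 0"
      using * by (simp only: fps_X_power_dvd_iff not_le)
    then show False by simp
  qed
qed (rule le_imp_power_dvd)

text \<open>The corner minor attains the sum of the \<open>s\<close> smallest exponents, and by
  \<open>minors_dvd_rows\<close> no minor falls below it. Only \<open>q \<le> N\<close> is visible,
  as \<open>B\<close> is known modulo t^N.\<close>

lemma minors_dvd_smith_iff:
  fixes A :: "'a::field fps mat"
  assumes AB: "mat_equiv m n A B" and mn: "m \<le> n" and h: "mono_on {..<m} h"
    and cong: "\<And>i j. i < m \<Longrightarrow> j < n \<Longrightarrow> fps_X ^ N dvd B $$ (i, j) - smith_mat m n h $$ (i, j)"
    and "q \<le> N" "s \<le> m"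
  shows "minors_dvd (fps_X ^ q) A s \<longleftrightarrow> q \<le> (\<Sum>k<s. h k)"
proof -
  have B: "B \<in> carrier_mat m n" using mat_equiv_carrier[OF AB] by simp
  have q: "fps_X ^ q dvd B $$ (i, j) - smith_mat m n h $$ (i, j)" if "i < m" "j < n" for i j
    using cong[OF that] le_imp_power_dvd[OF \<open>q \<le> N\<close>, of "fps_X :: 'a fps"] dvd_trans by blast
  have q': "fps_X ^ q dvd smith_mat m n h $$ (i, j) - B $$ (i, j)" if "i < m" "j < n" for i j
    using q[OF that] by (simp add: dvd_diff_commute)
  have "minors_dvd (fps_X ^ q) A s \<longleftrightarrow> minors_dvd (fps_X ^ q) B s"
    by (rule minors_dvd_equiv_iff[OF AB])
  also have "\<dots> \<longleftrightarrow> minors_dvd (fps_X ^ q) (smith_mat m n h :: 'a fps mat) s"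
    using minors_dvd_cong[OF _ B smith_mat_carrier q] minors_dvd_cong[OF _ smith_mat_carrier B q'] by blast
  also have "\<dots> \<longleftrightarrow> q \<le> (\<Sum>k<s. h k)"
  proof
    assume "minors_dvd (fps_X ^ q) (smith_mat m n h :: 'a fps mat) s"
    then have "fps_X ^ q dvd fminor (smith_mat m n h :: 'a fps mat) s (\<lambda>i. m - 1 - i) (\<lambda>j. n - 1 - j)"
      using \<open>s \<le> m\<close> mn by (rule_tac minors_dvdD) (auto simp: smith_mat_def)
    then show "q \<le> (\<Sum>k<s. h k)"
      using fminor_smith_mat[OF mn \<open>s \<le> m\<close>, of h] fps_X_power_dvd_power_iff by metis
  next
    assume "q \<le> (\<Sum>k<s. h k)"
    moreover have "minors_dvd (fps_X ^ (\<Sum>k<s. h k)) (smith_mat m n h :: 'a fps mat) s"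
      by (rule minors_dvd_rows[OF smith_mat_carrier h]) (auto simp: smith_mat_def)
    ultimately show "minors_dvd (fps_X ^ q) (smith_mat m n h :: 'a fps mat) s"
      using minors_dvd_mono le_imp_power_dvd by blast
  qed
  finally show ?thesis .
qed

section \<open>Congruent matrices and truncation\<close>

lemma mult_mat_cong_left:
  fixes g :: "'a::comm_ring_1 mat"
  assumes "g \<in> carrier_mat l m" "A \<in> carrier_mat m n" "B \<in> carrier_mat m n"
    and "\<And>i j. i < m \<Longrightarrow> j < n \<Longrightarrow> d dvd A $$ (i, j) - B $$ (i, j)" and "i < l" "j < n"
  shows "d dvd (g * A) $$ (i, j) - (g * B) $$ (i, j)"
proof -
  have "(g * A) $$ (i, j) - (g * B) $$ (i, j) = (\<Sum>k = 0..<m. g $$ (i, k) * (A $$ (k, j) - B $$ (k, j)))"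
    using assms by (simp add: scalar_prod_def right_diff_distrib sum_subtractf)
  also have "d dvd \<dots>"
    using assms by (intro dvd_sum dvd_mult) auto
  finally show ?thesis .
qed

lemma mult_mat_cong_right:
  fixes h :: "'a::comm_ring_1 mat"
  assumes "h \<in> carrier_mat n l" "A \<in> carrier_mat m n" "B \<in> carrier_mat m n"
    and "\<And>i j. i < m \<Longrightarrow> j < n \<Longrightarrow> d dvd A $$ (i, j) - B $$ (i, j)" and "i < m" "j < l"
  shows "d dvd (A * h) $$ (i, j) - (B * h) $$ (i, j)"
proof -
  have "(A * h) $$ (i, j) - (B * h) $$ (i, j) = (\<Sum>k = 0..<n. (A $$ (i, k) - B $$ (i, k)) * h $$ (k, j))"
    using assms by (simp add: scalar_prod_def left_diff_distrib sum_subtractf)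
  also have "d dvd \<dots>"
    using assms by (intro dvd_sum dvd_mult2) auto
  finally show ?thesis .
qed

text \<open>The same invertible factors are applied to both matrices. Thus a normal form known
  modulo \<open>d\<close> can be carried back to a matrix exactly equivalent to it, or forward to
  another lift of the same jet.\<close>

lemma mat_equiv_cong:
  fixes A :: "'a::comm_ring_1 mat"
  assumes "mat_equiv m n A B" and A': "A' \<in> carrier_mat m n"
    and d: "\<And>i j. i < m \<Longrightarrow> j < n \<Longrightarrow> d dvd A $$ (i, j) - A' $$ (i, j)"
  obtains B' where "mat_equiv m n A' B'" "\<And>i j. i < m \<Longrightarrow> j < n \<Longrightarrow> d dvd B $$ (i, j) - B' $$ (i, j)"
proof -
  obtain g g' h h' where *: "A \<in> carrier_mat m n" "mutual_inverse m g g'" "mutual_inverse n h h'" "B = g * A * h"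
    using assms(1) by (rule mat_equivE)
  then have c: "g \<in> carrier_mat m m" "h \<in> carrier_mat n n"
    by (auto simp: mutual_inverse_def)
  have "d dvd (g * A * h) $$ (i, j) - (g * A' * h) $$ (i, j)" if "i < m" "j < n" for i j
    using c *(1) A' d that
    by (intro mult_mat_cong_right[of _ n n _ m] mult_mat_cong_left[of _ m m _ n]) auto
  then show thesis
    using that[OF mat_equivI[OF A' *(2,3)]] *(4) by blast
qed

text \<open>Where \<open>f s \<le> p\<close>, all terms so far are uncapped and the hypothesis
  applies; otherwise the new term is \<open>p\<close>, which is at least
  \<open>\<mu> s\<close>.\<close>

lemma sum_min_dominance:
  fixes \<mu> f :: "nat \<Rightarrow> nat"
  assumes f: "mono_on {..<m} f" and \<mu>: "\<And>k. k < m \<Longrightarrow> \<mu> k \<le> p"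
    and dom: "\<And>s. s \<le> m \<Longrightarrow> (\<Sum>k<s. \<mu> k) \<le> (\<Sum>k<s. f k)" and "s \<le> m"
  shows "(\<Sum>k<s. \<mu> k) \<le> (\<Sum>k<s. min (f k) p)"
  using \<open>s \<le> m\<close>
proof (induction s)
  case (Suc s)
  show ?case
  proof (cases "f s \<le> p")
    case True
    have "min (f k) p = f k" if "k < Suc s" for k
      using mono_onD[OF f, of k s] that True Suc.prems by auto
    then have "(\<Sum>k<Suc s. min (f k) p) = (\<Sum>k<Suc s. f k)"
      by (intro sum.cong) auto
    then show ?thesis
      using dom[OF Suc.prems] by simp
  next
    case False
    then show ?thesis
      using Suc \<mu>[of s] by simp
  qed
qed simp

text \<open>Entries that differ by multiples of \<open>t\<^sup>p\<close> do not affect the bounds, although these bounds may exceed \<open>p\<close>.\<close>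

lemma minors_dvd_truncation:
  fixes A :: "'a::field fps mat"
  assumes A: "A \<in> carrier_mat m n" and B: "B \<in> carrier_mat m n" and mn: "m \<le> n"
    and cong: "\<And>i j. i < m \<Longrightarrow> j < n \<Longrightarrow> fps_X ^ p dvd A $$ (i, j) - B $$ (i, j)"
    and \<mu>: "\<And>k. k < m \<Longrightarrow> \<mu> k \<le> p"
    and dvd: "\<And>s. s \<le> m \<Longrightarrow> minors_dvd (fps_X ^ (\<Sum>k<s. \<mu> k)) A s" and "s \<le> m"
  shows "minors_dvd (fps_X ^ (\<Sum>k<s. \<mu> k)) B s"
proof -
  \<comment> \<open>\<open>N\<close> has to cover \<open>p\<close>, to see the congruence, and every
    bound, to read it off the exponents.\<close>
  define N where "N = p + (\<Sum>k<m. \<mu> k)"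
  have N: "p \<le> N" by (simp add: N_def)
  have N': "(\<Sum>k<s. \<mu> k) \<le> N" if "s \<le> m" for s
    unfolding N_def using that by (intro trans_le_add2 sum_mono2) auto
  obtain C h where C: "mat_equiv m n A C" and h: "mono_on {..<m} h"
    and cC: "\<And>i j. i < m \<Longrightarrow> j < n \<Longrightarrow> fps_X ^ N dvd C $$ (i, j) - smith_mat m n h $$ (i, j)"
    by (rule smith_form_mod[OF A mn, of N]) blast
  have dom: "(\<Sum>k<s. \<mu> k) \<le> (\<Sum>k<s. h k)" if "s \<le> m" for s
    using minors_dvd_smith_iff[OF C mn h cC N' that] dvd that by blast
  obtain D where D: "mat_equiv m n B D"
    and CD: "\<And>i j. i < m \<Longrightarrow> j < n \<Longrightarrow> fps_X ^ p dvd C $$ (i, j) - D $$ (i, j)"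
    by (rule mat_equiv_cong[OF C B cong]) blast+
  \<comment> \<open>\<open>D\<close> is diagonal only modulo t^p, so row \<open>i\<close> retains t
    to the capped exponent; the cap is harmless by \<open>sum_min_dominance\<close>.\<close>
  have "fps_X ^ min (h (m - 1 - i)) p dvd D $$ (i, j)" if "i < m" "j < n" for i j
  proof -
    let ?e = "min (h (m - 1 - i)) p"
    have "fps_X ^ ?e dvd C $$ (i, j) - smith_mat m n h $$ (i, j)"
      using cC[OF that] le_imp_power_dvd[of ?e N "fps_X :: 'a fps"] N dvd_trans by fastforce
    moreover have "fps_X ^ ?e dvd C $$ (i, j) - D $$ (i, j)"
      using CD[OF that] le_imp_power_dvd[of ?e p "fps_X :: 'a fps"] dvd_trans by fastforce
    moreover have "fps_X ^ ?e dvd (smith_mat m n h $$ (i, j) :: 'a fps)"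
      using that by (auto simp: smith_mat_def intro: le_imp_power_dvd)
    ultimately have "fps_X ^ ?e dvd (C $$ (i, j) - smith_mat m n h $$ (i, j)) + smith_mat m n h $$ (i, j) - (C $$ (i, j) - D $$ (i, j))"
      by (simp only: dvd_add dvd_diff)
    then show ?thesis by simp
  qed
  moreover have "mono_on {..<m} (\<lambda>k. min (h k) p)"
    using h unfolding mono_on_def by (meson min.mono order_refl)
  ultimately have "minors_dvd (fps_X ^ (\<Sum>k<s. min (h k) p)) D s"
    using mat_equiv_carrier[OF D] by (intro minors_dvd_rows[of _ m n]) auto
  moreover have "(\<Sum>k<s. \<mu> k) \<le> (\<Sum>k<s. min (h k) p)"
    by (rule sum_min_dominance[OF h \<mu> dom \<open>s \<le> m\<close>])
  ultimately show ?thesis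
    using minors_dvd_equiv_iff[OF D] minors_dvd_mono le_imp_power_dvd by blast
qed

lemma minors_dvd_Suc:
  fixes A :: "'a::field fps mat"
  assumes d: "minors_dvd (fps_X ^ q) A s" and s: "s \<ge> 1"
  shows "minors_dvd (fps_X ^ (q + nat \<lceil>real q / real s\<rceil>)) A (Suc s)"
proof (rule minors_dvdI)
  fix \<alpha> \<beta> assume *: "\<alpha> ` {..<Suc s} \<subseteq> {..<dim_row A}" "\<beta> ` {..<Suc s} \<subseteq> {..<dim_col A}"
  show "fps_X ^ (q + nat \<lceil>real q / real s\<rceil>) dvd fminor A (Suc s) \<alpha> \<beta>"
  proof (cases "fminor A (Suc s) \<alpha> \<beta> = 0")
    case False
    let ?o = "subdegree (fminor A (Suc s) \<alpha> \<beta>)"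
    have "Suc s * q \<le> s * ?o"
      by (rule subdegree_fminor_Suc[OF d * False])
    then have "real (Suc s * q) \<le> real (s * ?o)"
      by (rule of_nat_mono)
    then have "real q / real s \<le> real_of_int (int ?o - int q)"
      using s by (simp add: field_simps)
    then have "\<lceil>real q / real s\<rceil> \<le> int ?o - int q"
      by (rule ceiling_le)
    moreover have "0 \<le> \<lceil>real q / real s\<rceil>"
      using ceiling_mono[of 0 "real q / real s"] by simp
    ultimately have "q + nat \<lceil>real q / real s\<rceil> \<le> ?o"
      by linarith
    then show ?thesis
      by (auto simp: fps_X_power_dvd_iff intro: nth_less_subdegree_zero)
  qed simp
qed

section \<open>Units and invertible matrices over power series\<close>

lemma mutual_inverse_det:
  assumes "mutual_inverse n g g'"
  shows "fps_nth (det g) 0 \<noteq> (0 :: 'a::field)"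
proof -
  have "det g * det g' = 1"
    using assms det_mult[of g n g'] by (simp add: mutual_inverse_def)
  then have "fps_nth (det g) 0 * fps_nth (det g') 0 = 1"
    by (metis fps_mult_nth_0 fps_one_nth)
  then show ?thesis by auto
qed

text \<open>Power series form a local ring: a determinant with nonzero constant term is a unit, and
  the adjugate gives the inverse. Invertibility thus becomes an open condition on a single
  coefficient.\<close>

lemma mutual_inverse_exists:
  fixes g :: "'a::field fps mat"
  assumes g: "g \<in> carrier_mat n n" and "fps_nth (det g) 0 \<noteq> 0"
  obtains g' where "mutual_inverse n g g'"
proof -
  have inv: "inverse (det g) * det g = 1"
    using assms(2) by (rule inverse_mult_eq_1)
  have "g * (inverse (det g) \<cdot>\<^sub>m adj_mat g) = 1\<^sub>m n" "(inverse (det g) \<cdot>\<^sub>m adj_mat g) * g = 1\<^sub>m n"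
    unfolding mult_smult_distrib[OF g adj_mat(1)[OF g]] mult_smult_assoc_mat[OF adj_mat(1)[OF g] g]
      adj_mat(2,3)[OF g]
    by (auto intro!: eq_matI simp: inv)
  then show thesis
    using that[of "inverse (det g) \<cdot>\<^sub>m adj_mat g"] g adj_mat(1)[OF g] by (simp add: mutual_inverse_def)
qed

subsection \<open>Polynomial functions and the Zariski topology\<close>

text \<open>A common interface for polynomial dependence, instantiated with polynomials in the
  coordinates, with polynomials in one parameter and, coefficientwise, with power series;
  determinants and matrix products are treated once for all of them.\<close>

definition fun_ring :: "('x \<Rightarrow> 'a::comm_ring_1) set \<Rightarrow> bool" where
  "fun_ring R \<longleftrightarrow> (\<forall>c. (\<lambda>_. c) \<in> R) \<and>
     (\<forall>f\<in>R. \<forall>g\<in>R. (\<lambda>x. f x + g x) \<in> R \<and> (\<lambda>x. f x * g x) \<in> R)"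

lemma fun_ring_const: "fun_ring R \<Longrightarrow> (\<lambda>_. c) \<in> R"
  by (simp add: fun_ring_def)

lemma fun_ring_add: "fun_ring R \<Longrightarrow> f \<in> R \<Longrightarrow> g \<in> R \<Longrightarrow> (\<lambda>x. f x + g x) \<in> R"
  by (simp add: fun_ring_def)

lemma fun_ring_mult: "fun_ring R \<Longrightarrow> f \<in> R \<Longrightarrow> g \<in> R \<Longrightarrow> (\<lambda>x. f x * g x) \<in> R"
  by (simp add: fun_ring_def)

lemma fun_ring_sum:
  assumes "fun_ring R" "\<And>i. i \<in> S \<Longrightarrow> (\<lambda>x. f i x) \<in> R"
  shows "(\<lambda>x. \<Sum>i\<in>S. f i x) \<in> R"
  using assms(2)
  by (induction S rule: infinite_finite_induct) (auto intro: fun_ring_const fun_ring_add assms(1))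

lemma fun_ring_prod:
  assumes "fun_ring R" "\<And>i. i \<in> S \<Longrightarrow> (\<lambda>x. f i x) \<in> R"
  shows "(\<lambda>x. \<Prod>i\<in>S. f i x) \<in> R"
  using assms(2)
  by (induction S rule: infinite_finite_induct) (auto intro: fun_ring_const fun_ring_mult assms(1))

lemma fun_ring_power:
  assumes "fun_ring R" "f \<in> R"
  shows "(\<lambda>x. f x ^ k) \<in> R"
  by (induction k) (auto intro: fun_ring_const fun_ring_mult assms)

lemma fun_ring_det:
  assumes R: "fun_ring R" and M: "\<And>i j. i < s \<Longrightarrow> j < s \<Longrightarrow> (\<lambda>x. M x i j) \<in> R"
  shows "(\<lambda>x. det (mat s s (\<lambda>(i, j). M x i j))) \<in> R"
proof -
  have "det (mat s s (\<lambda>(i, j). M x i j))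
      = (\<Sum>p | p permutes {0..<s}. signof p * (\<Prod>i = 0..<s. M x i (p i)))" for x
  proof -
    have "p i < s" if "p permutes {0..<s}" "i < s" for p i
      using permutes_in_image[OF that(1), of i] that(2) by simp
    then show ?thesis
      by (subst det_def'[of _ s]) (auto intro!: sum.cong prod.cong)
  qed
  moreover have "(\<lambda>x. \<Sum>p | p permutes {0..<s}. signof p * (\<Prod>i = 0..<s. M x i (p i))) \<in> R"
  proof (intro fun_ring_sum fun_ring_mult fun_ring_const fun_ring_prod R M)
    fix p i assume "p \<in> {p. p permutes {0..<s}}" "i \<in> {0..<s}"
    then show "p i < s" "i < s"
      using permutes_in_image[of p "{0..<s}" i] by simp_all
  qed
  ultimately show ?thesis
    by simp
qed

lemma fun_ring_mult_mat:
  assumes R: "fun_ring R"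
    and A: "\<And>x. A x \<in> carrier_mat m k" and B: "\<And>x. B x \<in> carrier_mat k n"
    and "\<And>i j. i < m \<Longrightarrow> j < k \<Longrightarrow> (\<lambda>x. A x $$ (i, j)) \<in> R"
    and "\<And>i j. i < k \<Longrightarrow> j < n \<Longrightarrow> (\<lambda>x. B x $$ (i, j)) \<in> R"
    and ij: "i < m" "j < n"
  shows "(\<lambda>x. (A x * B x) $$ (i, j)) \<in> R"
proof -
  have "(A x * B x) $$ (i, j) = (\<Sum>l = 0..<k. A x $$ (i, l) * B x $$ (l, j))" for x
    using A[of x] B[of x] ij by (simp add: scalar_prod_def)
  then show ?thesis
    using assms by (auto intro!: fun_ring_sum fun_ring_mult)
qed

text \<open>Each coefficient of a product is a finite convolution, so this dependence survives
  multiplication although the degrees may grow with \<open>l\<close>.\<close>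

definition coeffwise :: "('x \<Rightarrow> 'a::comm_ring_1) set \<Rightarrow> ('x \<Rightarrow> 'a fps) set" where
  "coeffwise R = {u. \<forall>l. (\<lambda>x. fps_nth (u x) l) \<in> R}"

lemma coeffwiseD: "u \<in> coeffwise R \<Longrightarrow> (\<lambda>x. fps_nth (u x) l) \<in> R"
  by (simp add: coeffwise_def)

lemma fun_ring_coeffwise:
  assumes "fun_ring R"
  shows "fun_ring (coeffwise R)"
  unfolding fun_ring_def
proof (intro conjI allI ballI)
  fix c :: "'b fps"
  show "(\<lambda>_. c) \<in> coeffwise R"
    using assms by (auto simp: coeffwise_def intro: fun_ring_const)
next
  fix f g assume "f \<in> coeffwise R" "g \<in> coeffwise R"
  then show "(\<lambda>x. f x + g x) \<in> coeffwise R" "(\<lambda>x. f x * g x) \<in> coeffwise R"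
    using assms
    by (auto simp: coeffwise_def fps_mult_nth intro!: fun_ring_add fun_ring_sum fun_ring_mult)
qed

lemma fun_ring_mpoly_eval:
  assumes R: "fun_ring R" and f: "f \<in> mpolys V" and x: "\<And>v. v \<in> V \<Longrightarrow> (\<lambda>c. x c v) \<in> R"
  shows "(\<lambda>c. mpoly_eval (x c) f) \<in> R"
  unfolding mpoly_eval_def mono_eval_def
proof (intro fun_ring_sum fun_ring_mult fun_ring_const fun_ring_prod fun_ring_power R x)
  fix \<mu> v assume "\<mu> \<in> Poly_Mapping.keys f" "v \<in> Poly_Mapping.keys \<mu>"
  then show "v \<in> V"
    using f by (auto simp: mpolys_def)
qed

definition polyfuns :: "'v set \<Rightarrow> (('v \<Rightarrow> 'a::comm_ring_1) \<Rightarrow> 'a) set" where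
  "polyfuns V = {\<phi>. \<exists>f\<in>mpolys V. \<forall>x. \<phi> x = mpoly_eval x f}"

lemma fun_ring_polyfuns: "fun_ring (polyfuns V :: (('v \<Rightarrow> 'a::comm_ring_1) \<Rightarrow> 'a) set)"
  unfolding fun_ring_def
proof (intro conjI allI ballI)
  fix c :: 'a
  have "Poly_Mapping.single 0 c \<in> mpolys V"
    by (auto simp: mpolys_def)
  then show "(\<lambda>_. c) \<in> polyfuns V"
    unfolding polyfuns_def by (intro CollectI bexI[of _ "Poly_Mapping.single 0 c"]) simp_all
next
  fix \<phi> \<psi> :: "('v \<Rightarrow> 'a) \<Rightarrow> 'a" assume "\<phi> \<in> polyfuns V" "\<psi> \<in> polyfuns V"
  then obtain f g where fg: "f \<in> mpolys V" "g \<in> mpolys V" "\<And>x. \<phi> x = mpoly_eval x f" "\<And>x. \<psi> x = mpoly_eval x g"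
    by (auto simp: polyfuns_def)
  have "f + g \<in> mpolys V"
    using fg(1,2) Poly_Mapping.keys_add[of f g] unfolding mpolys_def by blast
  then show "(\<lambda>x. \<phi> x + \<psi> x) \<in> polyfuns V"
    using fg(3,4) unfolding polyfuns_def by (intro CollectI bexI[of _ "f + g"]) (simp_all add: mpoly_eval_add)
  show "(\<lambda>x. \<phi> x * \<psi> x) \<in> polyfuns V"
    using fg(3,4) mpolys_mult[OF fg(1,2)] unfolding polyfuns_def
    by (intro CollectI bexI[of _ "f * g"]) (simp_all add: mpoly_eval_mult)
qed

lemma polyfuns_var: "v \<in> V \<Longrightarrow> (\<lambda>x. x v) \<in> polyfuns V"
  unfolding polyfuns_def
  by (intro CollectI bexI[of _ "mvar v"]) (simp_all, simp add: mvar_def mpolys_def)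

lemma closedin_polyfuns:
  fixes \<Phi> :: "(('v \<Rightarrow> 'a::idom) \<Rightarrow> 'a) set"
  assumes "\<Phi> \<subseteq> polyfuns V"
  shows "closedin (zariski V) {x \<in> affine_space V. \<forall>\<phi>\<in>\<Phi>. \<phi> x = 0}"
proof -
  have "\<exists>f. f \<in> mpolys V \<and> (\<forall>x. \<phi> x = mpoly_eval x f)" if "\<phi> \<in> \<Phi>" for \<phi>
    using assms that by (auto simp: polyfuns_def)
  then obtain F where F: "\<And>\<phi>. \<phi> \<in> \<Phi> \<Longrightarrow> F \<phi> \<in> mpolys V \<and> (\<forall>x. \<phi> x = mpoly_eval x (F \<phi>))"
    by metis
  then have "{x \<in> affine_space V. \<forall>\<phi>\<in>\<Phi>. \<phi> x = 0} = zero_locus V (F ` \<Phi>)"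
    by (auto simp: zero_locus_def)
  then show ?thesis
    unfolding closedin_zariski using F by blast
qed

section \<open>Polynomial functions of one parameter\<close>

definition univariate_funs :: "('a::comm_ring_1 \<Rightarrow> 'a) set" where
  "univariate_funs = range poly"

lemma fun_ring_univariate: "fun_ring (univariate_funs :: ('a::comm_ring_1 \<Rightarrow> 'a) set)"
  unfolding fun_ring_def
proof (intro conjI allI ballI)
  fix c :: 'a
  have "poly [:c:] = (\<lambda>_. c)" by auto
  then show "(\<lambda>_. c) \<in> univariate_funs"
    unfolding univariate_funs_def by (metis rangeI)
next
  fix f g :: "'a \<Rightarrow> 'a" assume "f \<in> univariate_funs" "g \<in> univariate_funs"
  then obtain P Q where "f = poly P" "g = poly Q"
    by (auto simp: univariate_funs_def)
  then have "(\<lambda>x. f x + g x) = poly (P + Q)" "(\<lambda>x. f x * g x) = poly (P * Q)"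
    by auto
  then show "(\<lambda>x. f x + g x) \<in> univariate_funs" "(\<lambda>x. f x * g x) \<in> univariate_funs"
    by (simp_all add: univariate_funs_def)
qed

lemma univariate_id: "(\<lambda>c. c) \<in> univariate_funs"
proof -
  have "(\<lambda>c::'a. c) = poly [:0, 1:]" by auto
  then show ?thesis by (simp add: univariate_funs_def)
qed

text \<open>Were the field finite, 1 plus the product of all \<open>X - a\<close> would be
  nonconstant without a root.\<close>

lemma infinite_alg_closed_field: "infinite (UNIV :: 'a::alg_closed_field set)"
proof
  assume fin: "finite (UNIV :: 'a set)"
  define P :: "'a poly" where "P = (\<Prod>a\<in>UNIV. [:- a, 1:]) + 1"
  have deg: "degree (\<Prod>a\<in>(UNIV :: 'a set). [:- a, 1:]) = card (UNIV :: 'a set)"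
    by (subst degree_prod_eq_sum_degree) auto
  have "card (UNIV :: 'a set) > 0"
    using fin by (simp add: card_gt_0_iff)
  then have "degree P > 0"
    unfolding P_def using deg by (subst degree_add_eq_left) auto
  then obtain z where "poly P z = 0"
    using alg_closed_imp_poly_has_root by blast
  moreover have "poly P z = 1"
    unfolding P_def using fin by (auto simp: poly_prod)
  ultimately show False by simp
qed

lemma univariate_zero_at_0:
  fixes f :: "'a::alg_closed_field \<Rightarrow> 'a"
  assumes "f \<in> univariate_funs" "\<And>c. c \<noteq> 0 \<Longrightarrow> f c = 0"
  shows "f 0 = 0"
proof -
  obtain P where P: "f = poly P"
    using assms(1) by (auto simp: univariate_funs_def)
  have "infinite {c. poly P c = 0}"
  proof -
    have "UNIV - {0} \<subseteq> {c. poly P c = 0}"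
      using assms(2) P by auto
    moreover have "infinite (UNIV - {0 :: 'a})"
      using infinite_alg_closed_field by simp
    ultimately show ?thesis
      using infinite_super by blast
  qed
  then have "P = 0"
    using poly_roots_finite by blast
  then show ?thesis
    by (simp add: P)
qed

lemma univariate_nonzero:
  fixes f :: "'a::alg_closed_field \<Rightarrow> 'a"
  assumes "f \<in> univariate_funs" "f a \<noteq> 0" "g \<in> univariate_funs" "g b \<noteq> 0" "h \<in> univariate_funs" "h d \<noteq> 0"
  obtains c where "f c \<noteq> 0" "g c \<noteq> 0" "h c \<noteq> 0"
proof -
  obtain P Q R where PQR: "f = poly P" "g = poly Q" "h = poly R"
    using assms by (auto simp: univariate_funs_def)
  then have "P * Q * R \<noteq> 0"
    using assms by auto
  then have "finite {c. poly (P * Q * R) c = 0}"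
    by (rule poly_roots_finite)
  then obtain c where "poly (P * Q * R) c \<noteq> 0"
    using infinite_alg_closed_field by (metis (mono_tags, lifting) UNIV_eq_I mem_Collect_eq)
  then show thesis
    using that PQR by auto
qed

text \<open>An algebraic limit: each defining polynomial restricts to a polynomial in
  \<open>c\<close> that vanishes for \<open>c \<noteq> 0\<close>, hence also at 0 because the field
  is infinite.\<close>

lemma zariski_closed_limit:
  fixes x :: "'a::alg_closed_field \<Rightarrow> 'v \<Rightarrow> 'a"
  assumes Z: "closedin (zariski V) Z" and x: "\<And>v. v \<in> V \<Longrightarrow> (\<lambda>c. x c v) \<in> univariate_funs"
    and "\<And>c. x c \<in> affine_space V" and "\<And>c. c \<noteq> 0 \<Longrightarrow> x c \<in> Z"
  shows "x 0 \<in> Z"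
proof -
  obtain F where F: "F \<subseteq> mpolys V" "Z = zero_locus V F"
    using Z closedin_zariski by blast
  have "mpoly_eval (x 0) f = 0" if "f \<in> F" for f
  proof (rule univariate_zero_at_0)
    show "(\<lambda>c. mpoly_eval (x c) f) \<in> univariate_funs"
      using F(1) that x by (intro fun_ring_mpoly_eval[OF fun_ring_univariate]) auto
    show "mpoly_eval (x c) f = 0" if "c \<noteq> 0" for c
      using assms(4)[OF that] \<open>f \<in> F\<close> F(2) by (auto simp: zero_locus_def)
  qed
  then show ?thesis
    using F(2) assms(3) by (auto simp: zero_locus_def)
qed

text \<open>Two polynomials, each nonzero at one end of the curve, and the open condition
  \<open>d\<close> are nonzero at a common parameter. Families of polynomials appear instead of
  closed sets so that the same polynomials can be evaluated on arcs and on jets.\<close>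

lemma irreducible_by_curves:
  fixes S :: "('v \<Rightarrow> 'a::alg_closed_field) set"
  assumes curve: "\<And>y z. y \<in> S \<Longrightarrow> z \<in> S \<Longrightarrow>
      \<exists>x d. (\<forall>v\<in>V. (\<lambda>c. x c v) \<in> univariate_funs) \<and> x 0 = y \<and> x 1 = z \<and>
        d \<in> univariate_funs \<and> d 0 \<noteq> 0 \<and> (\<forall>c. d c \<noteq> 0 \<longrightarrow> x c \<in> S)"
    and F: "F \<subseteq> mpolys V" and G: "G \<subseteq> mpolys V"
    and cover: "\<And>y. y \<in> S \<Longrightarrow> (\<forall>f\<in>F. mpoly_eval y f = 0) \<or> (\<forall>g\<in>G. mpoly_eval y g = 0)"
  shows "(\<forall>y\<in>S. \<forall>f\<in>F. mpoly_eval y f = 0) \<or> (\<forall>y\<in>S. \<forall>g\<in>G. mpoly_eval y g = 0)"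
proof (rule ccontr)
  assume "\<not> ?thesis"
  then obtain y f z g where yf: "y \<in> S" "f \<in> F" "mpoly_eval y f \<noteq> 0"
    and zg: "z \<in> S" "g \<in> G" "mpoly_eval z g \<noteq> 0"
    by blast
  obtain x d where x: "\<And>v. v \<in> V \<Longrightarrow> (\<lambda>c. x c v) \<in> univariate_funs" "x 0 = y" "x 1 = z"
    and d: "d \<in> univariate_funs" "d 0 \<noteq> 0" "\<And>c. d c \<noteq> 0 \<Longrightarrow> x c \<in> S"
    using curve[OF yf(1) zg(1)] by blast
  have "(\<lambda>c. mpoly_eval (x c) f) \<in> univariate_funs" "(\<lambda>c. mpoly_eval (x c) g) \<in> univariate_funs"
    using yf(2) zg(2) F G x(1) by (auto intro!: fun_ring_mpoly_eval[OF fun_ring_univariate])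
  from univariate_nonzero[OF d(1,2) this(1) _ this(2), of 0 1]
  obtain c where "d c \<noteq> 0" "mpoly_eval (x c) f \<noteq> 0" "mpoly_eval (x c) g \<noteq> 0"
    using x(2,3) yf(3) zg(3) by auto
  then show False
    using cover[OF d(3)] yf(2) zg(2) by blast
qed

subsection \<open>Dominance of exponent sequences\<close>

text \<open>
  The sequence \<open>h\<close> is brought down to \<open>\<mu>\<close> by unit moves: at the first index \<open>u\<close> where the
  partial sums differ, decrease \<open>h u\<close>, and increase the entry just before the partial sums
  agree again, if they do. Each move keeps \<open>h\<close> sorted and dominated by \<open>\<mu>\<close>.
\<close>

lemma dominance_induct:
  fixes h \<mu> :: "nat \<Rightarrow> nat"
  assumes \<mu>: "mono_on {..<m} \<mu>" and h: "mono_on {..<m} h"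
    and dom: "\<And>s. s \<le> m \<Longrightarrow> (\<Sum>k<s. \<mu> k) \<le> (\<Sum>k<s. h k)"
    and base: "\<And>h. (\<And>k. k < m \<Longrightarrow> h k = \<mu> k) \<Longrightarrow> P h"
    and dec: "\<And>h u. u < m \<Longrightarrow> h u \<ge> 1 \<Longrightarrow> P (h(u := h u - 1)) \<Longrightarrow> P h"
    and shift: "\<And>h u v. u < m \<Longrightarrow> v < m \<Longrightarrow> u \<noteq> v \<Longrightarrow> h u \<ge> 1 \<Longrightarrow> h u \<le> h v \<Longrightarrow>
                  P (h(u := h u - 1, v := h v + 1)) \<Longrightarrow> P h"
  shows "P h"
  using h dom
\<comment> \<open>The sum of all partial sums drops: a move lowers by 1 the partial sums between its
  two positions, or all those after \<open>u\<close>, and keeps the others.\<close>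
proof (induction "\<Sum>s\<le>m. \<Sum>k<s. h k" arbitrary: h rule: less_induct)
  case less
  define H where "H s = (\<Sum>k<s. h k)" for s
  define M where "M s = (\<Sum>k<s. \<mu> k)" for s
  have MH: "M s \<le> H s" if "s \<le> m" for s
    using less.prems(2) that by (simp add: M_def H_def)
  have HS: "H (Suc s) = H s + h s" "M (Suc s) = M s + \<mu> s" for s
    by (simp_all add: H_def M_def)
  show ?case
  proof (cases "\<forall>s\<le>m. H s = M s")
    case True
    have "h k = \<mu> k" if "k < m" for k
    proof -
      have "H k = M k" "H (Suc k) = M (Suc k)"
        using True that by simp_all
      then show ?thesis
        using HS[of k] by linarith
    qed
    then show ?thesis by (rule base)
  next
    case False
    define Q where "Q s \<longleftrightarrow> s \<le> m \<and> H s \<noteq> M s" for s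
    define u' where "u' = (LEAST s. Q s)"
    have Q: "Q u'"
      unfolding u'_def by (rule LeastI_ex) (use False in \<open>simp add: Q_def\<close>)
    have notQ: "\<not> Q s" if "s < u'" for s
      using that unfolding u'_def by (rule not_less_Least)
    have "u' \<noteq> 0"
    proof
      assume "u' = 0"
      then show False
        using Q by (simp add: Q_def H_def M_def)
    qed
    then obtain u where u': "u' = Suc u"
      using not0_implies_Suc by blast
    have u: "u < m"
      using Q unfolding u' by (simp add: Q_def)
    have eq: "H s = M s" if "s \<le> u" for s
      using notQ[of s] that u unfolding u' by (simp add: Q_def)
    have gt: "H (Suc u) > M (Suc u)"
      using Q MH[of "Suc u"] unfolding u' Q_def by linarith
    then have hu: "h u > \<mu> u"
      using HS[of u] eq[OF order_refl] by linarith
    \<comment> \<open>Before \<open>u\<close> the two sequences agree and \<open>\<mu>\<close> is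
      sorted, so decreasing \<open>h u\<close> cannot break the order.\<close>
    have before: "h k \<le> h u - 1" if "k < u" for k
    proof -
      have "h k = \<mu> k"
        using HS[of k] eq[of k] eq[of "Suc k"] that by linarith
      also have "\<dots> \<le> \<mu> u"
        using that u by (intro mono_onD[OF \<mu>]) auto
      finally show ?thesis using hu by simp
    qed
    have mono: "h k \<le> h l" if "k \<le> l" "l < m" for k l
      using that by (intro mono_onD[OF less.prems(1)]) auto
    show ?thesis
    proof (cases "\<exists>s. u < s \<and> s \<le> m \<and> H s = M s")
      case no: False
      define h' where "h' = h(u := h u - 1)"
      have sum': "(\<Sum>k<s. h' k) = (if u < s then H s - 1 else H s)" for s
      proof (induction s)
        case (Suc s)
        have "H s \<ge> 1" if "u < s"
        proof -
          have "h u \<le> H s"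
            unfolding H_def using that by (intro member_le_sum) auto
          then show ?thesis using hu by simp
        qed
        then show ?case
          using Suc hu HS(1)[of s] by (auto simp: h'_def less_Suc_eq)
      qed (simp add: H_def)
      show ?thesis
      proof (rule dec[OF u])
        have "P h'"
        proof (rule less.hyps)
          show "(\<Sum>s\<le>m. \<Sum>k<s. h' k) < (\<Sum>s\<le>m. \<Sum>k<s. h k)"
          proof (rule sum_strict_mono_ex1)
            show "\<forall>s\<in>{..m}. (\<Sum>k<s. h' k) \<le> (\<Sum>k<s. h k)"
              unfolding sum' by (simp add: H_def)
            have "(\<Sum>k<Suc u. h' k) < (\<Sum>k<Suc u. h k)"
              unfolding sum' using gt by (simp add: H_def)
            then show "\<exists>s\<in>{..m}. (\<Sum>k<s. h' k) < (\<Sum>k<s. h k)"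
              using u by (intro bexI[of _ "Suc u"]) auto
          qed simp
          show "mono_on {..<m} h'"
          proof (rule mono_onI)
            fix k l assume kl: "k \<in> {..<m}" "l \<in> {..<m}" "k \<le> l"
            consider "k = l" | "k < l" "l = u" | "k < l" "l \<noteq> u"
              using kl(3) by linarith
            then show "h' k \<le> h' l"
            proof cases
              case 2
              then show ?thesis using before[of k] by (simp add: h'_def)
            next
              case 3
              then show ?thesis using mono[of k l] kl by (auto simp: h'_def)
            qed simp
          qed
          show "(\<Sum>k<s. \<mu> k) \<le> (\<Sum>k<s. h' k)" if "s \<le> m" for s
          proof -
            have "M s < H s" if "u < s"
            proof -
              have "H s \<noteq> M s"
                using no that \<open>s \<le> m\<close> by blast
              then show ?thesis
                using MH[OF \<open>s \<le> m\<close>] by linarith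
            qed
            then show ?thesis
              unfolding sum' using MH[OF that] by (auto simp: M_def)
          qed
        qed
        then show "P (h(u := h u - 1))" by (simp add: h'_def)
        show "1 \<le> h u" using hu by simp
      qed
    next
      case True
      define R where "R s \<longleftrightarrow> u < s \<and> s \<le> m \<and> H s = M s" for s
      define v' where "v' = (LEAST s. R s)"
      have R: "R v'"
        unfolding v'_def by (rule LeastI_ex) (use True in \<open>simp add: R_def\<close>)
      have notR: "\<not> R s" if "s < v'" for s
        using that unfolding v'_def by (rule not_less_Least)
      have "v' \<noteq> Suc u" "u < v'"
        using R gt unfolding R_def by auto
      then obtain v where v': "v' = Suc v" "u < v"
        by (cases v') auto
      have v: "v < m" "H (Suc v) = M (Suc v)"
        using R unfolding v'(1) R_def by simp_all
      have mid: "M s < H s" if "u < s" "s \<le> v" for s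
        using notR[of s] MH[of s] that v(1) unfolding R_def v'(1) by linarith
      have hv: "h v < \<mu> v"
        using HS[of v] mid[OF v'(2) order_refl] v(2) by linarith
      \<comment> \<open>The partial sums meet at \<open>Suc v\<close>, so domination one index
        further gives \<open>\<mu> (Suc v) \<le> h (Suc v)\<close>; hence increasing
        \<open>h v\<close> keeps the order.\<close>
      have after: "h v + 1 \<le> h k" if "v < k" "k < m" for k
      proof -
        have "h v + 1 \<le> \<mu> v" using hv by simp
        also have "\<mu> v \<le> \<mu> (Suc v)"
          using that by (intro mono_onD[OF \<mu>]) auto
        also have "\<dots> \<le> h (Suc v)"
          using MH[of "Suc (Suc v)"] HS[of "Suc v"] v(2) that by linarith
        also have "\<dots> \<le> h k"
          using that by (intro mono) auto
        finally show ?thesis .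
      qed
      define h' where "h' = h(u := h u - 1, v := h v + 1)"
      have sum': "(\<Sum>k<s. h' k) = (if u < s \<and> s \<le> v then H s - 1 else H s)" for s
      proof (induction s)
        case (Suc s)
        have "H s \<ge> 1" if "u < s"
        proof -
          have "h u \<le> H s"
            unfolding H_def using that by (intro member_le_sum) auto
          then show ?thesis using hu by simp
        qed
        then show ?case
          using Suc hu v' HS(1)[of s] by (auto simp: h'_def less_Suc_eq)
      qed (simp add: H_def)
      show ?thesis
      proof (rule shift[OF u v(1)])
        have "P h'"
        proof (rule less.hyps)
          show "(\<Sum>s\<le>m. \<Sum>k<s. h' k) < (\<Sum>s\<le>m. \<Sum>k<s. h k)"
          proof (rule sum_strict_mono_ex1)
            show "\<forall>s\<in>{..m}. (\<Sum>k<s. h' k) \<le> (\<Sum>k<s. h k)"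
              unfolding sum' by (simp add: H_def)
            have "(\<Sum>k<Suc u. h' k) < (\<Sum>k<Suc u. h k)"
              unfolding sum' using gt v' by (simp add: H_def)
            then show "\<exists>s\<in>{..m}. (\<Sum>k<s. h' k) < (\<Sum>k<s. h k)"
              using u by (intro bexI[of _ "Suc u"]) auto
          qed simp
          show "mono_on {..<m} h'"
          proof (rule mono_onI)
            fix k l assume kl: "k \<in> {..<m}" "l \<in> {..<m}" "k \<le> l"
            consider "k = l" | "k < l" "l = u" | "k < l" "k = v" | "k < l" "l \<noteq> u" "k \<noteq> v"
              using kl(3) by linarith
            then show "h' k \<le> h' l"
            proof cases
              case 2
              then show ?thesis using before[of k] v'(2) by (simp add: h'_def)
            next
              case 3
              then show ?thesis using after[of l] kl v'(2) by (simp add: h'_def)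
            next
              case 4
              then show ?thesis using mono[of k l] kl by (auto simp: h'_def)
            qed simp
          qed
          show "(\<Sum>k<s. \<mu> k) \<le> (\<Sum>k<s. h' k)" if "s \<le> m" for s
            unfolding sum' using mid[of s] MH[OF that] by (auto simp: M_def)
        qed
        then show "P (h(u := h u - 1, v := h v + 1))" by (simp add: h'_def)
        show "1 \<le> h u" "u \<noteq> v" "h u \<le> h v" using hu v' mono[of u v] v(1) by auto
      qed
    qed
  qed
qed

subsection \<open>Jets, arcs and degenerations of diagonal matrices\<close>

text \<open>The lift of a jet by zero coefficients from \<open>p\<close> on. Its minors are the
  untruncated minors of \<open>generic_matrix\<close> evaluated at \<open>x\<close>, in all
  degrees.\<close>

definition jet_mat :: "nat \<Rightarrow> nat \<Rightarrow> nat \<Rightarrow> (coord \<Rightarrow> 'a::comm_ring_1) \<Rightarrow> 'a fps mat" where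
  "jet_mat m n p x = mat m n (\<lambda>(i, j). Abs_fps (\<lambda>l. if l < p then x (i, j, l) else 0))"

definition arc_mat :: "nat \<Rightarrow> nat \<Rightarrow> (coord \<Rightarrow> 'a::comm_ring_1) \<Rightarrow> 'a fps mat" where
  "arc_mat m n x = mat m n (\<lambda>(i, j). Abs_fps (\<lambda>l. x (i, j, l)))"

lemma jet_mat_carrier [simp]: "jet_mat m n p x \<in> carrier_mat m n"
  by (simp add: jet_mat_def)

lemma arc_mat_carrier [simp]: "arc_mat m n x \<in> carrier_mat m n"
  by (simp add: arc_mat_def)

lemma arc_mat_arc_of_mat: "A \<in> carrier_mat m n \<Longrightarrow> arc_mat m n (arc_of_mat m n A) = A"
  by (intro eq_matI) (auto simp: arc_mat_def arc_of_mat_def arc_coords_def fps_eq_iff)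

lemma arc_of_mat_affine: "arc_of_mat m n A \<in> affine_space (arc_coords m n)"
  by (simp add: arc_of_mat_def affine_space_def)

lemma jet_mat_truncate_arc:
  assumes "i < m" "j < n"
  shows "fps_X ^ p dvd arc_mat m n y $$ (i, j) - jet_mat m n p (truncate_arc m n p y) $$ (i, j)"
  using assms by (auto simp: fps_X_power_dvd_iff arc_mat_def jet_mat_def truncate_arc_def jet_coords_def)

lemma truncate_arc_of_mat:
  assumes x: "x \<in> affine_space (jet_coords m n p)" and A: "A \<in> carrier_mat m n"
    and cong: "\<And>i j. i < m \<Longrightarrow> j < n \<Longrightarrow> fps_X ^ p dvd jet_mat m n p x $$ (i, j) - A $$ (i, j)"
  shows "truncate_arc m n p (arc_of_mat m n A) = x"
proof
  fix v :: coord
  obtain i j l where v: "v = (i, j, l)" by (cases v) auto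
  show "truncate_arc m n p (arc_of_mat m n A) v = x v"
  proof (cases "v \<in> jet_coords m n p")
    case True
    then have ijl: "i < m" "j < n" "l < p" by (auto simp: v jet_coords_def)
    then have "fps_nth (jet_mat m n p x $$ (i, j) - A $$ (i, j)) l = 0"
      using cong[OF ijl(1,2)] by (simp only: fps_X_power_dvd_iff)
    then show ?thesis
      using True ijl by (simp add: v truncate_arc_def arc_of_mat_def arc_coords_def jet_mat_def)
  next
    case False
    then show ?thesis
      using x unfolding v by (simp add: truncate_arc_def affine_space_def PiE_def extensional_def)
  qed
qed

text \<open>Coefficientwise evaluation is a ring homomorphism from polynomials in t to power series
  and so commutes with determinants.\<close>

lemma det_generic_matrix_eval:
  "fps_nth (det (submatrix (jet_mat m n p x) I J)) \<alpha>
     = mpoly_eval x (coeff (det (submatrix (generic_matrix m n p) I J)) \<alpha>)"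
proof -
  define \<Phi> :: "(coord, 'a) mpoly poly \<Rightarrow> 'a fps" where "\<Phi> P = Abs_fps (\<lambda>l. mpoly_eval x (coeff P l))" for P
  have eval_sum: "mpoly_eval x (sum f S) = (\<Sum>i\<in>S. mpoly_eval x (f i))" for f :: "nat \<Rightarrow> (coord, 'a) mpoly" and S
    by (induction S rule: infinite_finite_induct) (auto simp: mpoly_eval_add)
  interpret comm_ring_hom \<Phi>
  proof
    show "\<Phi> (P + Q) = \<Phi> P + \<Phi> Q" for P Q
      by (simp add: \<Phi>_def fps_eq_iff mpoly_eval_add)
    show "\<Phi> (P * Q) = \<Phi> P * \<Phi> Q" for P Q
      by (simp add: \<Phi>_def fps_eq_iff fps_mult_nth coeff_mult eval_sum mpoly_eval_mult atLeast0AtMost)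
    show "\<Phi> 1 = 1"
      by (simp add: \<Phi>_def fps_eq_iff)
  qed (simp add: \<Phi>_def fps_eq_iff)
  have "map_mat \<Phi> (submatrix (generic_matrix m n p) I J) = submatrix (jet_mat m n p x) I J"
  proof (rule eq_matI)
    fix i j assume "i < dim_row (submatrix (jet_mat m n p x) I J)" "j < dim_col (submatrix (jet_mat m n p x) I J)"
    then have ij: "i < card {i. i < m \<and> i \<in> I}" "j < card {j. j < n \<and> j \<in> J}"
      by (simp_all add: dim_submatrix jet_mat_def)
    then have pick: "pick I i < m" "pick J j < n"
      by (auto intro: pick_le)
    have "coeff (\<Sum>l<p. monom (mvar (a, b, l)) l) k = (if k < p then mvar (a, b, k) else (0 :: (coord, 'a) mpoly))" for a b k
      by (simp add: coeff_sum)
    then show "map_mat \<Phi> (submatrix (generic_matrix m n p) I J) $$ (i, j) = submatrix (jet_mat m n p x) I J $$ (i, j)"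
      using ij pick by (auto simp: submatrix_def generic_matrix_def jet_mat_def \<Phi>_def fps_eq_iff)
  qed (simp_all add: dim_submatrix generic_matrix_def jet_mat_def)
  then have "det (submatrix (jet_mat m n p x) I J) = \<Phi> (det (submatrix (generic_matrix m n p) I J))"
    using hom_det[of "submatrix (generic_matrix m n p) I J"] by simp
  then show ?thesis
    by (simp add: \<Phi>_def)
qed

lemma minor_coeffs_vanish_iff:
  fixes x :: "coord \<Rightarrow> 'a::comm_ring_1"
  shows "(\<forall>\<alpha><q. \<forall>f\<in>minor_coeffs m n p s \<alpha>. mpoly_eval x f = 0) \<longleftrightarrow> minors_dvd (fps_X ^ q) (jet_mat m n p x) s"
proof -
  let ?G = "generic_matrix m n p :: (coord, 'a) mpoly poly mat"
  have "(\<forall>f\<in>minor_coeffs m n p s \<alpha>. mpoly_eval x f = 0) \<longleftrightarrow>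
      (\<forall>I J. I \<subseteq> {..<m} \<longrightarrow> J \<subseteq> {..<n} \<longrightarrow> card I = s \<longrightarrow> card J = s \<longrightarrow>
        mpoly_eval x (coeff (det (submatrix ?G I J)) \<alpha>) = 0)" for \<alpha>
    unfolding minor_coeffs_def by auto
  then show ?thesis
    unfolding minors_dvd_iff_submatrix[OF jet_mat_carrier] fps_X_power_dvd_iff det_generic_matrix_eval
    by auto
qed

definition fminor_coeff :: "('x \<Rightarrow> 'a::comm_ring_1 fps mat) \<Rightarrow> nat \<Rightarrow> (nat \<Rightarrow> nat) \<Rightarrow> (nat \<Rightarrow> nat) \<Rightarrow> nat \<Rightarrow> 'x \<Rightarrow> 'a" where
  "fminor_coeff A s \<alpha> \<beta> l x = fps_nth (fminor (A x) s \<alpha> \<beta>) l"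

text \<open>The matrix is a parameter because both jets and arcs are meant. Arcs have infinitely
  many coordinates, but each coefficient of a minor involves finitely many.\<close>

lemma closedin_minors_dvd:
  fixes A :: "('v \<Rightarrow> 'a::idom) \<Rightarrow> 'a fps mat"
  assumes A: "\<And>x. A x \<in> carrier_mat m n"
    and poly: "\<And>i j l. i < m \<Longrightarrow> j < n \<Longrightarrow> (\<lambda>x. fps_nth (A x $$ (i, j)) l) \<in> polyfuns V"
  shows "closedin (zariski V) {x \<in> affine_space V. \<forall>s\<in>S. minors_dvd (fps_X ^ q s) (A x) s}"
proof -
  define \<Phi> where "\<Phi> = (\<lambda>(s, \<alpha>, \<beta>, l). fminor_coeff A s \<alpha> \<beta> l) `
    {(s, \<alpha>, \<beta>, l). s \<in> S \<and> \<alpha> ` {..<s} \<subseteq> {..<m} \<and> \<beta> ` {..<s} \<subseteq> {..<n} \<and> l < q s}"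
  have "minors_dvd (fps_X ^ q s) (A x) s \<longleftrightarrow> (\<forall>\<alpha> \<beta> l. \<alpha> ` {..<s} \<subseteq> {..<m} \<and> \<beta> ` {..<s} \<subseteq> {..<n} \<and> l < q s
      \<longrightarrow> fminor_coeff A s \<alpha> \<beta> l x = 0)" for s x
    using A[of x] unfolding minors_dvd_def fps_X_power_dvd_iff fminor_coeff_def by auto
  then have "{x \<in> affine_space V. \<forall>s\<in>S. minors_dvd (fps_X ^ q s) (A x) s}
      = {x \<in> affine_space V. \<forall>\<phi>\<in>\<Phi>. \<phi> x = 0}"
    unfolding \<Phi>_def by auto
  moreover have "\<Phi> \<subseteq> polyfuns V"
  proof
    fix \<phi> assume "\<phi> \<in> \<Phi>"
    then obtain s \<alpha> \<beta> l where \<phi>: "\<phi> = fminor_coeff A s \<alpha> \<beta> l" and \<alpha>: "\<alpha> ` {..<s} \<subseteq> {..<m}" and \<beta>: "\<beta> ` {..<s} \<subseteq> {..<n}"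
      unfolding \<Phi>_def by auto
    have "(\<lambda>x. fminor (A x) s \<alpha> \<beta>) \<in> coeffwise (polyfuns V)"
      unfolding fminor_def
    proof (rule fun_ring_det[OF fun_ring_coeffwise[OF fun_ring_polyfuns]])
      fix i j assume "i < s" "j < s"
      then have "\<alpha> i < m" "\<beta> j < n" using \<alpha> \<beta> by auto
      then show "(\<lambda>x. A x $$ (\<alpha> i, \<beta> j)) \<in> coeffwise (polyfuns V)"
        using poly by (simp add: coeffwise_def)
    qed
    then show "\<phi> \<in> polyfuns V"
      unfolding \<phi> fminor_coeff_def by (rule coeffwiseD)
  qed
  ultimately show ?thesis
    using closedin_polyfuns[of \<Phi> V] by simp
qed

lemma jet_mat_polyfuns:
  assumes "i < m" "j < n"
  shows "(\<lambda>x. fps_nth (jet_mat m n p x $$ (i, j)) l) \<in> polyfuns (jet_coords m n p)"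
proof (cases "l < p")
  case True
  then show ?thesis
    using assms polyfuns_var[of "(i, j, l)" "jet_coords m n p"] by (simp add: jet_mat_def jet_coords_def)
next
  case False
  then show ?thesis
    using assms fun_ring_const[OF fun_ring_polyfuns] by (simp add: jet_mat_def)
qed

lemma arc_mat_polyfuns:
  assumes "i < m" "j < n"
  shows "(\<lambda>x. fps_nth (arc_mat m n x $$ (i, j)) l) \<in> polyfuns (arc_coords m n)"
  using assms polyfuns_var[of "(i, j, l)" "arc_coords m n"] by (simp add: arc_mat_def arc_coords_def)

section \<open>Degenerations of diagonal matrices along a line\<close>

definition diag_fps_mat :: "nat \<Rightarrow> nat \<Rightarrow> nat \<Rightarrow> (nat \<Rightarrow> nat) \<Rightarrow> 'a::comm_ring_1 fps mat" where
  "diag_fps_mat m n k f = mat m n (\<lambda>(i, j). if j = k + i then fps_X ^ f i else 0)"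

text \<open>The perturbed entry is t + c times t^(f a - 1), and t + c is a unit for nonzero
  \<open>c\<close>; at \<open>c = 0\<close> the exponent jumps back to \<open>f a\<close>.\<close>

lemma diag_fps_mat_dec:
  fixes c :: "'a::field"
  assumes kn: "k + m \<le> n" and a: "a < m" and f: "f a \<ge> 1" and c: "c \<noteq> 0"
  shows "mat_equiv m n (diag_fps_mat m n k (f(a := f a - 1)))
    (mat m n (\<lambda>(i, j). (if j = k + i then fps_X ^ f i else 0) +
       (if i = a \<and> j = k + a then fps_const c * fps_X ^ (f a - 1) else 0)))"
proof -
  let ?w = "fps_X + fps_const c :: 'a fps"
  have w: "?w * inverse ?w = 1"
    using c by (intro inverse_mult_eq_1') simp
  let ?D = "diag_fps_mat m n k (f(a := f a - 1)) :: 'a fps mat"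
  let ?u = "\<lambda>i. if i = a then ?w else 1"
  have "mat_equiv m n ?D (mat m n (\<lambda>(i, j). ?u i * ?D $$ (i, j)))"
    by (rule mat_equiv_scale_rows[where v = "\<lambda>i. if i = a then inverse ?w else 1"])
      (use w in \<open>auto simp: diag_fps_mat_def\<close>)
  also have "mat m n (\<lambda>(i, j). ?u i * ?D $$ (i, j)) = mat m n (\<lambda>(i, j). (if j = k + i then fps_X ^ f i else 0) +
       (if i = a \<and> j = k + a then fps_const c * fps_X ^ (f a - 1) else 0))"
  proof -
    have "?w * fps_X ^ (f a - 1) = fps_X ^ f a + fps_const c * fps_X ^ (f a - 1)"
      using f power_eq_if[of "fps_X :: 'a fps" "f a"] by (simp add: distrib_right)
    then show ?thesis
      by (intro eq_matI) (auto simp: diag_fps_mat_def)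
  qed
  finally show ?thesis .
qed

text \<open>With \<open>e = f a - 1\<close> the essential block has rows (t^(e + 1), c t^e) and (0,
  t^(f b)). Its least order is \<open>e\<close> and its determinant has order
  \<open>e + 1 + f b\<close>, so its exponents are \<open>f a - 1\<close> and
  \<open>f b + 1\<close>; at \<open>c = 0\<close> it is the original diagonal.\<close>

lemma diag_fps_mat_shift:
  fixes c :: "'a::field"
  assumes kn: "k + m \<le> n" and ab: "a < m" "b < m" "a \<noteq> b" and f: "f a \<ge> 1" "f a \<le> f b" and c: "c \<noteq> 0"
  shows "mat_equiv m n (diag_fps_mat m n k (f(a := f a - 1, b := f b + 1)))
    (mat m n (\<lambda>(i, j). (if j = k + i then fps_X ^ f i else 0) +
       (if i = a \<and> j = k + b then fps_const c * fps_X ^ (f a - 1) else 0)))"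
proof -
  define e where "e = f a - 1"
  define g where "g = f b - e"
  have fa: "f a = Suc e" and fb: "f b = e + g"
    using f by (auto simp: e_def g_def)
  let ?c = "fps_const c" and ?d = "fps_const (inverse c)" and ?X = "fps_X :: 'a fps"
  have cd: "?c * ?d = 1" "?d * ?c = 1"
    using c by (simp_all add: fps_const_mult)
  define S where "S = mat m n (\<lambda>(i, j). (if j = k + i then ?X ^ f i else 0) +
       (if i = a \<and> j = k + b then ?c * ?X ^ e else 0))"
  \<comment> \<open>Subtracting t / c times column \<open>k + b\<close> clears position
    \<open>(a, k + a)\<close>, leaving c t^e as the only entry of row \<open>a\<close>.\<close>
  define w where "w j = (if j = k + a then ?d * ?X else 0)" for j
  define S1 where "S1 = mat m n (\<lambda>(i, j). S $$ (i, j) - w j * S $$ (i, k + b))"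
  \<comment> \<open>Row \<open>a\<close> now clears t^(f b) in row \<open>b\<close>; the factor t^g
    exists because \<open>f a \<le> f b\<close>.\<close>
  define u where "u i = (if i = b then ?d * ?X ^ g else 0)" for i
  define S2 where "S2 = mat m n (\<lambda>(i, j). S1 $$ (i, j) - u i * S1 $$ (a, j))"
  \<comment> \<open>The two surviving entries are antidiagonal; a column swap and the scaling
    \<open>v\<close> put them on the diagonal with coefficient 1.\<close>
  define \<tau> where "\<tau> = Transposition.transpose (k + a) (k + b)"
  define S3 where "S3 = mat m n (\<lambda>(i, j). S2 $$ (i, \<tau> j))"
  define v where "v i = (if i = a then ?d else if i = b then - ?c else 1)" for i
  define S4 where "S4 = mat m n (\<lambda>(i, j). v i * S3 $$ (i, j))"
  have c: "S \<in> carrier_mat m n" "S1 \<in> carrier_mat m n" "S2 \<in> carrier_mat m n" "S3 \<in> carrier_mat m n"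
    by (simp_all add: S_def S1_def S2_def S3_def)
  have ka: "k + i < n" if "i < m" for i
    using that kn by simp
  have "mat_equiv m n S S1"
    unfolding S1_def using c ab ka by (intro mat_equiv_clear_cols) (auto simp: w_def)
  also have "mat_equiv m n S1 S2"
    unfolding S2_def using c ab ka by (intro mat_equiv_clear_rows) (auto simp: u_def)
  also (mat_equiv_trans) have "mat_equiv m n S2 S3"
    unfolding S3_def \<tau>_def using c ab ka by (intro mat_equiv_permute_cols) auto
  also (mat_equiv_trans) have "mat_equiv m n S3 S4"
    unfolding S4_def using c cd
    by (intro mat_equiv_scale_rows[where v = "\<lambda>i. if i = a then ?c else if i = b then - ?d else 1"])
      (auto simp: v_def)
  finally (mat_equiv_trans) have equiv: "mat_equiv m n S S4" .
  have S_other: "S $$ (i, j) = (if j = k + i then ?X ^ f i else 0)" if "i < m" "j < n" "i \<noteq> a \<or> j \<noteq> k + b" for i j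
    using that by (auto simp: S_def)
  have Sab: "S $$ (a, k + b) = ?c * ?X ^ e"
    using ab ka by (simp add: S_def)
  have S1_a: "S1 $$ (a, j) = (if j = k + b then ?c * ?X ^ e else 0)" if "j < n" for j
  proof -
    have "?d * ?X * (?c * ?X ^ e) = ?X ^ f a"
      unfolding fa power_Suc by (metis (no_types, lifting) cd(2) mult.assoc mult.commute mult_1_left)
    then show ?thesis
      using that ab ka by (auto simp: S1_def S_other Sab w_def)
  qed
  have S1_b: "S1 $$ (b, j) = (if j = k + b then ?X ^ f b else if j = k + a then - (?d * ?X ^ Suc (f b)) else 0)" if "j < n" for j
    using that ab ka by (auto simp: S1_def S_other w_def mult.assoc)
  have S1_other: "S1 $$ (i, j) = (if j = k + i then ?X ^ f i else 0)" if "i < m" "j < n" "i \<noteq> a" "i \<noteq> b" for i j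
    using that ab ka by (auto simp: S1_def S_other w_def)
  have S2_b: "S2 $$ (b, j) = (if j = k + a then - (?d * ?X ^ Suc (f b)) else 0)" if "j < n" for j
  proof -
    have "?d * ?X ^ g * (?c * ?X ^ e) = ?X ^ f b"
      unfolding fb power_add by (metis (no_types, lifting) cd(2) mult.assoc mult.commute mult_1_left)
    then show ?thesis
      using that ab ka by (auto simp: S2_def S1_a S1_b u_def)
  qed
  have S2_other: "S2 $$ (i, j) = S1 $$ (i, j)" if "i < m" "j < n" "i \<noteq> b" for i j
    using that ab ka by (auto simp: S2_def u_def)
  have \<tau>: "\<tau> j < n" if "j < n" for j
    using that ab ka by (auto simp: \<tau>_def Transposition.transpose_def)
  have \<tau>_iff: "\<tau> j = k + b \<longleftrightarrow> j = k + a" "\<tau> j = k + a \<longleftrightarrow> j = k + b" for j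
    using ab by (auto simp: \<tau>_def Transposition.transpose_def)
  have \<tau>_other: "\<tau> j = k + i \<longleftrightarrow> j = k + i" if "i \<noteq> a" "i \<noteq> b" for i j
    using that by (auto simp: \<tau>_def Transposition.transpose_def)
  have S4: "S4 $$ (i, j) = diag_fps_mat m n k (f(a := f a - 1, b := f b + 1)) $$ (i, j)" if ij: "i < m" "j < n" for i j
  proof -
    have S4: "S4 $$ (i, j) = v i * S2 $$ (i, \<tau> j)"
      using ij by (simp add: S4_def S3_def)
    consider "i = a" | "i = b" | "i \<noteq> a" "i \<noteq> b" by blast
    then show ?thesis
    proof cases
      case 1
      have "?d * (?c * ?X ^ e) = ?X ^ e"
        using cd(2) by (simp add: mult.assoc[symmetric])
      then show ?thesis
        unfolding S4 unfolding 1 using ij ab \<tau>[OF ij(2)]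
        by (auto simp: v_def S2_other S1_a \<tau>_iff diag_fps_mat_def e_def)
    next
      case 2
      have "- ?c * - (?d * ?X ^ Suc (f b)) = ?X ^ Suc (f b)"
        unfolding minus_mult_minus mult.assoc[symmetric] cd(1) by (rule mult_1_left)
      then show ?thesis
        unfolding S4 unfolding 2 using ij ab \<tau>[OF ij(2)]
        by (simp add: v_def S2_b \<tau>_iff diag_fps_mat_def del: power_Suc)
    next
      case 3
      then show ?thesis
        unfolding S4 using ij \<tau>[OF ij(2)]
        by (simp add: v_def S2_other S1_other \<tau>_other diag_fps_mat_def)
    qed
  qed
  have "S4 = diag_fps_mat m n k (f(a := f a - 1, b := f b + 1))"
    by (rule eq_matI) (use S4 in \<open>auto simp: S4_def diag_fps_mat_def\<close>)
  then show ?thesis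
    using mat_equiv_sym[OF equiv] unfolding S_def e_def by simp
qed

subsection \<open>The jet component as a locus of minor bounds\<close>

lemma delta_mat_eq_smith_mat: "delta_mat m n lam = smith_mat m n (\<lambda>k. lam ! (m - 1 - k))"
  by (intro eq_matI) (auto simp: delta_mat_def smith_mat_def)

lemma mem_orbit_iff: "B \<in> orbit m n lam \<longleftrightarrow> mat_equiv m n (smith_mat m n (\<lambda>k. lam ! (m - 1 - k))) B"
proof
  assume "B \<in> orbit m n lam"
  then obtain g h h' where B: "B = g * delta_mat m n lam * h'" and g: "g \<in> carrier_mat m m" "invertible_mat g"
    and h: "h \<in> carrier_mat n n" "h' \<in> carrier_mat n n" "inverts_mat h h'" "inverts_mat h' h"
    unfolding orbit_def by blast
  obtain g' where g': "inverts_mat g g'" "inverts_mat g' g"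
    using g(2) by (auto simp: invertible_mat_def)
  \<comment> \<open>\<open>invertible_mat\<close> does not state the size of the inverse; it is read
    off from the two identity matrices.\<close>
  have "dim_col (g * g') = m" "dim_col (g' * g) = dim_row g'"
    using g' g(1) by (auto simp: inverts_mat_def)
  then have "g' \<in> carrier_mat m m"
    using g(1) by auto
  then have "mutual_inverse m g g'" "mutual_inverse n h' h"
    using g(1) g' h by (auto simp: mutual_inverse_def inverts_mat_def)
  then show "mat_equiv m n (smith_mat m n (\<lambda>k. lam ! (m - 1 - k))) B"
    unfolding B delta_mat_eq_smith_mat by (rule mat_equivI[OF smith_mat_carrier])
next
  assume "mat_equiv m n (smith_mat m n (\<lambda>k. lam ! (m - 1 - k))) B"
  then obtain g g' h h' where *: "mutual_inverse m g g'" "mutual_inverse n h h'" "B = g * delta_mat m n lam * h"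
    unfolding delta_mat_eq_smith_mat by (rule mat_equivE)
  then have "invertible_mat g" "g \<in> carrier_mat m m" "h \<in> carrier_mat n n" "h' \<in> carrier_mat n n"
    "inverts_mat h h'" "inverts_mat h' h"
    by (auto simp: mutual_inverse_def invertible_mat_def inverts_mat_def intro!: exI[of _ g'])
  then show "B \<in> orbit m n lam"
    unfolding orbit_def using *(3) by blast
qed

lemma arc_of_mat_univariate:
  assumes "\<And>i j. i < m \<Longrightarrow> j < n \<Longrightarrow> (\<lambda>c. S c $$ (i, j)) \<in> coeffwise univariate_funs"
    and "v \<in> arc_coords m n"
  shows "(\<lambda>c. arc_of_mat m n (S c) v) \<in> univariate_funs"
  using assms by (auto simp: arc_of_mat_def arc_coords_def coeffwise_def)

lemma fps_const_coeffwise: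
  assumes "fun_ring R" "f \<in> R"
  shows "(\<lambda>c. fps_const (f c)) \<in> coeffwise R"
  unfolding coeffwise_def
proof (intro CollectI allI)
  fix l
  show "(\<lambda>x. fps_nth (fps_const (f x)) l) \<in> R"
    using assms fun_ring_const[OF assms(1), of 0] by (cases "l = 0") simp_all
qed

lemma fun_ring_coeffwise_univariate: "fun_ring (coeffwise univariate_funs)"
  by (rule fun_ring_coeffwise[OF fun_ring_univariate])

lemma affine_coeffwise: "(\<lambda>c. A + (if Q then fps_const c * B else 0)) \<in> coeffwise univariate_funs"
proof (cases Q)
  case True
  have "(\<lambda>c. A + fps_const c * B) \<in> coeffwise univariate_funs"
    by (intro fun_ring_add[OF fun_ring_coeffwise_univariate] fun_ring_mult[OF fun_ring_coeffwise_univariate] fun_ring_const[OF fun_ring_coeffwise_univariate]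
        fps_const_coeffwise[OF fun_ring_univariate] univariate_id)
  then show ?thesis
    using True by simp
next
  case False
  then show ?thesis
    using fun_ring_const[OF fun_ring_coeffwise_univariate, of A] by simp
qed

text \<open>The factors taking \<open>S 0\<close> to \<open>B\<close> are applied to the whole line,
  so \<open>B\<close> is a limit of matrices equivalent to \<open>S c\<close>. Having this for every
  such \<open>B\<close> allows one degeneration to be followed by another.\<close>

lemma closed_equiv_limit:
  fixes S :: "'a::alg_closed_field \<Rightarrow> 'a fps mat"
  assumes C: "closedin (zariski (arc_coords m n)) C" and S: "\<And>c. S c \<in> carrier_mat m n"
    and poly: "\<And>i j. i < m \<Longrightarrow> j < n \<Longrightarrow> (\<lambda>c. S c $$ (i, j)) \<in> coeffwise univariate_funs"
    and gen: "\<And>c B. c \<noteq> 0 \<Longrightarrow> mat_equiv m n (S c) B \<Longrightarrow> arc_of_mat m n B \<in> C"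
    and B: "mat_equiv m n (S 0) B"
  shows "arc_of_mat m n B \<in> C"
proof -
  obtain g g' h h' where gh: "mutual_inverse m g g'" "mutual_inverse n h h'" "B = g * S 0 * h"
    using B by (rule mat_equivE)
  then have c: "g \<in> carrier_mat m m" "h \<in> carrier_mat n n"
    by (auto simp: mutual_inverse_def)
  have "arc_of_mat m n (g * S 0 * h) \<in> C"
  proof (rule zariski_closed_limit[OF C, of "\<lambda>c. arc_of_mat m n (g * S c * h)"])
    fix v assume "v \<in> arc_coords m n"
    then show "(\<lambda>c. arc_of_mat m n (g * S c * h) v) \<in> univariate_funs"
    proof (rule arc_of_mat_univariate[rotated])
      fix i j assume "i < m" "j < n"
      then show "(\<lambda>c'. (g * S c' * h) $$ (i, j)) \<in> coeffwise univariate_funs"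
        using c S poly
        by (intro fun_ring_mult_mat[OF fun_ring_coeffwise_univariate, of _ m n _ n] fun_ring_mult_mat[OF fun_ring_coeffwise_univariate, of _ m m _ n]
            fun_ring_const[OF fun_ring_coeffwise_univariate]) auto
    qed
  qed (use arc_of_mat_affine gen mat_equivI[OF S gh(1,2)] in blast)+
  then show ?thesis
    by (simp add: gh(3))
qed

lemma smith_mat_diag: "smith_mat m n h = diag_fps_mat m n (n - m) (\<lambda>i. h (m - 1 - i))"
  unfolding smith_mat_def diag_fps_mat_def by (rule refl)

lemma diag_fps_mat_cong:
  assumes "\<And>i. i < m \<Longrightarrow> f i = g i"
  shows "diag_fps_mat m n k f = diag_fps_mat m n k g"
  using assms by (intro eq_matI) (auto simp: diag_fps_mat_def)

text \<open>The induction claim ranges over all matrices equivalent to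
  \<open>smith_mat m n h\<close>. For each unit move, the line from \<open>diag_fps_mat_dec\<close>
  or \<open>diag_fps_mat_shift\<close> passes through this matrix at \<open>c = 0\<close>, and its
  other members have the exponents after the move.\<close>

lemma smith_mat_orbit_closure:
  fixes C :: "(coord \<Rightarrow> 'a::alg_closed_field) set"
  assumes mn: "m \<le> n" and C: "closedin (zariski (arc_coords m n)) C"
    and \<mu>: "mono_on {..<m} \<mu>" and h: "mono_on {..<m} h"
    and dom: "\<And>s. s \<le> m \<Longrightarrow> (\<Sum>k<s. \<mu> k) \<le> (\<Sum>k<s. h k)"
    and orb: "\<And>B. mat_equiv m n (smith_mat m n \<mu>) B \<Longrightarrow> arc_of_mat m n B \<in> C"
  shows "mat_equiv m n (smith_mat m n h) B \<Longrightarrow> arc_of_mat m n B \<in> C"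
proof (induction arbitrary: B rule: dominance_induct[OF \<mu> h dom])
  \<comment> \<open>Cases 2, 3 and 4 are \<open>base\<close>, \<open>dec\<close> and
    \<open>shift\<close> of \<open>dominance_induct\<close>.\<close>
  case (2 h)
  have "smith_mat m n h = (smith_mat m n \<mu> :: 'a fps mat)"
    unfolding smith_mat_diag using 2(1) by (intro diag_fps_mat_cong) auto
  then show ?case
    using 2(2) orb by simp
next
  case (3 h u)
  let ?f = "\<lambda>i. h (m - 1 - i)" and ?a = "m - 1 - u" and ?k = "n - m"
  have a: "?a < m" "?f ?a = h u"
    using 3(1) by auto
  define S where "S c = mat m n (\<lambda>(i, j). (if j = ?k + i then fps_X ^ ?f i else 0) +
      (if i = ?a \<and> j = ?k + ?a then fps_const c * fps_X ^ (?f ?a - 1) else 0))" for c :: 'a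
  have upd: "diag_fps_mat m n ?k (?f(?a := ?f ?a - 1)) = (smith_mat m n (h(u := h u - 1)) :: 'a fps mat)"
    unfolding smith_mat_diag using 3(1) a by (intro diag_fps_mat_cong) auto
  have equiv: "mat_equiv m n (smith_mat m n (h(u := h u - 1))) (S c)" if "c \<noteq> 0" for c
    using diag_fps_mat_dec[of ?k m n ?a ?f c] that mn a 3(2) unfolding upd S_def by simp
  have S0: "S 0 = smith_mat m n h"
    unfolding S_def smith_mat_def by (intro eq_matI) auto
  show ?case
  proof (rule closed_equiv_limit[OF C, of S])
    show "S c \<in> carrier_mat m n" for c by (simp add: S_def)
    show "(\<lambda>c. S c $$ (i, j)) \<in> coeffwise univariate_funs" if "i < m" "j < n" for i j
      unfolding S_def index_mat(1)[OF that] prod.case by (rule affine_coeffwise)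
    show "arc_of_mat m n B \<in> C" if "c \<noteq> 0" "mat_equiv m n (S c) B" for c B
      using 3(3) mat_equiv_trans[OF equiv[OF that(1)] that(2)] by blast
    show "mat_equiv m n (S 0) B"
      using 3(4) S0 by simp
  qed
next
  case (4 h u v)
  let ?f = "\<lambda>i. h (m - 1 - i)" and ?a = "m - 1 - u" and ?b = "m - 1 - v" and ?k = "n - m"
  have a: "?a < m" "?f ?a = h u" "?b < m" "?f ?b = h v" "?a \<noteq> ?b"
    using 4(1-3) by auto
  define S where "S c = mat m n (\<lambda>(i, j). (if j = ?k + i then fps_X ^ ?f i else 0) +
      (if i = ?a \<and> j = ?k + ?b then fps_const c * fps_X ^ (?f ?a - 1) else 0))" for c :: 'a
  have upd: "diag_fps_mat m n ?k (?f(?a := ?f ?a - 1, ?b := ?f ?b + 1))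
      = (smith_mat m n (h(u := h u - 1, v := h v + 1)) :: 'a fps mat)"
    unfolding smith_mat_diag using 4(1-3) a by (intro diag_fps_mat_cong) auto
  have equiv: "mat_equiv m n (smith_mat m n (h(u := h u - 1, v := h v + 1))) (S c)" if "c \<noteq> 0" for c
    using diag_fps_mat_shift[of ?k m n ?a ?b ?f c] that mn a 4(4,5) unfolding upd S_def by simp
  have S0: "S 0 = smith_mat m n h"
    unfolding S_def smith_mat_def by (intro eq_matI) auto
  show ?case
  proof (rule closed_equiv_limit[OF C, of S])
    show "S c \<in> carrier_mat m n" for c by (simp add: S_def)
    show "(\<lambda>c. S c $$ (i, j)) \<in> coeffwise univariate_funs" if "i < m" "j < n" for i j
      unfolding S_def index_mat(1)[OF that] prod.case by (rule affine_coeffwise)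
    show "arc_of_mat m n B \<in> C" if "c \<noteq> 0" "mat_equiv m n (S c) B" for c B
      using 4(6) mat_equiv_trans[OF equiv[OF that(1)] that(2)] by blast
    show "mat_equiv m n (S 0) B"
      using 4(7) S0 by simp
  qed
qed auto

lemma tail_sum_eq:
  assumes "length lam = m" "s \<le> m"
  shows "tail_sum lam s = (\<Sum>k<s. lam ! (m - 1 - k))"
  unfolding tail_sum_def assms(1)
  by (rule sum.reindex_bij_witness[of _ "\<lambda>k. m - 1 - k" "\<lambda>k. m - 1 - k"]) (use assms(2) in auto)

text \<open>The link between the two sides: it equals the zero locus of \<Omega>' and, for sorted
  exponents bounded by \<open>p\<close>, the component. Neither ceilings nor closures occur in
  it.\<close>

definition minor_bound_locus :: "nat \<Rightarrow> nat \<Rightarrow> nat \<Rightarrow> nat list \<Rightarrow> (coord \<Rightarrow> 'a::comm_ring_1) set" where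
  "minor_bound_locus m n p lam = {x \<in> affine_space (jet_coords m n p).
     \<forall>s\<in>{..m}. minors_dvd (fps_X ^ tail_sum lam s) (jet_mat m n p x) s}"

lemma zero_locus_Omega':
  assumes len: "length lam = m" and m: "m \<ge> 1"
  shows "zero_locus (jet_coords m n p) (Omega' m n p lam) = (minor_bound_locus m n p lam :: (coord \<Rightarrow> 'a::field) set)"
proof (intro equalityI subsetI)
  fix x :: "coord \<Rightarrow> 'a"
  assume "x \<in> minor_bound_locus m n p lam"
  then have x: "x \<in> affine_space (jet_coords m n p)"
    and d: "\<And>s. s \<le> m \<Longrightarrow> minors_dvd (fps_X ^ tail_sum lam s) (jet_mat m n p x) s"
    by (auto simp: minor_bound_locus_def)
  have "mpoly_eval x f = 0" if "f \<in> minor_coeffs m n p s \<alpha>" "\<alpha> < tail_sum lam s" "s \<le> m" for f s \<alpha>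
    using minor_coeffs_vanish_iff[of "tail_sum lam s" m n p s x] d[OF that(3)] that(1,2) by blast
  then show "x \<in> zero_locus (jet_coords m n p) (Omega' m n p lam)"
    using x m by (fastforce simp: zero_locus_def Omega'_def)
next
  fix x :: "coord \<Rightarrow> 'a"
  assume "x \<in> zero_locus (jet_coords m n p) (Omega' m n p lam)"
  then have x: "x \<in> affine_space (jet_coords m n p)" and \<Omega>: "\<And>f. f \<in> Omega' m n p lam \<Longrightarrow> mpoly_eval x f = 0"
    by (auto simp: zero_locus_def)
  let ?i = "tail_sum lam" and ?j = "tail_mean_ceil lam"
  let ?J = "jet_mat m n p x"
  have "minors_dvd (fps_X ^ ?i s) ?J s" if "s \<le> m" for s
    using that
  proof (induction s)
    case 0
    then show ?case by (simp add: tail_sum_def minors_dvd_def)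
  next
    case (Suc s)
    \<comment> \<open>Coefficients below \<open>?i s + ?j s\<close> vanish by
      \<open>minors_dvd_Suc\<close>. For \<open>s = 0\<close> nothing comes for free, which matches
      the full list of entry coefficients in \<open>Omega'\<close>.\<close>
    have low: "\<forall>\<alpha><(if s = 0 then 0 else ?i s + ?j s). \<forall>f\<in>minor_coeffs m n p (Suc s) \<alpha>. mpoly_eval x f = 0"
    proof (cases "s = 0")
      case False
      then have "minors_dvd (fps_X ^ (?i s + ?j s)) ?J (Suc s)"
        unfolding tail_mean_ceil_def using Suc by (intro minors_dvd_Suc) auto
      then show ?thesis
        using False minor_coeffs_vanish_iff[of "?i s + ?j s" m n p "Suc s" x] by simp
    qed simp
    have "mpoly_eval x f = 0" if \<alpha>: "\<alpha> < ?i (Suc s)" and f: "f \<in> minor_coeffs m n p (Suc s) \<alpha>" for \<alpha> f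
    proof (cases "s = 0")
      case True
      then show ?thesis
        using \<alpha> f by (intro \<Omega>) (auto simp: Omega'_def)
    next
      case False
      show ?thesis
      proof (cases "\<alpha> < ?i s + ?j s")
        case True
        then show ?thesis using low False f by auto
      next
        case ge: False
        have "f \<in> Omega' m n p lam"
          unfolding Omega'_def
          by (rule UnI2, rule UN_I[of s], use ge \<alpha> False Suc.prems in force,
              rule UN_I[of \<alpha>], use ge \<alpha> f in auto)
        then show ?thesis by (rule \<Omega>)
      qed
    qed
    then show ?case
      using minor_coeffs_vanish_iff[of "?i (Suc s)" m n p "Suc s" x] by blast
  qed
  then show "x \<in> minor_bound_locus m n p lam"
    using x by (simp add: minor_bound_locus_def)
qed

text \<open>One inclusion passes from the orbit to its closure, since the bounds are closed on arcs,
  and then to jets by \<open>minors_dvd_truncation\<close>, where \<open>le\<close> enters. The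
  other lifts a jet to an arc whose normal form is known.\<close>

lemma jet_component_eq:
  assumes mn: "m \<le> n" and len: "length lam = m" and mono: "mono_on {..<m} (\<lambda>k. lam ! (m - 1 - k))"
    and le: "\<And>k. k < m \<Longrightarrow> lam ! k \<le> p"
  shows "jet_component m n p lam = (minor_bound_locus m n p lam :: (coord \<Rightarrow> 'a::alg_closed_field) set)"
proof (intro equalityI subsetI)
  let ?\<mu> = "\<lambda>k. lam ! (m - 1 - k)"
  let ?C = "zariski (arc_coords m n) closure_of (arc_of_mat m n ` orbit m n lam) :: (coord \<Rightarrow> 'a) set"
  let ?W = "{y \<in> affine_space (arc_coords m n). \<forall>s\<in>{..m}. minors_dvd (fps_X ^ tail_sum lam s) (arc_mat m n y) s}
    :: (coord \<Rightarrow> 'a) set"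
  have W: "closedin (zariski (arc_coords m n)) ?W"
    by (rule closedin_minors_dvd[OF arc_mat_carrier arc_mat_polyfuns])
  have "arc_of_mat m n ` orbit m n lam \<subseteq> ?W"
  proof safe
    fix B :: "'a fps mat" and s assume "B \<in> orbit m n lam" and s: "s \<le> m"
    then have B: "mat_equiv m n (smith_mat m n ?\<mu>) B"
      by (simp add: mem_orbit_iff)
    have "minors_dvd (fps_X ^ (\<Sum>k<s. ?\<mu> k)) (smith_mat m n ?\<mu> :: 'a fps mat) s"
      by (rule minors_dvd_rows[OF smith_mat_carrier mono]) (auto simp: smith_mat_def)
    then have "minors_dvd (fps_X ^ tail_sum lam s) B s"
      using minors_dvd_equiv[OF B] tail_sum_eq[OF len s] by simp
    then show "minors_dvd (fps_X ^ tail_sum lam s) (arc_mat m n (arc_of_mat m n B)) s"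
      using arc_mat_arc_of_mat mat_equiv_carrier[OF B] by metis
  qed (rule arc_of_mat_affine)
  then have CW: "?C \<subseteq> ?W"
    using W by (rule closure_of_minimal)
  show "x \<in> minor_bound_locus m n p lam" if "x \<in> jet_component m n p lam" for x :: "coord \<Rightarrow> 'a"
  proof -
    obtain y where y: "y \<in> ?C" "x = truncate_arc m n p y"
      using \<open>x \<in> jet_component m n p lam\<close> unfolding jet_component_def by blast
    have "minors_dvd (fps_X ^ (\<Sum>k<s. ?\<mu> k)) (arc_mat m n y) s" if "s \<le> m" for s
    proof -
      have "y \<in> ?W"
        using y(1) CW by blast
      then have "minors_dvd (fps_X ^ tail_sum lam s) (arc_mat m n y) s"
        using that by simp
      then show ?thesis
        unfolding tail_sum_eq[OF len that] .
    qed
    then have "minors_dvd (fps_X ^ tail_sum lam s) (jet_mat m n p x) s" if "s \<le> m" for s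
      unfolding tail_sum_eq[OF len that] y(2)
      using le that
      by (intro minors_dvd_truncation[OF arc_mat_carrier jet_mat_carrier mn jet_mat_truncate_arc]) auto
    moreover have "x \<in> affine_space (jet_coords m n p)"
      by (simp add: y(2) truncate_arc_def affine_space_def)
    ultimately show ?thesis
      by (simp add: minor_bound_locus_def)
  qed
  show "x \<in> jet_component m n p lam" if "x \<in> minor_bound_locus m n p lam" for x :: "coord \<Rightarrow> 'a"
  proof -
    have x: "x \<in> affine_space (jet_coords m n p)"
      and d: "\<And>s. s \<le> m \<Longrightarrow> minors_dvd (fps_X ^ tail_sum lam s) (jet_mat m n p x) s"
      using that by (auto simp: minor_bound_locus_def)
    \<comment> \<open>Large enough to compare all partial sums, and at least \<open>p\<close> so
      that a lift modulo t^N still truncates to \<open>x\<close>.\<close>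
    define N where "N = p + (\<Sum>k<m. ?\<mu> k)"
    have N: "tail_sum lam s \<le> N" if "s \<le> m" for s
      unfolding N_def tail_sum_eq[OF len that] using that by (intro trans_le_add2 sum_mono2) auto
    obtain B h where B: "mat_equiv m n (jet_mat m n p x) B" and h: "mono_on {..<m} h"
      and cong: "\<And>i j. i < m \<Longrightarrow> j < n \<Longrightarrow> fps_X ^ N dvd B $$ (i, j) - smith_mat m n h $$ (i, j)"
      by (rule smith_form_mod[OF jet_mat_carrier mn, of p x N]) blast
    have dom: "(\<Sum>k<s. ?\<mu> k) \<le> (\<Sum>k<s. h k)" if "s \<le> m" for s
      using minors_dvd_smith_iff[OF B mn h cong N[OF that] that] d[OF that] tail_sum_eq[OF len that] by simp
    \<comment> \<open>Undoing the reduction on the exact diagonal matrix yields an arc that has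
      these exponents exactly and still lifts the jet.\<close>
    obtain A where A: "mat_equiv m n (smith_mat m n h) A"
      and A_cong: "\<And>i j. i < m \<Longrightarrow> j < n \<Longrightarrow> fps_X ^ N dvd jet_mat m n p x $$ (i, j) - A $$ (i, j)"
      by (rule mat_equiv_cong[OF mat_equiv_sym[OF B] smith_mat_carrier cong]) blast+
    have "arc_of_mat m n A \<in> ?C"
    proof (rule smith_mat_orbit_closure[OF mn closedin_closure_of mono h dom _ A])
      fix D :: "'a fps mat" assume "mat_equiv m n (smith_mat m n ?\<mu>) D"
      then have "arc_of_mat m n D \<in> arc_of_mat m n ` orbit m n lam"
        by (simp add: mem_orbit_iff)
      moreover have "arc_of_mat m n ` orbit m n lam \<subseteq> topspace (zariski (arc_coords m n) :: (coord \<Rightarrow> 'a) topology)"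
        using arc_of_mat_affine by auto
      ultimately show "arc_of_mat m n D \<in> ?C"
        using closure_of_subset by blast
    qed
    moreover have "truncate_arc m n p (arc_of_mat m n A) = x"
    proof (rule truncate_arc_of_mat[OF x])
      show "A \<in> carrier_mat m n" using mat_equiv_carrier[OF A] by simp
      have "fps_X ^ p dvd (fps_X ^ N :: 'a fps)"
        by (intro le_imp_power_dvd) (simp add: N_def)
      then show "fps_X ^ p dvd jet_mat m n p x $$ (i, j) - A $$ (i, j)" if "i < m" "j < n" for i j
        using A_cong[OF that] dvd_trans by blast
    qed
    ultimately show ?thesis
      unfolding jet_component_def by blast
  qed
qed

subsection \<open>Irreducibility and maximality\<close>

lemma mpoly_eval_truncate_arc:
  assumes "f \<in> mpolys (jet_coords m n p)"
  shows "mpoly_eval (truncate_arc m n p y) f = mpoly_eval y f"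
  unfolding mpoly_eval_def mono_eval_def
proof (intro sum.cong prod.cong arg_cong2[where f = "(*)"] arg_cong2[where f = power] refl)
  fix \<mu> v assume "\<mu> \<in> Poly_Mapping.keys f" "v \<in> Poly_Mapping.keys \<mu>"
  then show "truncate_arc m n p y v = y v"
    using assms by (auto simp: mpolys_def truncate_arc_def)
qed

text \<open>The line is drawn between the group elements, not between the matrices, so
  \<open>x c\<close> always comes from a product \<open>g * ?S * h\<close>. It lies in the orbit as
  soon as the constant terms of both determinants, whose product is \<open>d\<close>, are
  nonzero.\<close>

lemma orbit_curve:
  fixes y z :: "coord \<Rightarrow> 'a::field"
  assumes "y \<in> arc_of_mat m n ` orbit m n lam" "z \<in> arc_of_mat m n ` orbit m n lam"
  shows "\<exists>x d. (\<forall>v\<in>arc_coords m n. (\<lambda>c. x c v) \<in> univariate_funs) \<and> x 0 = y \<and> x 1 = z \<and>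
    d \<in> univariate_funs \<and> d 0 \<noteq> 0 \<and> (\<forall>c. d c \<noteq> 0 \<longrightarrow> x c \<in> arc_of_mat m n ` orbit m n lam)"
proof -
  let ?S = "smith_mat m n (\<lambda>k. lam ! (m - 1 - k)) :: 'a fps mat"
  obtain B1 B2 where B: "mat_equiv m n ?S B1" "y = arc_of_mat m n B1" "mat_equiv m n ?S B2" "z = arc_of_mat m n B2"
    using assms by (auto simp: mem_orbit_iff)
  obtain g1 g1' h1 h1' where 1: "mutual_inverse m g1 g1'" "mutual_inverse n h1 h1'" "B1 = g1 * ?S * h1"
    using B(1) by (rule mat_equivE)
  obtain g2 g2' h2 h2' where 2: "mutual_inverse m g2 g2'" "mutual_inverse n h2 h2'" "B2 = g2 * ?S * h2"
    using B(3) by (rule mat_equivE)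
  define P :: "nat \<Rightarrow> 'a fps mat \<Rightarrow> 'a fps mat \<Rightarrow> 'a \<Rightarrow> 'a fps mat"
    where "P k A A' c = mat k k (\<lambda>(i, j). A $$ (i, j) + fps_const c * (A' $$ (i, j) - A $$ (i, j)))" for k A A' c
  have P: "P k A A' c \<in> carrier_mat k k" for k A A' c
    by (simp add: P_def)
  have P0: "P k A A' 0 = A" and P1: "P k A A' 1 = A'" if "A \<in> carrier_mat k k" "A' \<in> carrier_mat k k" for k A A'
    using that by (auto simp: P_def)
  have entry: "(\<lambda>c. A + fps_const c * A') \<in> coeffwise univariate_funs" for A A' :: "'a fps"
    using affine_coeffwise[of A True A'] by simp
  have P_entry: "(\<lambda>c. P k A A' c $$ (i, j)) \<in> coeffwise univariate_funs" if "i < k" "j < k" for k A A' i j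
    using that entry by (simp add: P_def)
  have P_det: "(\<lambda>c. det (P k A A' c)) \<in> coeffwise univariate_funs" for k A A'
    unfolding P_def by (rule fun_ring_det[OF fun_ring_coeffwise_univariate entry])
  define x where "x c = arc_of_mat m n (P m g1 g2 c * ?S * P n h1 h2 c)" for c
  define d where "d c = fps_nth (det (P m g1 g2 c)) 0 * fps_nth (det (P n h1 h2 c)) 0" for c
  have c: "g1 \<in> carrier_mat m m" "g2 \<in> carrier_mat m m" "h1 \<in> carrier_mat n n" "h2 \<in> carrier_mat n n"
    using 1 2 by (auto simp: mutual_inverse_def)
  have "(\<lambda>c. x c v) \<in> univariate_funs" if "v \<in> arc_coords m n" for v
    unfolding x_def using that
  proof (rule arc_of_mat_univariate[rotated])
    fix i j assume "i < m" "j < n"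
    moreover have "(\<lambda>c. (P m g1 g2 c * ?S) $$ (a, b)) \<in> coeffwise univariate_funs" if "a < m" "b < n" for a b
      by (rule fun_ring_mult_mat[OF fun_ring_coeffwise_univariate P smith_mat_carrier P_entry fun_ring_const[OF fun_ring_coeffwise_univariate] that])
    ultimately show "(\<lambda>c. (P m g1 g2 c * ?S * P n h1 h2 c) $$ (i, j)) \<in> coeffwise univariate_funs"
      by (intro fun_ring_mult_mat[OF fun_ring_coeffwise_univariate mult_carrier_mat[OF P smith_mat_carrier] P _ P_entry])
  qed
  moreover have "x 0 = y" "x 1 = z"
    using c 1(3) 2(3) B(2,4) by (simp_all add: x_def P0 P1)
  moreover have "d \<in> univariate_funs"
    using fun_ring_mult[OF fun_ring_univariate coeffwiseD[OF P_det] coeffwiseD[OF P_det]]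
    unfolding d_def by simp
  moreover have "d 0 \<noteq> 0"
    using mutual_inverse_det[OF 1(1)] mutual_inverse_det[OF 1(2)] c by (simp add: d_def P0)
  moreover have "x c \<in> arc_of_mat m n ` orbit m n lam" if "d c \<noteq> 0" for c
  proof -
    have "fps_nth (det (P m g1 g2 c)) 0 \<noteq> 0" "fps_nth (det (P n h1 h2 c)) 0 \<noteq> 0"
      using that by (auto simp: d_def)
    then obtain g' h' where "mutual_inverse m (P m g1 g2 c) g'" "mutual_inverse n (P n h1 h2 c) h'"
      using mutual_inverse_exists[OF P] by metis
    then have "P m g1 g2 c * ?S * P n h1 h2 c \<in> orbit m n lam"
      unfolding mem_orbit_iff by (intro mat_equivI smith_mat_carrier)
    then show ?thesis
      by (simp add: x_def)
  qed
  ultimately show ?thesis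
    by blast
qed

text \<open>A polynomial in jet coordinates takes the same value on an arc and on its truncation. A
  cover of the component is thus pulled back to the orbit, decided there by curves, and returned
  through the closure.\<close>

lemma jet_component_irreducible:
  fixes F G :: "(coord, 'a::alg_closed_field) mpoly set"
  assumes F: "F \<subseteq> mpolys (jet_coords m n p)" and G: "G \<subseteq> mpolys (jet_coords m n p)"
    and cover: "jet_component m n p lam \<subseteq> zero_locus (jet_coords m n p) F \<union> zero_locus (jet_coords m n p) G"
  shows "jet_component m n p lam \<subseteq> zero_locus (jet_coords m n p) F \<or>
    jet_component m n p lam \<subseteq> zero_locus (jet_coords m n p) G"
proof -
  let ?V = "arc_coords m n" and ?S = "arc_of_mat m n ` orbit m n lam :: (coord \<Rightarrow> 'a) set"
  have "jet_coords m n p \<subseteq> ?V"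
    by (auto simp: jet_coords_def arc_coords_def)
  then have sub: "mpolys (jet_coords m n p) \<subseteq> (mpolys ?V :: (coord, 'a) mpoly set)"
    unfolding mpolys_def by blast
  have S: "?S \<subseteq> zariski ?V closure_of ?S"
    using arc_of_mat_affine by (intro closure_of_subset) auto
  have in_comp: "truncate_arc m n p y \<in> jet_component m n p lam" if "y \<in> ?S" for y
    using that S unfolding jet_component_def by blast
  have vanish: "jet_component m n p lam \<subseteq> zero_locus (jet_coords m n p) H"
    if H: "H \<subseteq> mpolys (jet_coords m n p)" and "\<forall>y\<in>?S. \<forall>f\<in>H. mpoly_eval y f = 0" for H
  proof -
    have "?S \<subseteq> zero_locus ?V H"
      using that(2) arc_of_mat_affine by (auto simp: zero_locus_def)
    moreover have "closedin (zariski ?V) (zero_locus ?V H)"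
      unfolding closedin_zariski using H sub by blast
    ultimately have "zariski ?V closure_of ?S \<subseteq> zero_locus ?V H"
      by (rule closure_of_minimal)
    moreover have "truncate_arc m n p y \<in> zero_locus (jet_coords m n p) H" if "y \<in> zero_locus ?V H" for y
      using that H mpoly_eval_truncate_arc[of _ m n p y]
      by (auto simp: zero_locus_def affine_space_def truncate_arc_def)
    ultimately show ?thesis
      unfolding jet_component_def by blast
  qed
  have cover': "(\<forall>f\<in>F. mpoly_eval y f = 0) \<or> (\<forall>g\<in>G. mpoly_eval y g = 0)" if y: "y \<in> ?S" for y
  proof -
    have "truncate_arc m n p y \<in> zero_locus (jet_coords m n p) F \<union> zero_locus (jet_coords m n p) G"
      using in_comp[OF y] cover by blast
    then show ?thesis
      using F G mpoly_eval_truncate_arc[of _ m n p y] by (fastforce simp: zero_locus_def)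
  qed
  have "(\<forall>y\<in>?S. \<forall>f\<in>F. mpoly_eval y f = 0) \<or> (\<forall>y\<in>?S. \<forall>g\<in>G. mpoly_eval y g = 0)"
    by (rule irreducible_by_curves[OF orbit_curve _ _ cover']) (use F G sub in auto)
  then show ?thesis
    using vanish F G by blast
qed

section \<open>The bounds for admissible \<lambda>\<close>

lemma jet_scheme_eq:
  "jet_scheme m n r p = {x \<in> affine_space (jet_coords m n p). minors_dvd (fps_X ^ p) (jet_mat m n p x) r}"
  unfolding jet_scheme_def zero_locus_def minor_coeffs_vanish_iff[symmetric] by auto

text \<open>Read from the smallest entry, \<lambda> consists of zeros, then \<open>e\<close>, then
  copies of \<open>d\<close>, and the \<open>r\<close> smallest entries sum to \<open>p\<close>.
  From \<open>e\<close> on the sums grow with slope \<open>d\<close>, and the cut-off of natural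
  subtraction at 0 matches the initial zeros.\<close>

lemma admissible_tail_sums:
  assumes adm: "admissible m r p lam" and r: "1 < r" "r < m"
  obtains d where "1 \<le> d" "d \<le> p" "length lam = m" "\<And>k. k < m \<Longrightarrow> lam ! k \<le> d"
    "mono_on {..<m} (\<lambda>k. lam ! (m - 1 - k))" "\<And>s. s \<le> m \<Longrightarrow> tail_sum lam s = p + s * d - r * d"
proof -
  obtain d e a where len: "length lam = m" and d: "d \<ge> 1" and p: "p = (a + 1) * d + e" and e: "e < d"
    and a: "e = 0 \<and> a \<le> r - 1 \<or> e > 0 \<and> a < r - 1"
    and lam: "\<And>k. k < m \<Longrightarrow> lam ! k = (if k < a + (m - r) + 1 then d else if k = a + (m - r) + 1 then e else 0)"
    using adm unfolding admissible_def by blast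
  have \<mu>: "lam ! (m - 1 - k) = (if r \<le> k + a + 1 then d else if r = k + a + 2 then e else 0)" if "k < m" for k
  proof -
    have "m - 1 - k < a + (m - r) + 1 \<longleftrightarrow> r \<le> k + a + 1" "m - 1 - k = a + (m - r) + 1 \<longleftrightarrow> r = k + a + 2"
      using that r by arith+
    then show ?thesis
      using lam[of "m - 1 - k"] that by simp
  qed
  have sum: "(\<Sum>k<s. lam ! (m - 1 - k)) = p + s * d - r * d" if "s \<le> m" for s
    using that
  proof (induction s)
    case 0
    \<comment> \<open>This makes the subtraction yield 0 at \<open>s = 0\<close>. The bound on
      \<open>a\<close> differs by one according to whether a positive entry \<open>e\<close> has to
      fit in.\<close>
    have "p \<le> r * d"
    proof (cases "e = 0")
      case True
      have "(a + 1) * d \<le> r * d"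
        using a True r by (intro mult_le_mono1) arith
      then show ?thesis using p True by simp
    next
      case False
      have "(a + 2) * d \<le> r * d"
        using a False r by (intro mult_le_mono1) arith
      then show ?thesis using p e by simp
    qed
    then show ?case by simp
  next
    case (Suc s)
    have IH: "(\<Sum>k<Suc s. lam ! (m - 1 - k)) = p + s * d - r * d + lam ! (m - 1 - s)"
      using Suc by simp
    have ps: "p + s * d = (s + a + 1) * d + e" "p + Suc s * d = (s + a + 2) * d + e"
      unfolding p by (simp_all add: algebra_simps)
    consider "r \<le> s + a + 1" | "r = s + a + 2" | "s + a + 3 \<le> r" by linarith
    then show ?case
    proof cases
      case 1
      then have "r * d \<le> (s + a + 1) * d"
        by (rule mult_le_mono1)
      then show ?thesis
        using IH \<mu>[of s] Suc.prems 1 ps by simp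
    next
      case 2
      then show ?thesis
        using IH \<mu>[of s] Suc.prems ps e by simp
    next
      case 3
      then have "(s + a + 3) * d \<le> r * d"
        by (rule mult_le_mono1)
      moreover have "(s + a + 3) * d = (s + a + 2) * d + d"
        by (simp add: algebra_simps)
      ultimately have "p + Suc s * d \<le> r * d"
        using ps(2) e by linarith
      moreover have "lam ! (m - 1 - s) = 0"
        using \<mu>[of s] Suc.prems 3 by simp
      ultimately show ?thesis
        unfolding IH by simp
    qed
  qed
  show thesis
  proof (rule that[OF d _ len])
    show "d \<le> p" by (simp add: p)
    show "lam ! k \<le> d" if "k < m" for k
      using lam[OF that] e by simp
    show "mono_on {..<m} (\<lambda>k. lam ! (m - 1 - k))"
      using \<mu> e by (intro mono_onI) auto
    show "tail_sum lam s = p + s * d - r * d" if "s \<le> m" for s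
      using sum[OF that] tail_sum_eq[OF len that] by simp
  qed
qed

text \<open>The bounds on the partial sums of length \<open>r - 1\<close> and \<open>r + 1\<close> pin \<open>h (r - 1)\<close> and \<open>h r\<close> to the two sides of \<open>d\<close>.\<close>

lemma generic_point_bounds:
  fixes h :: "nat \<Rightarrow> nat"
  assumes h: "mono_on {..<m} h" and r: "1 < r" "r < m" and d: "d \<le> p"
    and Hr: "p \<le> (\<Sum>k<r. h k)" and Hr1: "(\<Sum>k<r - 1. h k) \<le> p - d"
    and Hr2: "d < p \<Longrightarrow> (\<Sum>k<r + 1. h k) \<le> p + d" and "s \<le> m"
  shows "p + s * d - r * d \<le> (\<Sum>k<s. h k)"
proof (cases "r \<le> s")
  case True
  have "(\<Sum>k<r. h k) = (\<Sum>k<r - 1. h k) + h (r - 1)"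
    using r sum.lessThan_Suc[of h "r - 1"] by simp
  then have hd: "d \<le> h (r - 1)"
    using Hr Hr1 d by linarith
  \<comment> \<open>From \<open>r\<close> on, every exponent is at least \<open>h (r - 1)\<close>,
    hence at least \<open>d\<close>.\<close>
  have "p + t * d \<le> (\<Sum>k<r + t. h k)" if "r + t \<le> m" for t
    using that
  proof (induction t)
    case (Suc t)
    have "h (r - 1) \<le> h (r + t)"
      using Suc.prems r by (intro mono_onD[OF h]) auto
    then show ?case
      using Suc hd by simp
  qed (use Hr in simp)
  from this[of "s - r"] show ?thesis
    using True \<open>s \<le> m\<close> by (simp add: diff_mult_distrib)
next
  case False
  show ?thesis
  \<comment> \<open>For \<open>d = p\<close> and \<open>s < r\<close> the claimed bound is 0 by
    natural subtraction; only \<open>d < p\<close> calls for an upper bound on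
    \<open>h r\<close>.\<close>
  proof (cases "d = p")
    case True
    have "Suc s * p \<le> r * p"
      using False by (intro mult_le_mono1) simp
    then show ?thesis using True by simp
  next
    case neq: False
    then have "h r \<le> d"
      using Hr Hr2 d by simp
    have step: "p \<le> (\<Sum>k<r - t. h k) + t * d" if "t \<le> r" for t
      using that
    proof (induction t)
      case (Suc t)
      have "h (r - Suc t) \<le> h r"
        using r by (intro mono_onD[OF h]) auto
      moreover have "(\<Sum>k<r - t. h k) = (\<Sum>k<r - Suc t. h k) + h (r - Suc t)"
        using Suc.prems sum.lessThan_Suc[of h "r - Suc t"] by (simp add: Suc_diff_Suc)
      ultimately show ?case
        using Suc \<open>h r \<le> d\<close> by simp
    qed (use Hr in simp)
    have "s * d \<le> r * d"
      using False by (intro mult_le_mono1) simp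
    moreover have "p \<le> (\<Sum>k<s. h k) + (r - s) * d"
      using step[of "r - s"] False by simp
    ultimately show ?thesis
      using diff_mult_distrib[of r s d] by linarith
  qed
qed

text \<open>Exponents below \<open>p\<close> survive truncation, so the corner minor of the jet
  still has order exactly the sum; an exponent of \<open>p\<close> or more would leave a zero
  entry.\<close>

lemma delta_jet_minors:
  fixes \<mu> :: "nat \<Rightarrow> nat"
  assumes mn: "m \<le> n" and s: "s \<le> m" and \<mu>: "\<And>k. k < s \<Longrightarrow> \<mu> k < p"
  shows "\<not> minors_dvd (fps_X ^ Suc (\<Sum>k<s. \<mu> k))
    (jet_mat m n p (truncate_arc m n p (arc_of_mat m n (smith_mat m n \<mu> :: 'a::field fps mat)))) s" (is "\<not> minors_dvd _ ?J _")
proof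
  assume *: "minors_dvd (fps_X ^ Suc (\<Sum>k<s. \<mu> k)) ?J s"
  have "?J $$ (m - 1 - i, n - 1 - j) = smith_mat m n \<mu> $$ (m - 1 - i, n - 1 - j)" if ij: "i < s" "j < s" for i j
  proof -
    have "m - 1 - i < m" "n - 1 - j < n" "m - 1 - (m - 1 - i) = i"
      using ij s mn by auto
    then show ?thesis
      using \<mu>[OF ij(1)]
      by (auto simp: jet_mat_def truncate_arc_def jet_coords_def arc_of_mat_def arc_coords_def smith_mat_def fps_eq_iff)
  qed
  then have "fminor ?J s (\<lambda>i. m - 1 - i) (\<lambda>j. n - 1 - j) = fminor (smith_mat m n \<mu>) s (\<lambda>i. m - 1 - i) (\<lambda>j. n - 1 - j)"
    unfolding fminor_def by (intro arg_cong[of _ _ det] eq_matI) auto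
  also have "\<dots> = fps_X ^ (\<Sum>k<s. \<mu> k)"
    by (rule fminor_smith_mat[OF mn s])
  finally have eq: "fminor ?J s (\<lambda>i. m - 1 - i) (\<lambda>j. n - 1 - j) = fps_X ^ (\<Sum>k<s. \<mu> k)" .
  have "fps_X ^ Suc (\<Sum>k<s. \<mu> k) dvd fminor ?J s (\<lambda>i. m - 1 - i) (\<lambda>j. n - 1 - j)"
    using s mn by (intro minors_dvdD[OF *]) (auto simp: jet_mat_def)
  then show False
    unfolding eq fps_X_power_dvd_power_iff by simp
qed

lemma delta_jet_in_component:
  "truncate_arc m n p (arc_of_mat m n (smith_mat m n (\<lambda>k. lam ! (m - 1 - k)))) \<in> jet_component m n p lam"
proof -
  let ?S = "smith_mat m n (\<lambda>k. lam ! (m - 1 - k)) :: 'a fps mat"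
  have "?S \<in> orbit m n lam"
    unfolding mem_orbit_iff by (intro mat_equiv_refl smith_mat_carrier)
  moreover have "arc_of_mat m n ` orbit m n lam \<subseteq> zariski (arc_coords m n) closure_of (arc_of_mat m n ` orbit m n lam :: (coord \<Rightarrow> 'a) set)"
    using arc_of_mat_affine by (intro closure_of_subset) auto
  ultimately show ?thesis
    unfolding jet_component_def by blast
qed

theorem theorem3:
  fixes m n r p :: nat and lam :: "nat list"
  assumes "1 < r" and "r < m" and "m \<le> n" and "p \<ge> 1"
    and "admissible m r p lam"
  shows "zero_locus (jet_coords m n p) (Omega' m n p lam)
           = (jet_component m n p lam :: (coord \<Rightarrow> 'a::alg_closed_field) set) \<and>
         zero_locus (jet_coords m n p) (Omega' m n p lam)
           \<in> irreducible_components
               (subtopology (zariski (jet_coords m n p)) (jet_scheme m n r p)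
                  :: (coord \<Rightarrow> 'a) topology)"
proof -
  let ?V = "jet_coords m n p"
  let ?Z = "jet_component m n p lam :: (coord \<Rightarrow> 'a) set"
  let ?L = "jet_scheme m n r p :: (coord \<Rightarrow> 'a) set"
  let ?X = "subtopology (zariski ?V) ?L :: (coord \<Rightarrow> 'a) topology"
  let ?\<mu> = "\<lambda>k. lam ! (m - 1 - k)"
  obtain d where d: "1 \<le> d" "d \<le> p" and len: "length lam = m" and le: "\<And>k. k < m \<Longrightarrow> lam ! k \<le> d"
    and mono: "mono_on {..<m} ?\<mu>" and tail: "\<And>s. s \<le> m \<Longrightarrow> tail_sum lam s = p + s * d - r * d"
    using assms by (rule_tac admissible_tail_sums) blast+
  have Z: "?Z = minor_bound_locus m n p lam"
    using le d(2) by (intro jet_component_eq assms len mono) (meson le_trans)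
  have \<Omega>: "zero_locus ?V (Omega' m n p lam) = ?Z"
    unfolding Z using assms by (intro zero_locus_Omega' len) auto

  \<comment> \<open>The competing closed sets: the bound at a single index \<open>s\<close>, raised
    by one. The singleton quantifier matches the form of \<open>closedin_minors_dvd\<close>.\<close>
  define Y :: "nat \<Rightarrow> (coord \<Rightarrow> 'a) set" where "Y s = {x \<in> affine_space ?V. \<forall>s\<in>{s}. minors_dvd (fps_X ^ Suc (tail_sum lam s)) (jet_mat m n p x) s}" for s
  have closed_Y: "closedin (zariski ?V) (Y s :: (coord \<Rightarrow> 'a) set)" for s
    unfolding Y_def by (rule closedin_minors_dvd[OF jet_mat_carrier jet_mat_polyfuns])
  have closed_Z: "closedin (zariski ?V) ?Z"
    unfolding Z minor_bound_locus_def by (rule closedin_minors_dvd[OF jet_mat_carrier jet_mat_polyfuns])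
  have ZL: "?Z \<subseteq> ?L"
  proof
    fix x assume "x \<in> ?Z"
    then have "x \<in> affine_space ?V" "minors_dvd (fps_X ^ tail_sum lam r) (jet_mat m n p x) r"
      using assms by (auto simp: Z minor_bound_locus_def)
    then show "x \<in> ?L"
      using assms tail[of r] by (simp add: jet_scheme_eq)
  qed
  have L_aff: "?L \<subseteq> affine_space ?V"
    by (auto simp: jet_scheme_eq)

  have not_Y: "\<not> ?Z \<subseteq> Y s" if s: "s \<le> m" "\<And>k. k < s \<Longrightarrow> ?\<mu> k < p" for s
  proof
    assume "?Z \<subseteq> Y s"
    then have "truncate_arc m n p (arc_of_mat m n (smith_mat m n ?\<mu>)) \<in> (Y s :: (coord \<Rightarrow> 'a) set)"
      using delta_jet_in_component by blast
    then show False
      using delta_jet_minors[OF assms(3) s(1), of ?\<mu> p, where 'a = 'a] s(2) tail_sum_eq[OF len s(1)]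
      by (simp add: Y_def)
  qed
  have not_Y1: "\<not> ?Z \<subseteq> Y (r - 1)"
  proof (rule not_Y)
    fix k assume k: "k < r - 1"
    show "?\<mu> k < p"
    \<comment> \<open>For \<open>d = p\<close> some entries of \<lambda> equal \<open>p\<close>, but
      the \<open>r - 1\<close> smallest sum to 0.\<close>
    proof (cases "d = p")
      case True
      have "?\<mu> k \<le> (\<Sum>k<r - 1. ?\<mu> k)"
        using k by (intro member_le_sum) auto
      also have "\<dots> = p + (r - 1) * p - r * p"
        using tail[of "r - 1"] tail_sum_eq[OF len, of "r - 1"] assms True by simp
      also have "\<dots> = 0"
        using assms(1) by (simp add: diff_mult_distrib)
      finally show ?thesis using assms(4) by simp
    next
      case False
      then show ?thesis
        using le[of "m - 1 - k"] d(2) assms(2) by simp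
    qed
  qed (use assms in simp)
  \<comment> \<open>For \<open>d = p\<close> the jet of \<open>\<delta>\<^sub>\<lambda>\<close>
    loses its entries t^d, hence the restriction.\<close>
  have not_Y2: "\<not> ?Z \<subseteq> Y (r + 1)" if "d < p"
  proof (rule not_Y)
    show "?\<mu> k < p" if "k < r + 1" for k
      using le[of "m - 1 - k"] \<open>d < p\<close> assms(2) by simp
  qed (use assms in simp)

  have cover: "x \<in> ?Z \<or> x \<in> Y (r - 1) \<or> d < p \<and> x \<in> Y (r + 1)" if "x \<in> ?L" for x
  proof -
    have x: "x \<in> affine_space ?V" "minors_dvd (fps_X ^ p) (jet_mat m n p x) r"
      using that by (auto simp: jet_scheme_eq)
    \<comment> \<open>At least one more than every tail sum, since membership in \<open>Y s\<close>
      asks for the bound \<open>Suc (tail_sum lam s)\<close>.\<close>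
    define N where "N = p + m * d + 1"
    obtain B h where B: "mat_equiv m n (jet_mat m n p x) B" and h: "mono_on {..<m} h"
      and cong: "\<And>i j. i < m \<Longrightarrow> j < n \<Longrightarrow> fps_X ^ N dvd B $$ (i, j) - smith_mat m n h $$ (i, j)"
      by (rule smith_form_mod[OF jet_mat_carrier assms(3), of p x N]) blast
    have smith: "minors_dvd (fps_X ^ q) (jet_mat m n p x) s \<longleftrightarrow> q \<le> (\<Sum>k<s. h k)" if "q \<le> N" "s \<le> m" for q s
      by (rule minors_dvd_smith_iff[OF B assms(3) h cong that])
    have N: "Suc (tail_sum lam s) \<le> N" if "s \<le> m" for s
      using tail[OF that] mult_le_mono1[OF that, of d] unfolding N_def by linarith
    have Y: "x \<in> Y s \<longleftrightarrow> Suc (tail_sum lam s) \<le> (\<Sum>k<s. h k)" if "s \<le> m" for s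
      using x(1) smith[OF N[OF that] that] by (simp add: Y_def)
    have r1: "r - 1 \<le> m" and r2: "r + 1 \<le> m"
      using assms(2) by simp_all
    have Hr: "p \<le> (\<Sum>k<r. h k)"
      using smith[of p r] x(2) assms(2) by (simp add: N_def)
    have "x \<in> ?Z" if "x \<notin> Y (r - 1)" "d < p \<longrightarrow> x \<notin> Y (r + 1)"
    proof -
      have "p + (r - 1) * d - r * d = p - d"
        using assms(1) by (simp add: diff_mult_distrib)
      then have "(\<Sum>k<r - 1. h k) \<le> p - d"
        using that(1) Y[OF r1] tail[OF r1] by simp
      moreover have "(\<Sum>k<r + 1. h k) \<le> p + d" if "d < p"
        using \<open>d < p \<longrightarrow> x \<notin> Y (r + 1)\<close> that Y[OF r2] tail[OF r2] by simp
      ultimately have "tail_sum lam s \<le> (\<Sum>k<s. h k)" if "s \<le> m" for s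
        unfolding tail[OF that] by (intro generic_point_bounds[OF h assms(1,2) d(2) Hr] that)
      then have "minors_dvd (fps_X ^ tail_sum lam s) (jet_mat m n p x) s" if "s \<le> m" for s
        using smith[OF Suc_leD[OF N[OF that]] that] that by blast
      then show ?thesis
        using x(1) by (simp add: Z minor_bound_locus_def)
    qed
    then show ?thesis by blast
  qed

  have irr: "irreducible_set ?X ?Z"
    unfolding irreducible_set_def
  proof (intro conjI allI impI)
    show "?Z \<subseteq> topspace ?X"
      using ZL L_aff by auto
    show "?Z \<noteq> {}"
      using delta_jet_in_component by blast
    fix A B assume "closedin ?X A" "closedin ?X B" and AB: "?Z \<subseteq> A \<union> B"
    then obtain F G where F: "F \<subseteq> mpolys ?V" "A = zero_locus ?V F \<inter> ?L" and G: "G \<subseteq> mpolys ?V" "B = zero_locus ?V G \<inter> ?L"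
      unfolding closedin_subtopology closedin_zariski by blast
    then show "?Z \<subseteq> A \<or> ?Z \<subseteq> B"
      using jet_component_irreducible[OF F(1) G(1), of lam] AB ZL by blast
  qed
  have maximal: "T = ?Z" if T: "irreducible_set ?X T" and sub: "?Z \<subseteq> T" for T
  proof -
    \<comment> \<open>Irreducibility in the subspace is applied to the traces of ambient closed
      sets.\<close>
    have split: "T \<subseteq> A \<or> T \<subseteq> B"
      if "closedin (zariski ?V) A" "closedin (zariski ?V) B" "T \<subseteq> A \<union> B" for A B
    proof -
      have "closedin ?X (A \<inter> ?L)" "closedin ?X (B \<inter> ?L)"
        using that by (auto simp: closedin_subtopology)
      moreover have TL: "T \<subseteq> ?L"
        using T by (auto simp: irreducible_set_def)
      then have "T \<subseteq> (A \<inter> ?L) \<union> (B \<inter> ?L)"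
        using that(3) by blast
      ultimately show ?thesis
        using T unfolding irreducible_set_def by blast
    qed
    \<comment> \<open>Empty for \<open>d = p\<close>, in accordance with \<open>cover\<close>;
      \<open>T\<close> contains the nonempty \<open>?Z\<close> and so cannot lie in it.\<close>
    define Y2 where "Y2 = (if d < p then Y (r + 1) else {})"
    have Y2: "closedin (zariski ?V) Y2"
      using closed_Y by (simp add: Y2_def)
    have "T \<subseteq> ?L"
      using T by (auto simp: irreducible_set_def)
    then have "T \<subseteq> ?Z \<union> (Y (r - 1) \<union> Y2)"
      using cover by (auto simp: Y2_def)
    then have "T \<subseteq> ?Z \<or> T \<subseteq> Y (r - 1) \<union> Y2"
      using closed_Z closed_Y Y2 by (intro split closedin_Un)
    then have "T \<subseteq> ?Z \<or> T \<subseteq> Y (r - 1) \<or> T \<subseteq> Y2"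
      using split closed_Y Y2 by blast
    moreover have "\<not> T \<subseteq> Y2"
      using sub not_Y2 delta_jet_in_component[of m n p lam, where 'a = 'a] by (auto simp: Y2_def)
    ultimately show ?thesis
      using sub not_Y1 by blast
  qed
  show ?thesis
    unfolding \<Omega> irreducible_components_def using irr maximal by blast
qed

end
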